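(* Let $(M,g(t))$ be a solution to the abstract geometric flow $\frac{\partial g}{\partial t}=-2\alpha$ on a time interval contained in $(T,\infty)$, and let $\sigma=t-T>0$. Assume that $\phi_+$ satisfies $$\frac{\partial\phi_+}{\partial t}=-\Delta\phi_++|\nabla\phi_+|^2-A-\frac{n}{2(t-T)}$$ such that $$\int_M(4\pi\sigma)^{-n/2}e^{-\phi_+}\,dy=1.$$ Then $$\frac{d}{dt}\mathcal{W}_+(g(t),\phi_+(t),t)=\int_M 2\sigma\left(\left|\alpha+\nabla\nabla\phi_++\frac{1}{2(t-T)}g\right|^2+\Theta(-\nabla\phi_+)\right)(4\pi\sigma)^{-n/2}e^{-\phi_+}\,dy.$$ Furthermore, if $\Theta\ge0$ then $\mathcal{W}_+$ is monotone nondecreasing, and the monotonicity is strict unless $$\alpha+\nabla\nabla\phi_++\frac{1}{2(t-T)}g=0,\qquad \Theta(-\nabla\phi_+)=0$$ (that is, if $\frac{d}{dt}\mathcal{W}_+=0$ at some time, then these identities hold on $M$ at that time).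
   Context: $M$ is a compact $n$-dimensional manifold without boundary and $T$ is a fixed constant. An abstract geometric flow is a smooth one-parameter family of Riemannian metrics $g(t)$ on $M$ (here with $t>T$) together with a smooth time-dependent symmetric two-tensor $\alpha(t,y)$ on $M$ such that $\frac{\partial g}{\partial t}=-2\alpha$. At time $t$ all geometric objects (inner products, norms, the Levi-Civita connection $\nabla$, the Hessian $\nabla\nabla$, the Laplace-Beltrami operator $\Delta$, the Riemannian volume $dy$, the Ricci tensor $\mathrm{Rc}$) are taken with respect to $g(t)$. Notation: $A:=g^{ij}\alpha_{ij}$, $\beta_{ij}:=\frac{\partial\alpha_{ij}}{\partial t}$, $B:=g^{ij}\beta_{ij}$, and $\mathrm{Div}(\alpha)_k=g^{ij}\nabla_i\alpha_{jk}$. For any time-dependent vector field $V$ on $M$, $$\Theta(V):=(\mathrm{Rc}-\alpha)(V,V)+\langle\nabla A-2\,\mathrm{Div}(\alpha),V\rangle+\tfrac12(B-\Delta A).$$ $\Theta\ge0$ means $\Theta(V)\ge 0$ for all $V$. Functions $\phi_+(t,y)$ are smooth. Perelman's entropy for expanders is $$\mathcal{W}_+(g,\phi_+,t)=\int_M\left(\sigma\left(|\nabla\phi_+|^2+A\right)-\phi_++n\right)(4\pi\sigma)^{-n/2}e^{-\phi_+}\,dy,\qquad \sigma=t-T.$$ *)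

theory Defs
  imports "HOL-Analysis.Analysis"
begin

section \<open>Smooth functions\<close>

text \<open>Derivatives are taken within the set, so that the definitions apply to products of a (possibly not
  open) nondegenerate time interval with an open set of coordinates; at an end point of the interval
  the time derivatives are one-sided. On such sets the derivative \<open>f'\<close> is unique.\<close>

primrec Ck_on :: "nat \<Rightarrow> ('a::real_normed_vector \<Rightarrow> 'b::real_normed_vector) \<Rightarrow> 'a set \<Rightarrow> bool" where
  "Ck_on 0 f S \<longleftrightarrow> continuous_on S f"
| "Ck_on (Suc k) f S \<longleftrightarrow>
     (\<exists>f'. (\<forall>x\<in>S. (f has_derivative f' x) (at x within S)) \<and> (\<forall>v. Ck_on k (\<lambda>x. f' x v) S))"

definition smooth_on :: "('a::real_normed_vector \<Rightarrow> 'b::real_normed_vector) \<Rightarrow> 'a set \<Rightarrow> bool" where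
  "smooth_on f S \<longleftrightarrow> (\<forall>k. Ck_on k f S)"

section \<open>Manifolds\<close>

text \<open>The manifold is the whole type \<open>'m\<close>, of dimension \<open>CARD('n)\<close>. A chart is a pair of its
  domain and its coordinate map.\<close>

type_synonym ('m, 'n) chart = "'m set \<times> ('m \<Rightarrow> real ^ 'n)"

abbreviation dom_of :: "('m, 'n) chart \<Rightarrow> 'm set" where "dom_of c \<equiv> fst c"
abbreviation coord :: "('m, 'n) chart \<Rightarrow> 'm \<Rightarrow> real ^ 'n" where "coord c \<equiv> snd c"

abbreviation range_of :: "('m, 'n) chart \<Rightarrow> (real ^ 'n) set" where
  "range_of c \<equiv> coord c ` dom_of c"

definition inv_coord :: "('m, 'n) chart \<Rightarrow> real ^ 'n \<Rightarrow> 'm" where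
  "inv_coord c = inv_into (dom_of c) (coord c)"

definition is_chart :: "('m::topological_space, 'n::finite) chart \<Rightarrow> bool" where
  "is_chart c \<longleftrightarrow> open (dom_of c) \<and> open (range_of c) \<and>
     homeomorphism (dom_of c) (range_of c) (coord c) (inv_coord c)"

definition smooth_atlas :: "('m::topological_space, 'n::finite) chart set \<Rightarrow> bool" where
  "smooth_atlas \<A> \<longleftrightarrow> (\<forall>c\<in>\<A>. is_chart c) \<and> (\<Union>c\<in>\<A>. dom_of c) = UNIV \<and>
     (\<forall>c\<in>\<A>. \<forall>d\<in>\<A>. smooth_on (coord d \<circ> inv_coord c) (coord c ` (dom_of c \<inter> dom_of d)))"

text \<open>The Jacobian matrix of the change of coordinates from \<open>c\<close> to \<open>d\<close>; its entry in row \<open>k\<close> and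
  column \<open>i\<close> is the derivative of the \<open>k\<close>-th coordinate of \<open>d\<close> by the \<open>i\<close>-th coordinate of \<open>c\<close>.\<close>

definition transition_jacobian ::
    "('m, 'n::finite) chart \<Rightarrow> ('m, 'n) chart \<Rightarrow> 'm \<Rightarrow> real ^ 'n ^ 'n" where
  "transition_jacobian c d p = jacobian (coord d \<circ> inv_coord c) (at (coord c p))"

section \<open>Tensor fields\<close>

text \<open>Vector fields and covariant two-tensors are given by their components in the charts of the
  atlas, subject to the usual transformation law. The values of such a function for a chart outside
  the atlas, or at a point outside the domain of the chart, have no meaning.\<close>

type_synonym ('m, 'n) vfield = "('m, 'n) chart \<Rightarrow> 'm \<Rightarrow> real ^ 'n"
type_synonym ('m, 'n) tensor2 = "('m, 'n) chart \<Rightarrow> 'm \<Rightarrow> real ^ 'n ^ 'n"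

definition is_vector_field :: "('m, 'n::finite) chart set \<Rightarrow> ('m, 'n) vfield \<Rightarrow> bool" where
  "is_vector_field \<A> V \<longleftrightarrow> (\<forall>c\<in>\<A>. \<forall>d\<in>\<A>. \<forall>p\<in>dom_of c \<inter> dom_of d.
     V d p = transition_jacobian c d p *v V c p)"

definition is_symmetric_tensor :: "('m, 'n::finite) chart set \<Rightarrow> ('m, 'n) tensor2 \<Rightarrow> bool" where
  "is_symmetric_tensor \<A> S \<longleftrightarrow> (\<forall>c\<in>\<A>. \<forall>p\<in>dom_of c. transpose (S c p) = S c p) \<and>
     (\<forall>c\<in>\<A>. \<forall>d\<in>\<A>. \<forall>p\<in>dom_of c \<inter> dom_of d.
        S c p = transpose (transition_jacobian c d p) ** S d p ** transition_jacobian c d p)"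

definition is_riemannian_metric :: "('m, 'n::finite) chart set \<Rightarrow> ('m, 'n) tensor2 \<Rightarrow> bool" where
  "is_riemannian_metric \<A> g \<longleftrightarrow> is_symmetric_tensor \<A> g \<and>
     (\<forall>c\<in>\<A>. \<forall>p\<in>dom_of c. \<forall>v. v \<noteq> 0 \<longrightarrow> v \<bullet> (g c p *v v) > 0)"

text \<open>Time-dependent objects on a time interval \<open>I\<close> are smooth jointly in time and space.\<close>

definition smooth_scalar :: "('m, 'n::finite) chart set \<Rightarrow> real set \<Rightarrow> (real \<Rightarrow> 'm \<Rightarrow> real) \<Rightarrow> bool" where
  "smooth_scalar \<A> I f \<longleftrightarrow>
     (\<forall>c\<in>\<A>. smooth_on (\<lambda>(t, y). f t (inv_coord c y)) (I \<times> range_of c))"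

definition smooth_vector_field ::
    "('m, 'n::finite) chart set \<Rightarrow> real set \<Rightarrow> (real \<Rightarrow> ('m, 'n) vfield) \<Rightarrow> bool" where
  "smooth_vector_field \<A> I V \<longleftrightarrow> (\<forall>t\<in>I. is_vector_field \<A> (V t)) \<and>
     (\<forall>c\<in>\<A>. smooth_on (\<lambda>(t, y). V t c (inv_coord c y)) (I \<times> range_of c))"

definition smooth_symmetric_tensor ::
    "('m, 'n::finite) chart set \<Rightarrow> real set \<Rightarrow> (real \<Rightarrow> ('m, 'n) tensor2) \<Rightarrow> bool" where
  "smooth_symmetric_tensor \<A> I S \<longleftrightarrow> (\<forall>t\<in>I. is_symmetric_tensor \<A> (S t)) \<and>
     (\<forall>c\<in>\<A>. smooth_on (\<lambda>(t, y). S t c (inv_coord c y)) (I \<times> range_of c))"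

section \<open>Riemannian geometry in a chart\<close>

text \<open>In this section \<open>c\<close> is a chart and \<open>p\<close> a point of its domain; indices refer to the
  coordinates of \<open>c\<close>. Local functions are functions of the point, not of its coordinates.\<close>

definition pd :: "('m, 'n::finite) chart \<Rightarrow> 'n \<Rightarrow> ('m \<Rightarrow> real) \<Rightarrow> 'm \<Rightarrow> real" where
  "pd c i f p = frechet_derivative (f \<circ> inv_coord c) (at (coord c p)) (axis i 1)"

definition ginv :: "('m, 'n::finite) tensor2 \<Rightarrow> ('m, 'n) tensor2" where
  "ginv g c p = matrix_inv (g c p)"

definition christoffel ::
    "('m, 'n::finite) tensor2 \<Rightarrow> ('m, 'n) chart \<Rightarrow> 'n \<Rightarrow> 'n \<Rightarrow> 'n \<Rightarrow> 'm \<Rightarrow> real" where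
  "christoffel g c k i j p = (\<Sum>l\<in>UNIV. 1/2 * ginv g c p $ k $ l *
     (pd c i (\<lambda>q. g c q $ j $ l) p + pd c j (\<lambda>q. g c q $ i $ l) p - pd c l (\<lambda>q. g c q $ i $ j) p))"

text \<open>\<open>riemann g c l k i j\<close> is the \<open>l\<close>-th component of
  \<open>\<nabla>\<^sub>i \<nabla>\<^sub>j \<partial>\<^sub>k - \<nabla>\<^sub>j \<nabla>\<^sub>i \<partial>\<^sub>k\<close>; with this sign the Ricci tensor below is positive on round spheres.\<close>

definition riemann ::
    "('m, 'n::finite) tensor2 \<Rightarrow> ('m, 'n) chart \<Rightarrow> 'n \<Rightarrow> 'n \<Rightarrow> 'n \<Rightarrow> 'n \<Rightarrow> 'm \<Rightarrow> real" where
  "riemann g c l k i j p = pd c i (christoffel g c l j k) p - pd c j (christoffel g c l i k) p +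
     (\<Sum>m\<in>UNIV. christoffel g c l i m p * christoffel g c m j k p
              - christoffel g c l j m p * christoffel g c m i k p)"

definition ricci :: "('m, 'n::finite) tensor2 \<Rightarrow> ('m, 'n) tensor2" where
  "ricci g c p = (\<chi> j k. \<Sum>i\<in>UNIV. riemann g c i k i j p)"

definition hessian :: "('m, 'n::finite) tensor2 \<Rightarrow> ('m \<Rightarrow> real) \<Rightarrow> ('m, 'n) tensor2" where
  "hessian g f c p = (\<chi> i j. pd c i (pd c j f) p - (\<Sum>k\<in>UNIV. christoffel g c k i j p * pd c k f p))"

definition gradient :: "('m, 'n::finite) tensor2 \<Rightarrow> ('m \<Rightarrow> real) \<Rightarrow> ('m, 'n) vfield" where
  "gradient g f c p = (\<chi> i. \<Sum>j\<in>UNIV. ginv g c p $ i $ j * pd c j f p)"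

definition inner_at :: "('m, 'n::finite) tensor2 \<Rightarrow> ('m, 'n) chart \<Rightarrow> 'm \<Rightarrow> real ^ 'n \<Rightarrow> real ^ 'n \<Rightarrow> real" where
  "inner_at g c p v w = (\<Sum>i\<in>UNIV. \<Sum>j\<in>UNIV. g c p $ i $ j * v $ i * w $ j)"

definition trace_of :: "('m, 'n::finite) tensor2 \<Rightarrow> ('m, 'n) tensor2 \<Rightarrow> ('m, 'n) chart \<Rightarrow> 'm \<Rightarrow> real" where
  "trace_of g S c p = (\<Sum>i\<in>UNIV. \<Sum>j\<in>UNIV. ginv g c p $ i $ j * S c p $ i $ j)"

definition tensor_norm_sq ::
    "('m, 'n::finite) tensor2 \<Rightarrow> ('m, 'n) tensor2 \<Rightarrow> ('m, 'n) chart \<Rightarrow> 'm \<Rightarrow> real" where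
  "tensor_norm_sq g S c p = (\<Sum>i\<in>UNIV. \<Sum>j\<in>UNIV. \<Sum>k\<in>UNIV. \<Sum>l\<in>UNIV.
     ginv g c p $ i $ k * ginv g c p $ j $ l * S c p $ i $ j * S c p $ k $ l)"

definition laplacian :: "('m, 'n::finite) tensor2 \<Rightarrow> ('m \<Rightarrow> real) \<Rightarrow> ('m, 'n) chart \<Rightarrow> 'm \<Rightarrow> real" where
  "laplacian g f c p = trace_of g (hessian g f) c p"

definition nabla_tensor ::
    "('m, 'n::finite) tensor2 \<Rightarrow> ('m, 'n) tensor2 \<Rightarrow> ('m, 'n) chart \<Rightarrow> 'n \<Rightarrow> 'n \<Rightarrow> 'n \<Rightarrow> 'm \<Rightarrow> real" where
  "nabla_tensor g S c i j k p = pd c i (\<lambda>q. S c q $ j $ k) p -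
     (\<Sum>l\<in>UNIV. christoffel g c l i j p * S c p $ l $ k + christoffel g c l i k p * S c p $ j $ l)"

definition Div :: "('m, 'n::finite) tensor2 \<Rightarrow> ('m, 'n) tensor2 \<Rightarrow> ('m, 'n) chart \<Rightarrow> 'n \<Rightarrow> 'm \<Rightarrow> real" where
  "Div g S c k p = (\<Sum>i\<in>UNIV. \<Sum>j\<in>UNIV. ginv g c p $ i $ j * nabla_tensor g S c i j k p)"

section \<open>Scalars on the manifold and integration\<close>

definition chart_at :: "('m, 'n) chart set \<Rightarrow> 'm \<Rightarrow> ('m, 'n) chart" where
  "chart_at \<A> p = (SOME c. c \<in> \<A> \<and> p \<in> dom_of c)"

text \<open>The function on the manifold whose expression in every chart \<open>c\<close> is \<open>F c\<close>. It is used only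
  for expressions \<open>F\<close> that do not depend on the chart, so the choice of the chart is immaterial.\<close>

definition on_M :: "('m, 'n) chart set \<Rightarrow> (('m, 'n) chart \<Rightarrow> 'm \<Rightarrow> real) \<Rightarrow> 'm \<Rightarrow> real" where
  "on_M \<A> F p = F (chart_at \<A> p) p"

text \<open>The Riemannian volume is the Borel measure with density \<open>sqrt (det g)\<close> in every chart; no
  orientation is needed.\<close>

definition riemannian_volume ::
    "('m::topological_space, 'n::finite) chart set \<Rightarrow> ('m, 'n) tensor2 \<Rightarrow> 'm measure" where
  "riemannian_volume \<A> g = (THE \<mu>. sets \<mu> = sets borel \<and>
     (\<forall>c\<in>\<A>. \<forall>S\<in>sets borel. S \<subseteq> dom_of c \<longrightarrow>
        emeasure \<mu> S =
          (\<integral>\<^sup>+ y \<in> coord c ` S. ennreal (sqrt (det (g c (inv_coord c y)))) \<partial>lborel)))"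

section \<open>Abstract geometric flows\<close>

definition abstract_geometric_flow ::
    "('m, 'n::finite) chart set \<Rightarrow> real set \<Rightarrow> (real \<Rightarrow> ('m, 'n) tensor2) \<Rightarrow> (real \<Rightarrow> ('m, 'n) tensor2) \<Rightarrow> bool" where
  "abstract_geometric_flow \<A> I g \<alpha> \<longleftrightarrow>
     smooth_symmetric_tensor \<A> I g \<and> (\<forall>t\<in>I. is_riemannian_metric \<A> (g t)) \<and>
     smooth_symmetric_tensor \<A> I \<alpha> \<and>
     (\<forall>c\<in>\<A>. \<forall>p\<in>dom_of c. \<forall>t\<in>I.
        ((\<lambda>s. g s c p) has_vector_derivative (-2) *\<^sub>R \<alpha> t c p) (at t within I))"

definition time_deriv :: "real set \<Rightarrow> (real \<Rightarrow> ('m, 'n::finite) tensor2) \<Rightarrow> real \<Rightarrow> ('m, 'n) tensor2" where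
  "time_deriv I \<alpha> t c p = vector_derivative (\<lambda>s. \<alpha> s c p) (at t within I)"

text \<open>\<open>\<Theta>(V)\<close> at time \<open>t\<close>. The pairing \<open>\<langle>\<nabla>A - 2 Div(\<alpha>), V\<rangle>\<close> is written
  as the value of the one-form \<open>dA - 2 Div(\<alpha>)\<close> on \<open>V\<close>.\<close>

definition Theta_local ::
    "real set \<Rightarrow> (real \<Rightarrow> ('m, 'n::finite) tensor2) \<Rightarrow> (real \<Rightarrow> ('m, 'n) tensor2) \<Rightarrow> real \<Rightarrow>
     ('m, 'n) vfield \<Rightarrow> ('m, 'n) chart \<Rightarrow> 'm \<Rightarrow> real" where
  "Theta_local I g \<alpha> t V c p =
     (\<Sum>i\<in>UNIV. \<Sum>j\<in>UNIV. (ricci (g t) c p - \<alpha> t c p) $ i $ j * V c p $ i * V c p $ j) +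
     (\<Sum>k\<in>UNIV. (pd c k (trace_of (g t) (\<alpha> t) c) p - 2 * Div (g t) (\<alpha> t) c k p) * V c p $ k) +
     1/2 * (trace_of (g t) (time_deriv I \<alpha> t) c p - laplacian (g t) (trace_of (g t) (\<alpha> t) c) c p)"

definition Theta ::
    "('m, 'n::finite) chart set \<Rightarrow> real set \<Rightarrow> (real \<Rightarrow> ('m, 'n) tensor2) \<Rightarrow> (real \<Rightarrow> ('m, 'n) tensor2) \<Rightarrow>
     real \<Rightarrow> ('m, 'n) vfield \<Rightarrow> 'm \<Rightarrow> real" where
  "Theta \<A> I g \<alpha> t V = on_M \<A> (Theta_local I g \<alpha> t V)"

definition Theta_nonneg ::
    "('m, 'n::finite) chart set \<Rightarrow> real set \<Rightarrow> (real \<Rightarrow> ('m, 'n) tensor2) \<Rightarrow> (real \<Rightarrow> ('m, 'n) tensor2) \<Rightarrow> bool" where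
  "Theta_nonneg \<A> I g \<alpha> \<longleftrightarrow>
     (\<forall>V. smooth_vector_field \<A> I V \<longrightarrow> (\<forall>t\<in>I. \<forall>p. Theta \<A> I g \<alpha> t (V t) p \<ge> 0))"

definition trace_M :: "('m, 'n::finite) chart set \<Rightarrow> ('m, 'n) tensor2 \<Rightarrow> ('m, 'n) tensor2 \<Rightarrow> 'm \<Rightarrow> real" where
  "trace_M \<A> g S = on_M \<A> (trace_of g S)"

definition laplacian_M :: "('m, 'n::finite) chart set \<Rightarrow> ('m, 'n) tensor2 \<Rightarrow> ('m \<Rightarrow> real) \<Rightarrow> 'm \<Rightarrow> real" where
  "laplacian_M \<A> g f = on_M \<A> (laplacian g f)"

definition gradient_norm_sq ::
    "('m, 'n::finite) chart set \<Rightarrow> ('m, 'n) tensor2 \<Rightarrow> ('m \<Rightarrow> real) \<Rightarrow> 'm \<Rightarrow> real" where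
  "gradient_norm_sq \<A> g f =
     on_M \<A> (\<lambda>c p. inner_at g c p (gradient g f c p) (gradient g f c p))"

definition norm_sq_M :: "('m, 'n::finite) chart set \<Rightarrow> ('m, 'n) tensor2 \<Rightarrow> ('m, 'n) tensor2 \<Rightarrow> 'm \<Rightarrow> real" where
  "norm_sq_M \<A> g S = on_M \<A> (tensor_norm_sq g S)"

section \<open>The expander entropy\<close>

text \<open>The density \<open>(4 \<pi> \<sigma>) powr (-n/2) * exp (-\<phi>)\<close> with \<open>\<sigma> = t - T\<close>. The atlas is an argument only because its
  type determines the dimension \<open>n = CARD('n)\<close>.\<close>

definition weight :: "('m, 'n::finite) chart set \<Rightarrow> real \<Rightarrow> (real \<Rightarrow> 'm \<Rightarrow> real) \<Rightarrow> real \<Rightarrow> 'm \<Rightarrow> real" where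
  "weight \<A> T \<phi> t p = (4 * pi * (t - T)) powr (- real CARD('n) / 2) * exp (- \<phi> t p)"

definition expander_entropy ::
    "('m::topological_space, 'n::finite) chart set \<Rightarrow> real \<Rightarrow> (real \<Rightarrow> ('m, 'n) tensor2) \<Rightarrow>
     (real \<Rightarrow> ('m, 'n) tensor2) \<Rightarrow> (real \<Rightarrow> 'm \<Rightarrow> real) \<Rightarrow> real \<Rightarrow> real" where
  "expander_entropy \<A> T g \<alpha> \<phi> t =
     (\<integral>p. ((t - T) * (gradient_norm_sq \<A> (g t) (\<phi> t) p + trace_M \<A> (g t) (\<alpha> t) p)
             - \<phi> t p + real CARD('n)) * weight \<A> T \<phi> t p \<partial>riemannian_volume \<A> (g t))"

definition expander_tensor ::
    "real \<Rightarrow> (real \<Rightarrow> ('m, 'n::finite) tensor2) \<Rightarrow> (real \<Rightarrow> ('m, 'n) tensor2) \<Rightarrow>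
     (real \<Rightarrow> 'm \<Rightarrow> real) \<Rightarrow> real \<Rightarrow> ('m, 'n) tensor2" where
  "expander_tensor T g \<alpha> \<phi> t c p =
     \<alpha> t c p + hessian (g t) (\<phi> t) c p + (1 / (2 * (t - T))) *\<^sub>R g t c p"

definition neg_gradient :: "('m, 'n::finite) tensor2 \<Rightarrow> ('m \<Rightarrow> real) \<Rightarrow> ('m, 'n) vfield" where
  "neg_gradient g f c p = - gradient g f c p"

end

theory Submission
  imports Defs
begin

text \<open>
  Put \<open>u = (4\<pi>\<sigma>) powr (-n/2) exp (- \<phi>)\<close> and \<open>w = \<sigma> (2 \<Delta>\<phi> - |\<nabla>\<phi>|\<^sup>2 + A) - \<phi> + n\<close>.  Since \<open>\<nabla>u = - u \<nabla>\<phi>\<close>,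
  Green's formula turns the entropy into \<open>\<integral> w u\<close>.  The Bochner formula together with the evolution of
  the metric, its inverse and the Laplacian gives the pointwise identity
  \<open>\<partial>\<^sub>t w + \<Delta>w - 2 \<langle>\<nabla>\<phi>, \<nabla>w\<rangle> = 2\<sigma> (|\<alpha> + \<nabla>\<nabla>\<phi> + g/(2\<sigma>)|\<^sup>2 + \<Theta>(- \<nabla>\<phi>))\<close>,
  while \<open>\<partial>\<^sub>t u = u (\<Delta>\<phi> - |\<nabla>\<phi>|\<^sup>2 + A)\<close> and the volume form has logarithmic derivative \<open>- A\<close>.  Hence the
  derivative of \<open>\<integral> w u\<close> is the integral of \<open>u\<close> times this expression, up to
  \<open>\<integral> (w u \<Delta>\<phi> + \<langle>\<nabla>\<phi>, \<nabla>(w u)\<rangle>)\<close> and \<open>\<integral> (u \<Delta>w + \<langle>\<nabla>u, \<nabla>w\<rangle>)\<close>, which vanish by Green's formula.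

  All local identities are verified in a chart.  The chart independence of the Hessian, and with it that
  of the Laplacian, comes from the polarisation
  \<open>2 Hess f(\<nabla>a, \<nabla>b) = \<langle>\<nabla>a, \<nabla>\<langle>\<nabla>f, \<nabla>b\<rangle>\<rangle> + \<langle>\<nabla>b, \<nabla>\<langle>\<nabla>f, \<nabla>a\<rangle>\<rangle> - \<langle>\<nabla>f, \<nabla>\<langle>\<nabla>a, \<nabla>b\<rangle>\<rangle>\<close>,
  whose right-hand side involves only first derivatives of scalars.
\<close>

subsection \<open>Functions of class \<open>C\<^sup>k\<close> on a set\<close>

text \<open>Time is treated as one more coordinate: in a chart every object becomes a scalar
  function on \<open>I \<times> U\<close>, and the derivatives in time and in space are both
  instances of \<open>dirD\<close>. As \<open>I\<close> may contain an end point, this set need not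
  be open; uniqueness and commutation of derivatives rest on the room it leaves in the coordinate
  directions. The entropy density is replaced by w because the two differ by
  2\<sigma>(\<Delta>\<phi> - |\<nabla>\<phi>|^2), whose integral against u is 0. Only the contracted
  Christoffel symbol enters the evolution of the Laplacian; being the logarithmic derivative of the
  volume density, it spares the variation of the full connection. The volume is a definite
  description, so existence and uniqueness are proved by gluing chart measures. Green's formula and
  differentiation under the integral are reduced to one chart by a partition of unity of class C^1,
  enough because a single derivative falls on it. In the equality case a continuous nonnegative
  integrand with integral 0 vanishes, because nonempty open sets have positive volume.\<close>

declare Ck_on.simps(2) [simp del]

lemma Ck_on_SucI:
  "(\<And>x. x \<in> S \<Longrightarrow> (f has_derivative f' x) (at x within S)) \<Longrightarrow>
    (\<And>v. Ck_on k (\<lambda>x. f' x v) S) \<Longrightarrow> Ck_on (Suc k) f S"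
  unfolding Ck_on.simps(2) by blast

lemma Ck_on_SucE:
  assumes "Ck_on (Suc k) f S"
  obtains f' where "\<And>x. x \<in> S \<Longrightarrow> (f has_derivative f' x) (at x within S)"
    "\<And>v. Ck_on k (\<lambda>x. f' x v) S"
  using assms unfolding Ck_on.simps(2) by blast

lemma Ck_on_cong:
  assumes "\<And>x. x \<in> S \<Longrightarrow> f x = g x"
  shows "Ck_on k f S \<longleftrightarrow> Ck_on k g S"
proof -
  have "Ck_on k g S" if "Ck_on k f S" and eq: "\<And>x. x \<in> S \<Longrightarrow> f x = g x" for f g
  proof (cases k)
    case 0
    with that show ?thesis
      by (simp add: continuous_on_cong[of S S f g])
  next
    case (Suc j)
    with that(1) obtain f' where f': "\<And>x. x \<in> S \<Longrightarrow> (f has_derivative f' x) (at x within S)"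
      "\<And>v. Ck_on j (\<lambda>x. f' x v) S" by (metis Ck_on_SucE)
    have "(g has_derivative f' x) (at x within S)" if "x \<in> S" for x
      by (rule has_derivative_transform[OF that _ f'(1)[OF that]]) (simp add: eq)
    with f'(2) Suc show ?thesis by (metis Ck_on_SucI)
  qed
  from this[of f g] this[of g f] assms show ?thesis by auto
qed

lemma Ck_on_Suc_imp: "Ck_on (Suc k) f S \<Longrightarrow> Ck_on k f S"
proof (induction k arbitrary: f)
  case 0
  then show ?case
    by (auto simp: continuous_on_eq_continuous_within elim!: Ck_on_SucE intro: has_derivative_continuous)
next
  case (Suc k)
  from Suc.prems obtain f' where f': "\<And>x. x \<in> S \<Longrightarrow> (f has_derivative f' x) (at x within S)"
      "\<And>v. Ck_on (Suc k) (\<lambda>x. f' x v) S" by (metis Ck_on_SucE)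
  show ?case by (rule Ck_on_SucI[OF f'(1)]) (auto intro: Suc.IH f'(2))
qed

lemma Ck_on_imp_continuous_on: "Ck_on k f S \<Longrightarrow> continuous_on S f"
proof (induction k)
  case (Suc k)
  then show ?case using Ck_on_Suc_imp by blast
qed simp

lemma Ck_on_subset: "Ck_on k f S \<Longrightarrow> T \<subseteq> S \<Longrightarrow> Ck_on k f T"
proof (induction k arbitrary: f)
  case 0
  then show ?case by (auto intro: continuous_on_subset)
next
  case (Suc k)
  from Suc.prems obtain f' where f': "\<And>x. x \<in> S \<Longrightarrow> (f has_derivative f' x) (at x within S)"
      "\<And>v. Ck_on k (\<lambda>x. f' x v) S" by (metis Ck_on_SucE)
  show ?case using Suc.prems(2)
    by (intro Ck_on_SucI[where f'=f'] Suc.IH f') (auto intro: has_derivative_subset[OF f'(1)])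
qed

lemma Ck_on_const: "Ck_on k (\<lambda>x. c) S"
  by (induction k arbitrary: c) (auto intro!: Ck_on_SucI[where f'="\<lambda>x v. 0"])

lemma Ck_on_bounded_linear_compose:
  assumes "bounded_linear L" "Ck_on k f S"
  shows "Ck_on k (\<lambda>x. L (f x)) S"
  using assms(2)
proof (induction k arbitrary: f)
  case 0
  then show ?case using assms(1) by (auto intro: bounded_linear.continuous_on)
next
  case (Suc k)
  from Suc.prems obtain f' where f': "\<And>x. x \<in> S \<Longrightarrow> (f has_derivative f' x) (at x within S)"
      "\<And>v. Ck_on k (\<lambda>x. f' x v) S" by (metis Ck_on_SucE)
  show ?case
    by (intro Ck_on_SucI[where f'="\<lambda>x v. L (f' x v)"] bounded_linear.has_derivative[OF assms(1)] f' Suc.IH)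
qed

text \<open>The shift \<open>a\<close> makes the slice y \<mapsto> (t, y) an instance, as (t, 0) +
  (0, y). With \<open>a = 0\<close> and a projection for \<open>L\<close>, functions of time alone
  or of space alone are lifted to the product.\<close>

lemma Ck_on_affine_precompose:
  assumes "bounded_linear L" "Ck_on k f S" "\<And>x. x \<in> T \<Longrightarrow> a + L x \<in> S"
  shows "Ck_on k (\<lambda>x. f (a + L x)) T"
  using assms(2)
proof (induction k arbitrary: f)
  case 0
  then show ?case using assms(1,3)
    by (auto intro!: continuous_on_compose2[of S f] continuous_intros bounded_linear.continuous_on[of L])
next
  case (Suc k)
  from Suc.prems obtain f' where f': "\<And>x. x \<in> S \<Longrightarrow> (f has_derivative f' x) (at x within S)"
      "\<And>v. Ck_on k (\<lambda>x. f' x v) S" by (metis Ck_on_SucE)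
  have "((\<lambda>x. f (a + L x)) has_derivative (\<lambda>v. f' (a + L x) (L v))) (at x within T)" if "x \<in> T" for x
    by (rule has_derivative_in_compose2[of S f f'])
       (use f' that assms in \<open>auto intro!: derivative_eq_intros bounded_linear.has_derivative[OF assms(1)]\<close>)
  then show ?case using Suc.IH[OF f'(2)]
    by (rule Ck_on_SucI)
qed

lemma Ck_on_add: "Ck_on k f S \<Longrightarrow> Ck_on k g S \<Longrightarrow> Ck_on k (\<lambda>x. f x + g x) S"
proof (induction k arbitrary: f g)
  case 0
  then show ?case by (auto intro: continuous_intros)
next
  case (Suc k)
  from Suc.prems obtain f' g' where f': "\<And>x. x \<in> S \<Longrightarrow> (f has_derivative f' x) (at x within S)"
      "\<And>v. Ck_on k (\<lambda>x. f' x v) S"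
      "\<And>x. x \<in> S \<Longrightarrow> (g has_derivative g' x) (at x within S)"
      "\<And>v. Ck_on k (\<lambda>x. g' x v) S" by (metis Ck_on_SucE)
  show ?case
    by (intro Ck_on_SucI[where f'="\<lambda>x v. f' x v + g' x v"] has_derivative_add f' Suc.IH)
qed

lemma Ck_on_uminus: "Ck_on k f S \<Longrightarrow> Ck_on k (\<lambda>x. - f x) S"
  by (rule Ck_on_bounded_linear_compose) (rule bounded_linear_minus[OF bounded_linear_ident])

lemma Ck_on_diff: "Ck_on k f S \<Longrightarrow> Ck_on k g S \<Longrightarrow> Ck_on k (\<lambda>x. f x - g x) S"
  using Ck_on_add[of k f S "\<lambda>x. - g x"] Ck_on_uminus[of k g S] by simp

lemma Ck_on_sum: "(\<And>i. i \<in> J \<Longrightarrow> Ck_on k (f i) S) \<Longrightarrow> Ck_on k (\<lambda>x. \<Sum>i\<in>J. f i x) S"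
  by (induction J rule: infinite_finite_induct) (auto intro: Ck_on_add Ck_on_const)

lemma Ck_on_mult:
  fixes f g :: "'a::real_normed_vector \<Rightarrow> real"
  shows "Ck_on k f S \<Longrightarrow> Ck_on k g S \<Longrightarrow> Ck_on k (\<lambda>x. f x * g x) S"
proof (induction k arbitrary: f g)
  case 0
  then show ?case by (auto intro: continuous_intros)
next
  case (Suc k)
  from Suc.prems obtain f' g' where f': "\<And>x. x \<in> S \<Longrightarrow> (f has_derivative f' x) (at x within S)"
      "\<And>v. Ck_on k (\<lambda>x. f' x v) S"
      "\<And>x. x \<in> S \<Longrightarrow> (g has_derivative g' x) (at x within S)"
      "\<And>v. Ck_on k (\<lambda>x. g' x v) S" by (metis Ck_on_SucE)
  show ?case
    by (intro Ck_on_SucI[where f'="\<lambda>x v. f x * g' x v + f' x v * g x"] has_derivative_mult Ck_on_add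
        f' Suc.IH Suc.prems[THEN Ck_on_Suc_imp])
qed

lemma Ck_on_prod:
  fixes f :: "'i \<Rightarrow> 'a::real_normed_vector \<Rightarrow> real"
  shows "(\<And>i. i \<in> J \<Longrightarrow> Ck_on k (f i) S) \<Longrightarrow> Ck_on k (\<lambda>x. \<Prod>i\<in>J. f i x) S"
  by (induction J rule: infinite_finite_induct) (auto intro: Ck_on_mult Ck_on_const)

text \<open>The derivative of the composite is \<open>f' x v\<close> times
  \<open>h' (f x) 1\<close>, again a composite with the same inner function, so the induction varies
  only \<open>h\<close>.\<close>

lemma Ck_on_compose_real:
  fixes f :: "'a::real_normed_vector \<Rightarrow> real" and h :: "real \<Rightarrow> real"
  assumes "Ck_on k f S" "Ck_on k h T" "\<And>x. x \<in> S \<Longrightarrow> f x \<in> T"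
  shows "Ck_on k (\<lambda>x. h (f x)) S"
  using assms(1,2)
proof (induction k arbitrary: h)
  case 0
  then show ?case using assms(3)
    by (auto intro!: continuous_on_compose2[of T h])
next
  case (Suc k)
  from Suc.prems obtain f' h' where f': "\<And>x. x \<in> S \<Longrightarrow> (f has_derivative f' x) (at x within S)"
      "\<And>v. Ck_on k (\<lambda>x. f' x v) S"
      "\<And>x. x \<in> T \<Longrightarrow> (h has_derivative h' x) (at x within T)"
      "\<And>v. Ck_on k (\<lambda>x. h' x v) T" by (metis Ck_on_SucE)
  have eq: "h' y v = h' y 1 * v" if "y \<in> T" for y v
    using linear_scale[OF has_derivative_linear[OF f'(3)[OF that]], of v 1] by simp
  have "((\<lambda>x. h (f x)) has_derivative (\<lambda>v. h' (f x) 1 * f' x v)) (at x within S)" if "x \<in> S" for x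
    by (rule has_derivative_eq_rhs[OF has_derivative_in_compose2[OF f'(3) _ that f'(1)[OF that]]])
       (use assms(3) that in \<open>auto intro: eq\<close>)
  moreover have "Ck_on k (\<lambda>x. h' (f x) 1 * f' x v) S" for v
    by (rule Ck_on_mult[OF Suc.IH[OF Ck_on_Suc_imp[OF Suc.prems(1)] f'(4)] f'(2)])
  ultimately show ?case by (rule Ck_on_SucI)
qed

lemma Ck_on_real_derivI:
  fixes f :: "real \<Rightarrow> real"
  assumes "\<And>x. x \<in> S \<Longrightarrow> (f has_real_derivative f' x) (at x within S)" "Ck_on k f' S"
  shows "Ck_on (Suc k) f S"
  by (rule Ck_on_SucI[where f'="\<lambda>x v. f' x * v"])
     (use assms in \<open>auto intro!: Ck_on_mult Ck_on_const simp: has_field_derivative_def\<close>)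

lemma Ck_on_exp: "Ck_on k (exp :: real \<Rightarrow> real) S"
  by (induction k)
     (auto intro!: Ck_on_real_derivI[where f'=exp] continuous_intros derivative_eq_intros)

text \<open>Differentiation lowers the exponent by one, so \<open>a\<close> varies in the induction.
  The inverse and the square root are the exponents -1 and 1/2.\<close>

lemma Ck_on_powr: "Ck_on k (\<lambda>x::real. x powr a) {0<..}"
proof (induction k arbitrary: a)
  case 0
  then show ?case by (auto intro!: continuous_intros)
next
  case (Suc k)
  show ?case
    by (rule Ck_on_real_derivI[where f'="\<lambda>x. a * x powr (a - 1)"])
       (auto intro!: derivative_eq_intros Ck_on_mult Ck_on_const Suc)
qed

lemma Ck_on_inverse_pos: "Ck_on k (\<lambda>x::real. inverse x) {0<..}"
proof -
  have "Ck_on k (\<lambda>x::real. inverse x) {0<..} \<longleftrightarrow> Ck_on k (\<lambda>x::real. x powr (-1)) {0<..}"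
    by (rule Ck_on_cong) (auto simp: powr_minus)
  with Ck_on_powr show ?thesis by blast
qed

lemma Ck_on_sqrt_pos: "Ck_on k sqrt {0<..}"
proof -
  have "Ck_on k sqrt {0<..} \<longleftrightarrow> Ck_on k (\<lambda>x::real. x powr (1/2)) {0<..}"
    by (rule Ck_on_cong) (auto simp: powr_half_sqrt)
  with Ck_on_powr show ?thesis by blast
qed

lemma smooth_on_cong: "(\<And>x. x \<in> S \<Longrightarrow> f x = g x) \<Longrightarrow> smooth_on f S \<longleftrightarrow> smooth_on g S"
  unfolding smooth_on_def using Ck_on_cong by blast

named_theorems smooth_intros

lemma smooth_on_const [smooth_intros]: "smooth_on (\<lambda>x. c) S"
  and smooth_on_add [smooth_intros]: "smooth_on f S \<Longrightarrow> smooth_on g S \<Longrightarrow> smooth_on (\<lambda>x. f x + g x) S"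
  and smooth_on_diff [smooth_intros]: "smooth_on f S \<Longrightarrow> smooth_on g S \<Longrightarrow> smooth_on (\<lambda>x. f x - g x) S"
  and smooth_on_uminus [smooth_intros]: "smooth_on f S \<Longrightarrow> smooth_on (\<lambda>x. - f x) S"
  and smooth_on_sum [smooth_intros]: "(\<And>i. i \<in> J \<Longrightarrow> smooth_on (F i) S) \<Longrightarrow> smooth_on (\<lambda>x. \<Sum>i\<in>J. F i x) S"
  for f g :: "'a::real_normed_vector \<Rightarrow> 'b::real_normed_vector"
  unfolding smooth_on_def by (auto intro: Ck_on_const Ck_on_add Ck_on_diff Ck_on_uminus Ck_on_sum)

lemma smooth_on_mult [smooth_intros]: "smooth_on f S \<Longrightarrow> smooth_on g S \<Longrightarrow> smooth_on (\<lambda>x. f x * g x) S"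
  and smooth_on_prod [smooth_intros]: "(\<And>i. i \<in> J \<Longrightarrow> smooth_on (F i) S) \<Longrightarrow> smooth_on (\<lambda>x. \<Prod>i\<in>J. F i x) S"
  and smooth_on_exp [smooth_intros]: "smooth_on f S \<Longrightarrow> smooth_on (\<lambda>x. exp (f x)) S"
  for F :: "'i \<Rightarrow> 'a::real_normed_vector \<Rightarrow> real" and f g :: "'a::real_normed_vector \<Rightarrow> real"
  unfolding smooth_on_def
  by (auto intro!: Ck_on_mult Ck_on_prod Ck_on_compose_real[where h=exp and T=UNIV] Ck_on_exp)

lemma smooth_on_sqrt: "smooth_on f S \<Longrightarrow> (\<And>x. x \<in> S \<Longrightarrow> f x > 0) \<Longrightarrow> smooth_on (\<lambda>x. sqrt (f x)) S"
  and smooth_on_inverse: "smooth_on f S \<Longrightarrow> (\<And>x. x \<in> S \<Longrightarrow> f x > 0) \<Longrightarrow> smooth_on (\<lambda>x. inverse (f x)) S"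
  and smooth_on_powr: "smooth_on f S \<Longrightarrow> (\<And>x. x \<in> S \<Longrightarrow> f x > 0) \<Longrightarrow> smooth_on (\<lambda>x. f x powr a) S"
  for f :: "'a::real_normed_vector \<Rightarrow> real"
  unfolding smooth_on_def
  by (auto intro!: Ck_on_compose_real[where h=sqrt and T="{0<..}"] Ck_on_sqrt_pos
      Ck_on_compose_real[where h=inverse and T="{0<..}"] Ck_on_inverse_pos
      Ck_on_compose_real[where h="\<lambda>x. x powr a" and T="{0<..}"] Ck_on_powr)

lemma smooth_on_bounded_linear_compose: "bounded_linear L \<Longrightarrow> smooth_on f S \<Longrightarrow> smooth_on (\<lambda>x. L (f x)) S"
  unfolding smooth_on_def by (auto intro: Ck_on_bounded_linear_compose)

lemma smooth_on_affine_precompose: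
  "smooth_on f S \<Longrightarrow> bounded_linear L \<Longrightarrow> (\<And>x. x \<in> T \<Longrightarrow> a + L x \<in> S) \<Longrightarrow> smooth_on (\<lambda>x. f (a + L x)) T"
  unfolding smooth_on_def by (auto intro: Ck_on_affine_precompose)

lemma smooth_on_subset: "smooth_on f S \<Longrightarrow> T \<subseteq> S \<Longrightarrow> smooth_on f T"
  unfolding smooth_on_def by (auto intro: Ck_on_subset)

lemma smooth_on_vec:
  fixes f :: "'a::real_normed_vector \<Rightarrow> real ^ 'n"
  assumes "\<And>i. smooth_on (\<lambda>x. f x $ i) S"
  shows "smooth_on f S"
proof -
  have "smooth_on (\<lambda>x. \<Sum>i\<in>UNIV. (f x $ i) *\<^sub>R axis i (1::real)) S"
    by (intro smooth_on_sum smooth_on_bounded_linear_compose[OF bounded_linear_scaleR_left] assms)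
  moreover have "(\<Sum>i\<in>UNIV. (f x $ i) *\<^sub>R axis i (1::real)) = f x" for x
    by (simp add: vec_eq_iff axis_def if_distrib cong: if_cong)
  ultimately show ?thesis by simp
qed

lemma smooth_on_imp_continuous_on: "smooth_on f S \<Longrightarrow> continuous_on S f"
  unfolding smooth_on_def using Ck_on_imp_continuous_on by blast

lemma smooth_on_imp_differentiable: "smooth_on f S \<Longrightarrow> x \<in> S \<Longrightarrow> f differentiable (at x within S)"
  unfolding smooth_on_def differentiable_def by (metis Ck_on_SucE)

subsection \<open>Directional derivatives\<close>

text \<open>Enough room in the coordinate directions for derivatives within the set to be unique.\<close>

definition ample :: "'a::euclidean_space set \<Rightarrow> bool" where
  "ample S \<longleftrightarrow> (\<forall>x\<in>S. \<forall>i\<in>Basis. \<forall>e>0. \<exists>d. 0 < \<bar>d\<bar> \<and> \<bar>d\<bar> < e \<and> x + d *\<^sub>R i \<in> S)"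

text \<open>The derivative is taken within the set, unlike that of \<open>pd\<close>. The direction
  is a vector of the whole space, so (1, 0) gives the time derivative and
  \<open>(0, axis i 1)\<close> a coordinate derivative.\<close>

definition dirD :: "'a::real_normed_vector set \<Rightarrow> 'a \<Rightarrow> ('a \<Rightarrow> 'b::real_normed_vector) \<Rightarrow> 'a \<Rightarrow> 'b" where
  "dirD S v F x = frechet_derivative F (at x within S) v"

lemma dirD_eqI:
  assumes "ample S" "x \<in> S" "(F has_derivative F') (at x within S)"
  shows "dirD S v F x = F' v"
proof -
  have "(F has_derivative frechet_derivative F (at x within S)) (at x within S)"
    using assms(3) frechet_derivative_works differentiable_def by blast
  then have "frechet_derivative F (at x within S) = F'"
    by (rule frechet_derivative_unique_within[OF _ assms(3)]) (use assms in \<open>auto simp: ample_def\<close>)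
  then show ?thesis by (simp add: dirD_def)
qed

lemma smooth_on_has_derivative:
  assumes "smooth_on F S" "x \<in> S"
  shows "(F has_derivative (\<lambda>v. dirD S v F x)) (at x within S)"
  using smooth_on_imp_differentiable[OF assms] unfolding dirD_def
  by (simp add: frechet_derivative_works)

text \<open>For every k the definition of smoothness provides a derivative that may depend on k;
  uniqueness on an ample set identifies all of them with \<open>dirD\<close>.\<close>

lemma smooth_on_dirD:
  assumes "ample S" "smooth_on F S"
  shows "smooth_on (\<lambda>x. dirD S v F x) S"
  unfolding smooth_on_def
proof
  fix k
  from assms(2) have "Ck_on (Suc k) F S" by (simp add: smooth_on_def)
  then obtain f' where f': "\<And>x. x \<in> S \<Longrightarrow> (F has_derivative f' x) (at x within S)"
      "\<And>v. Ck_on k (\<lambda>x. f' x v) S" by (metis Ck_on_SucE)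
  have "Ck_on k (\<lambda>x. dirD S v F x) S \<longleftrightarrow> Ck_on k (\<lambda>x. f' x v) S"
    by (rule Ck_on_cong) (use dirD_eqI[OF assms(1) _ f'(1)] in auto)
  with f'(2) show "Ck_on k (\<lambda>x. dirD S v F x) S" by simp
qed

lemma dirD_cong:
  assumes "\<And>x. x \<in> S \<Longrightarrow> F x = G x" "x \<in> S"
  shows "dirD S v F x = dirD S v G x"
proof -
  have "(F has_derivative D) (at x within S) \<longleftrightarrow> (G has_derivative D) (at x within S)" for D
    using assms has_derivative_transform[of x S F G] has_derivative_transform[of x S G F] by auto
  then show ?thesis unfolding dirD_def frechet_derivative_def by simp
qed

context
  fixes S :: "'a::euclidean_space set" and x :: 'a
  assumes S: "ample S" and x: "x \<in> S"
begin

lemma dirD_const: "dirD S v (\<lambda>x. c) x = 0"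
  by (rule dirD_eqI[OF S x]) simp

lemma dirD_add:
  "smooth_on F S \<Longrightarrow> smooth_on G S \<Longrightarrow> dirD S v (\<lambda>x. F x + G x) x = dirD S v F x + dirD S v G x"
  by (rule dirD_eqI[OF S x]) (intro derivative_intros smooth_on_has_derivative x)

lemma dirD_diff:
  "smooth_on F S \<Longrightarrow> smooth_on G S \<Longrightarrow> dirD S v (\<lambda>x. F x - G x) x = dirD S v F x - dirD S v G x"
  by (rule dirD_eqI[OF S x]) (intro derivative_intros smooth_on_has_derivative x)

lemma dirD_uminus: "smooth_on F S \<Longrightarrow> dirD S v (\<lambda>x. - F x) x = - dirD S v F x"
  by (rule dirD_eqI[OF S x]) (intro derivative_intros smooth_on_has_derivative x)

lemma dirD_sum:
  "(\<And>i. i \<in> J \<Longrightarrow> smooth_on (H i) S) \<Longrightarrow> dirD S v (\<lambda>x. \<Sum>i\<in>J. H i x) x = (\<Sum>i\<in>J. dirD S v (H i) x)"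
  by (rule dirD_eqI[OF S x]) (intro derivative_intros smooth_on_has_derivative x)

lemma dirD_mult:
  fixes F G :: "'a \<Rightarrow> real"
  shows "smooth_on F S \<Longrightarrow> smooth_on G S \<Longrightarrow>
    dirD S v (\<lambda>x. F x * G x) x = F x * dirD S v G x + dirD S v F x * G x"
  by (rule dirD_eqI[OF S x]) (intro has_derivative_mult smooth_on_has_derivative x)

lemma dirD_cmult:
  fixes F :: "'a \<Rightarrow> real"
  shows "smooth_on F S \<Longrightarrow> dirD S v (\<lambda>x. c * F x) x = c * dirD S v F x"
  by (simp add: dirD_mult dirD_const smooth_on_const)

lemma dirD_compose_real:
  fixes F :: "'a \<Rightarrow> real"
  assumes "smooth_on F S" "(h has_real_derivative h') (at (F x))"
  shows "dirD S v (\<lambda>x. h (F x)) x = h' * dirD S v F x"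
  by (rule dirD_eqI[OF S x])
     (use has_derivative_compose[OF smooth_on_has_derivative[OF assms(1) x] has_field_derivative_imp_has_derivative[OF assms(2)]] in simp)

end

section \<open>Symmetry of mixed derivatives, also at points that are not interior\<close>

lemma mvt_segment:
  fixes F :: "'a::real_normed_vector \<Rightarrow> real"
  assumes "\<And>y. y \<in> S \<Longrightarrow> (F has_derivative F' y) (at y within S)"
    and "0 < h" and "\<And>s. s \<in> {0..h} \<Longrightarrow> y + s *\<^sub>R v \<in> S"
  obtains s where "s \<in> {0<..<h}" "F (y + h *\<^sub>R v) - F y = h * F' (y + s *\<^sub>R v) v"
proof -
  have "((\<lambda>s. F (y + s *\<^sub>R v)) has_derivative (\<lambda>r. F' (y + s *\<^sub>R v) (r *\<^sub>R v))) (at s within {0..h})"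
    if "s \<in> {0..h}" for s
    by (rule has_derivative_in_compose2[OF assms(1)])
       (use assms(3) that in \<open>auto intro!: derivative_eq_intros\<close>)
  then obtain s where s: "s \<in> {0<..<h}" "F (y + h *\<^sub>R v) - F (y + 0 *\<^sub>R v) = F' (y + s *\<^sub>R v) ((h - 0) *\<^sub>R v)"
    using mvt_simple[OF \<open>0 < h\<close>, of "\<lambda>s. F (y + s *\<^sub>R v)" "\<lambda>s r. F' (y + s *\<^sub>R v) (r *\<^sub>R v)"] by auto
  have "linear (F' (y + s *\<^sub>R v))"
    using assms(1)[OF assms(3)[of s]] s(1) by (auto intro: has_derivative_linear)
  with s show ?thesis by (auto simp: linear_scale intro!: that)
qed

text \<open>It suffices that a parallelogram with \<open>x\<close> as a corner lies in the set; such
  a parallelogram exists also over an end point of the time interval.\<close>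

lemma mixed_derivatives_eq:
  fixes F :: "'a::real_normed_vector \<Rightarrow> real"
  assumes F: "\<And>y. y \<in> S \<Longrightarrow> (F has_derivative F' y) (at y within S)"
    and Fv: "\<And>y. y \<in> S \<Longrightarrow> ((\<lambda>z. F' z v) has_derivative Fv y) (at y within S)"
    and Fw: "\<And>y. y \<in> S \<Longrightarrow> ((\<lambda>z. F' z w) has_derivative Fw y) (at y within S)"
    and cv: "continuous_on S (\<lambda>y. Fv y w)" and cw: "continuous_on S (\<lambda>y. Fw y v)"
    and e: "0 < e" and par: "\<And>s r. s \<in> {0..e} \<Longrightarrow> r \<in> {0..e} \<Longrightarrow> x + s *\<^sub>R v + r *\<^sub>R w \<in> S"
  shows "Fv x w = Fw x v"
proof -
  \<comment> \<open>The second difference over a parallelogram of side \<open>h\<close> is \<open>h\<^sup>2\<close> times either mixed derivative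
     at some point of the parallelogram.\<close>
  have one: "\<exists>s\<in>{0<..<h}. \<exists>r\<in>{0<..<h}.
      F (x + h *\<^sub>R v + h *\<^sub>R w) - F (x + h *\<^sub>R v) - F (x + h *\<^sub>R w) + F x = h * (h * Fv (x + s *\<^sub>R v + r *\<^sub>R w) w)"
    if F: "\<And>y. y \<in> S \<Longrightarrow> (F has_derivative F' y) (at y within S)"
      and Fv: "\<And>y. y \<in> S \<Longrightarrow> ((\<lambda>z. F' z v) has_derivative Fv y) (at y within S)"
      and h: "0 < h" and par: "\<And>s r. s \<in> {0..h} \<Longrightarrow> r \<in> {0..h} \<Longrightarrow> x + s *\<^sub>R v + r *\<^sub>R w \<in> S"
    for v w Fv h
  proof -
    \<comment> \<open>The difference F(y + h w) - F(y) is differentiable within the set of those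
      points whose translate also stays in \<open>S\<close>.\<close>
    define S' where "S' = {y \<in> S. y + h *\<^sub>R w \<in> S}"
    have "((\<lambda>y. F (y + h *\<^sub>R w) - F y) has_derivative (\<lambda>u. F' (y + h *\<^sub>R w) u - F' y u)) (at y within S')"
      if "y \<in> S'" for y
      by (intro derivative_intros has_derivative_in_compose2[OF F] has_derivative_subset[OF F])
         (use that in \<open>auto simp: S'_def intro!: derivative_eq_intros\<close>)
    moreover have "x + s *\<^sub>R v \<in> S'" if "s \<in> {0..h}" for s
      using par[OF that, of 0] par[OF that, of h] h by (auto simp: S'_def)
    ultimately obtain s where s: "s \<in> {0<..<h}"
      "F (x + h *\<^sub>R v + h *\<^sub>R w) - F (x + h *\<^sub>R v) - (F (x + h *\<^sub>R w) - F x)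
        = h * (F' (x + s *\<^sub>R v + h *\<^sub>R w) v - F' (x + s *\<^sub>R v) v)"
      using mvt_segment[of S' "\<lambda>y. F (y + h *\<^sub>R w) - F y" "\<lambda>y u. F' (y + h *\<^sub>R w) u - F' y u" h x v] h
      by (auto simp: add_ac)
    obtain r where r: "r \<in> {0<..<h}"
      "F' (x + s *\<^sub>R v + h *\<^sub>R w) v - F' (x + s *\<^sub>R v) v = h * Fv (x + s *\<^sub>R v + r *\<^sub>R w) w"
      using mvt_segment[of S "\<lambda>z. F' z v" Fv h "x + s *\<^sub>R v" w, OF Fv h par] s(1) by auto
    have "F (x + h *\<^sub>R v + h *\<^sub>R w) - F (x + h *\<^sub>R v) - F (x + h *\<^sub>R w) + F x
        = h * (h * Fv (x + s *\<^sub>R v + r *\<^sub>R w) w)"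
      using s(2) r(2) by simp
    then show ?thesis using s(1) r(1) by blast
  qed
  define h where "h n = e / real (Suc n)" for n
  have hpos: "0 < h n" and hle: "h n \<le> e" for n
    using e by (auto simp: h_def field_simps)
  have h_lim: "h \<longlonglongrightarrow> 0"
    unfolding h_def using LIMSEQ_Suc[OF lim_const_over_n[of e]] by simp
  have lim: "(\<lambda>n. x + s n *\<^sub>R v + r n *\<^sub>R w) \<longlonglongrightarrow> x + 0 *\<^sub>R v + 0 *\<^sub>R w"
    if "\<And>n. s n \<in> {0<..<h n}" "\<And>n. r n \<in> {0<..<h n}" for s r
    using that by (intro tendsto_intros tendsto_sandwich[OF _ _ tendsto_const h_lim])
      (auto intro!: always_eventually less_imp_le)
  have mem: "x + s n *\<^sub>R v + r n *\<^sub>R w \<in> S"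
    if "\<And>n. s n \<in> {0<..<h n}" "\<And>n. r n \<in> {0<..<h n}" for s r n
    using par[of "s n" "r n"] that[of n] hle[of n] by (auto simp: less_imp_le)
  have xS: "x \<in> S" using par[of 0 0] e by auto
  have par1: "x + s *\<^sub>R v + r *\<^sub>R w \<in> S" and par2: "x + s *\<^sub>R w + r *\<^sub>R v \<in> S"
    if "s \<in> {0..h n}" "r \<in> {0..h n}" for s r n
    using par[of s r] par[of r s] that hle[of n] by (auto simp: add_ac)
  have "\<exists>s r. s \<in> {0<..<h n} \<and> r \<in> {0<..<h n} \<and>
      F (x + h n *\<^sub>R v + h n *\<^sub>R w) - F (x + h n *\<^sub>R v) - F (x + h n *\<^sub>R w) + F x = h n * (h n * Fv (x + s *\<^sub>R v + r *\<^sub>R w) w)" for n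
  proof -
    have "\<exists>s\<in>{0<..<h n}. \<exists>r\<in>{0<..<h n}. F (x + h n *\<^sub>R v + h n *\<^sub>R w) - F (x + h n *\<^sub>R v) - F (x + h n *\<^sub>R w) + F x
        = h n * (h n * Fv (x + s *\<^sub>R v + r *\<^sub>R w) w)"
      by (rule one[OF F Fv hpos par1])
    then show ?thesis by blast
  qed
  then obtain s r where sr: "\<And>n. s n \<in> {0<..<h n}" "\<And>n. r n \<in> {0<..<h n}"
    "\<And>n. F (x + h n *\<^sub>R v + h n *\<^sub>R w) - F (x + h n *\<^sub>R v) - F (x + h n *\<^sub>R w) + F x = h n * (h n * Fv (x + s n *\<^sub>R v + r n *\<^sub>R w) w)"
    by metis
  have "\<exists>r s. r \<in> {0<..<h n} \<and> s \<in> {0<..<h n} \<and>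
      F (x + h n *\<^sub>R w + h n *\<^sub>R v) - F (x + h n *\<^sub>R w) - F (x + h n *\<^sub>R v) + F x = h n * (h n * Fw (x + r *\<^sub>R w + s *\<^sub>R v) v)" for n
  proof -
    have "\<exists>r\<in>{0<..<h n}. \<exists>s\<in>{0<..<h n}. F (x + h n *\<^sub>R w + h n *\<^sub>R v) - F (x + h n *\<^sub>R w) - F (x + h n *\<^sub>R v) + F x
        = h n * (h n * Fw (x + r *\<^sub>R w + s *\<^sub>R v) v)"
      by (rule one[OF F Fw hpos par2])
    then show ?thesis by blast
  qed
  then obtain s' r' where sr': "\<And>n. s' n \<in> {0<..<h n}" "\<And>n. r' n \<in> {0<..<h n}"
    "\<And>n. F (x + h n *\<^sub>R w + h n *\<^sub>R v) - F (x + h n *\<^sub>R w) - F (x + h n *\<^sub>R v) + F x = h n * (h n * Fw (x + r' n *\<^sub>R w + s' n *\<^sub>R v) v)"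
    by metis
  \<comment> \<open>The second difference is symmetric in \<open>v\<close> and \<open>w\<close>, so
    its two mean value forms agree, though at different intermediate points; both points tend to
    \<open>x\<close>.\<close>
  have eq: "Fv (x + s n *\<^sub>R v + r n *\<^sub>R w) w = Fw (x + s' n *\<^sub>R v + r' n *\<^sub>R w) v" for n
  proof -
    have eqs: "x + r' n *\<^sub>R w + s' n *\<^sub>R v = x + s' n *\<^sub>R v + r' n *\<^sub>R w"
      "x + h n *\<^sub>R w + h n *\<^sub>R v = x + h n *\<^sub>R v + h n *\<^sub>R w" by simp_all
    then have "h n * (h n * Fv (x + s n *\<^sub>R v + r n *\<^sub>R w) w) = h n * (h n * Fw (x + s' n *\<^sub>R v + r' n *\<^sub>R w) v)"
      using sr(3)[of n] sr'(3)[of n, unfolded eqs] by linarith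
    then show ?thesis using hpos[of n] by simp
  qed
  have "(\<lambda>n. Fv (x + s n *\<^sub>R v + r n *\<^sub>R w) w) \<longlonglongrightarrow> Fv x w"
    using continuous_on_tendsto_compose[OF cv lim[OF sr(1,2)]] mem[OF sr(1,2)] xS by auto
  moreover have "(\<lambda>n. Fw (x + s' n *\<^sub>R v + r' n *\<^sub>R w) v) \<longlonglongrightarrow> Fw x v"
    using continuous_on_tendsto_compose[OF cw lim[OF sr'(1,2)]] mem[OF sr'(1,2)] xS by auto
  ultimately show ?thesis using eq LIMSEQ_unique by simp
qed

lemma dirD_commute_room:
  fixes F :: "'a::euclidean_space \<Rightarrow> real"
  assumes S: "ample S" and F: "smooth_on F S" and "0 < e"
    and "\<And>s r. s \<in> {0..e} \<Longrightarrow> r \<in> {0..e} \<Longrightarrow> x + s *\<^sub>R v + r *\<^sub>R w \<in> S"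
  shows "dirD S w (dirD S v F) x = dirD S v (dirD S w F) x"
  by (rule mixed_derivatives_eq[where F=F and S=S and F'="\<lambda>y v. dirD S v F y" and e=e
      and Fv="\<lambda>y u. dirD S u (dirD S v F) y" and Fw="\<lambda>y u. dirD S u (dirD S w F) y"])
     (use assms in \<open>auto intro!: smooth_on_has_derivative smooth_on_imp_continuous_on smooth_on_dirD\<close>)

lemma dirD_uminus_dir:
  assumes "smooth_on F S" "x \<in> S"
  shows "dirD S (- v) F x = - dirD S v F x"
  using linear_neg[OF has_derivative_linear[OF smooth_on_has_derivative[OF assms]]] by simp

section \<open>Calculus on a time interval times an open set of coordinates\<close>

locale slab =
  fixes I :: "real set" and U :: "(real ^ 'n) set"
  assumes interval: "is_interval I" "interior I \<noteq> {}" and open_U: "open U"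
begin

abbreviation "Q \<equiv> I \<times> U"
abbreviation "smooth \<equiv> \<lambda>F :: real \<times> (real ^ 'n) \<Rightarrow> real. smooth_on F Q"
abbreviation dt :: "(real \<times> (real ^ 'n) \<Rightarrow> real) \<Rightarrow> real \<times> (real ^ 'n) \<Rightarrow> real" where
  "dt \<equiv> dirD Q (1, 0)"
abbreviation dx :: "'n \<Rightarrow> (real \<times> (real ^ 'n) \<Rightarrow> real) \<Rightarrow> real \<times> (real ^ 'n) \<Rightarrow> real" where
  "dx i \<equiv> dirD Q (0, axis i 1)"

text \<open>The sign \<open>e\<close> is part of the conclusion because at an end point only one
  direction stays in the interval. A nonempty interior rules out the interval with a single
  point.\<close>

lemma I_room:
  assumes "t \<in> I"
  obtains e h where "e = 1 \<or> e = -1" "0 < h" "\<And>s. s \<in> {0..h} \<Longrightarrow> t + s * e \<in> I"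
proof -
  obtain a b where ab: "a < b" "{a..b} \<subseteq> I"
  proof -
    from interval(2) obtain c where "c \<in> interior I" by auto
    then obtain e where "0 < e" "cball c e \<subseteq> I"
      by (metis mem_interior_cball)
    then show ?thesis using that[of c "c + e"] by (auto simp: cball_def dist_real_def subset_iff)
  qed
  have conv: "y \<in> I" if "t' \<in> I" "b' \<in> I" "t' \<le> y" "y \<le> b'" for y t' b'
    using interval(1) that unfolding is_interval_1 by blast
  show ?thesis
  proof (cases "t < b")
    case True
    moreover have "b \<in> I" using ab by auto
    ultimately show ?thesis using that[of 1 "b - t"] conv[OF assms, of b] by auto
  next
    case False
    then have "t > a" "a \<in> I" using ab by auto
    then show ?thesis using that[of "-1" "t - a"] conv[OF _ assms, of a] by auto
  qed
qed

lemma U_room: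
  assumes "y \<in> U"
  obtains h where "0 < h" "\<And>s r. s \<in> {0..h} \<Longrightarrow> r \<in> {0..h} \<Longrightarrow> y + s *\<^sub>R v + r *\<^sub>R w \<in> U"
proof -
  obtain e where e: "e > 0" "ball y e \<subseteq> U" using open_U assms openE by blast
  \<comment> \<open>The summand 1 keeps the denominator positive when \<open>v\<close> and
    \<open>w\<close> vanish; the factor 2 makes the final estimate strict.\<close>
  define h where "h = e / (2 * (norm v + norm w + 1))"
  have N: "0 < norm v + norm w + 1" by (simp add: add_nonneg_pos)
  have "h > 0" using e N by (simp add: h_def)
  moreover have "y + s *\<^sub>R v + r *\<^sub>R w \<in> U" if "s \<in> {0..h}" "r \<in> {0..h}" for s r
  proof -
    have "norm (s *\<^sub>R v + r *\<^sub>R w) \<le> \<bar>s\<bar> * norm v + \<bar>r\<bar> * norm w"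
      by (metis norm_scaleR norm_triangle_ineq)
    also have "\<dots> \<le> h * norm v + h * norm w"
      using that by (intro add_mono mult_right_mono) auto
    also have "\<dots> \<le> h * (norm v + norm w + 1)" using \<open>h > 0\<close> by (simp add: algebra_simps)
    also have "\<dots> = e / 2" using N by (simp add: h_def field_simps)
    also have "\<dots> < e" using e by simp
    finally have "dist y (y + s *\<^sub>R v + r *\<^sub>R w) < e" by (simp add: dist_norm norm_minus_commute add.assoc flip: norm_minus_cancel[of "s *\<^sub>R v + r *\<^sub>R w"])
    then show ?thesis using e by auto
  qed
  ultimately show ?thesis using that by blast
qed

lemma ample_Q: "ample Q"
  unfolding ample_def
proof (intro ballI allI impI)
  fix x :: "real \<times> (real ^ 'n)" and i :: "real \<times> (real ^ 'n)" and e :: real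
  assume x: "x \<in> Q" and i: "i \<in> Basis" and e: "(0::real) < e"
  obtain t y where xy: "x = (t, y)" "t \<in> I" "y \<in> U" using x by auto
  show "\<exists>d. 0 < \<bar>d\<bar> \<and> \<bar>d\<bar> < e \<and> x + d *\<^sub>R i \<in> Q"
  proof (cases "snd i = 0")
    case True
    then have i1: "i = (1, 0)" using i by (auto simp: Basis_prod_def)
    obtain u h where "u = 1 \<or> u = -1" "0 < h" "\<And>s. s \<in> {0..h} \<Longrightarrow> t + s * u \<in> I"
      using I_room[OF xy(2)] by blast
    then show ?thesis using xy e
      by (auto simp: i1 intro!: exI[of _ "min h (e/2) * u"])
  next
    case False
    then have i0: "fst i = 0" using i by (auto simp: Basis_prod_def)
    obtain h where "0 < h" "\<And>s r. s \<in> {0..h} \<Longrightarrow> r \<in> {0..h} \<Longrightarrow> y + s *\<^sub>R snd i + r *\<^sub>R 0 \<in> U"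
      using U_room[OF xy(3)] by blast
    from this(1) this(2)[of "min h (e/2)" 0] show ?thesis using xy e
      by (cases i) (use i0 in \<open>auto intro!: exI[of _ "min h (e/2)"]\<close>)
  qed
qed

lemma smooth_dirD [smooth_intros]: "smooth F \<Longrightarrow> smooth (dirD Q v F)"
  using smooth_on_dirD[OF ample_Q, of F v] by simp

lemmas d_const = dirD_const[OF ample_Q] and d_add = dirD_add[OF ample_Q] and d_diff = dirD_diff[OF ample_Q]
  and d_uminus = dirD_uminus[OF ample_Q] and d_sum = dirD_sum[OF ample_Q]
  and d_mult = dirD_mult[OF ample_Q] and d_cmult = dirD_cmult[OF ample_Q]

lemma dx_commute:
  assumes "smooth F" "x \<in> Q"
  shows "dx i (dx j F) x = dx j (dx i F) x"
proof -
  obtain t y where xy: "x = (t, y)" "t \<in> I" "y \<in> U" using assms by auto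
  obtain h where "0 < h" "\<And>s r. s \<in> {0..h} \<Longrightarrow> r \<in> {0..h} \<Longrightarrow> y + s *\<^sub>R axis j 1 + r *\<^sub>R axis i 1 \<in> U"
    using U_room[OF xy(3)] by blast
  then show ?thesis
    by (intro dirD_commute_room[OF ample_Q assms(1), of h]) (use xy in auto)
qed

text \<open>At a right end point only backward steps in time are available. Commutation is then
  proved for the direction (-1, 0), and linearity removes the sign on both sides.\<close>

lemma dt_dx_commute:
  assumes F: "smooth F" and x: "x \<in> Q"
  shows "dt (dx i F) x = dx i (dt F) x"
proof -
  obtain t y where xy: "x = (t, y)" "t \<in> I" "y \<in> U" using x by auto
  obtain h where h: "0 < h" "\<And>s r. s \<in> {0..h} \<Longrightarrow> r \<in> {0..h} \<Longrightarrow> y + s *\<^sub>R axis i 1 + r *\<^sub>R 0 \<in> U"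
    using U_room[OF xy(3)] by blast
  obtain u h' where u: "u = 1 \<or> u = -1" "0 < h'" "\<And>s. s \<in> {0..h'} \<Longrightarrow> t + s * u \<in> I"
    using I_room[OF xy(2)] by blast
  define k where "k = min h h'"
  have "dirD Q (u, 0) (dx i F) x = dx i (dirD Q (u, 0) F) x"
    by (rule dirD_commute_room[OF ample_Q F, of k]) (use xy h(1) h(2)[of _ 0] u(2,3) in \<open>auto simp: k_def\<close>)
  moreover have "dirD Q (-1, 0) G y = - dt G y" if "smooth G" "y \<in> Q" for G y
    using dirD_uminus_dir[OF that, of "(1, 0)"] by simp
  then have "dirD Q (-1, 0) (dx i F) x = - dt (dx i F) x" "dx i (dirD Q (-1, 0) F) x = - dx i (dt F) x"
    using F x dirD_cong[of Q "dirD Q (-1, 0) F" "\<lambda>y. - dt F y" x]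
    by (auto simp: d_uminus smooth_dirD)
  ultimately show ?thesis using u(1) by auto
qed

end

subsection \<open>Change of variables over arbitrary finite index types\<close>

text \<open>The library has the change of variables formula only for index types that are well-orders;
  the copy \<open>'n wo\<close> of the index type \<open>'n\<close> removes this restriction.\<close>

typedef 'n wo = "UNIV :: 'n set" by simp

lemma bij_Rep_wo: "bij Rep_wo"
  by (metis Abs_wo_inverse Rep_wo_inverse UNIV_I bij_betw_def inj_on_inverseI surj_def)

instance wo :: (finite) finite
  by standard (metis bij_Rep_wo bij_betw_finite finite)

text \<open>An arbitrary enumeration: pulling back the order of the natural numbers along it makes
  the copied type a well-order.\<close>

definition wo_index :: "'n::finite wo \<Rightarrow> nat" where
  "wo_index = (SOME f. inj f)"

lemma inj_wo_index: "inj (wo_index :: 'n::finite wo \<Rightarrow> nat)"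
proof -
  obtain f :: "'n wo \<Rightarrow> nat" where "inj f"
    using finite_imp_inj_to_nat_seg[OF finite[of "UNIV :: 'n wo set"]] by blast
  then show ?thesis unfolding wo_index_def using someI[of inj f] by simp
qed

instantiation wo :: (finite) wellorder
begin

definition less_eq_wo :: "'a wo \<Rightarrow> 'a wo \<Rightarrow> bool" where "less_eq_wo x y \<longleftrightarrow> wo_index x \<le> wo_index y"
definition less_wo :: "'a wo \<Rightarrow> 'a wo \<Rightarrow> bool" where "less_wo x y \<longleftrightarrow> wo_index x < wo_index y"

instance
proof
  fix P :: "'a wo \<Rightarrow> bool" and a
  assume step: "\<And>x. (\<And>y. y < x \<Longrightarrow> P y) \<Longrightarrow> P x"
  show "P a"
    by (rule measure_induct[of wo_index P a]) (use step in \<open>auto simp: less_wo_def\<close>)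
qed (auto simp: less_eq_wo_def less_wo_def dest: injD[OF inj_wo_index])

end

text \<open>The known formula concerns absolutely integrable functions with vector values, hence the
  wrapping of \<open>f\<close> by \<open>vec\<close>. For nonnegative functions absolute
  integrability is integrability, so both sides are finite simultaneously and then equal.\<close>

lemma nn_integral_change_of_variables_wellorder:
  fixes f :: "real ^ 'n::{finite,wellorder} \<Rightarrow> real" and g :: "real ^ 'n::_ \<Rightarrow> real ^ 'n::_"
  assumes S: "S \<in> sets borel"
    and der: "\<And>x. x \<in> S \<Longrightarrow> (g has_derivative g' x) (at x within S)"
    and inj: "inj_on g S" and f: "\<And>y. f y \<ge> 0"
    and m1: "(\<lambda>x. indicator S x * (\<bar>det (matrix (g' x))\<bar> * f (g x))) \<in> borel_measurable borel"
    and m2: "(\<lambda>y. indicator (g ` S) y * f y) \<in> borel_measurable borel"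
  shows "(\<integral>\<^sup>+y. ennreal (indicator (g ` S) y * f y) \<partial>lborel) =
    (\<integral>\<^sup>+x. ennreal (indicator S x * (\<bar>det (matrix (g' x))\<bar> * f (g x))) \<partial>lborel)"
proof -
  define h where "h x = \<bar>det (matrix (g' x))\<bar> * f (g x)" for x
  have h_eq: "h = (\<lambda>x. \<bar>det (matrix (g' x))\<bar> * f (g x))" by (simp add: h_def fun_eq_iff)
  have h0: "h x \<ge> 0" for x unfolding h_def using f by simp
  have ind: "(\<lambda>x. indicator A x * u x) = (\<lambda>x. if x \<in> A then u x else 0)" for A and u :: "real ^ 'n::_ \<Rightarrow> real"
    by (auto simp: indicator_def)
  have cov: "(h has_integral b) S \<longleftrightarrow> (f has_integral b) (g ` S)" for b
  proof -
    have "S \<in> sets lebesgue" using S by simp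
    from has_absolute_integral_change_of_variables[OF this der inj, of "\<lambda>y. vec (f y) :: real ^ 1" "vec b"]
    moreover have "u absolutely_integrable_on A \<longleftrightarrow> u integrable_on A" if "\<And>x. u x \<ge> 0"
      for A and u :: "real ^ 'n::_ \<Rightarrow> real"
      using that by (auto intro: nonnegative_absolutely_integrable_1 simp: absolutely_integrable_on_def)
    note this[of h S, OF h0] this[of f "g ` S", OF f]
    ultimately show ?thesis
      unfolding absolutely_integrable_on_1_iff integral_on_1_eq
      by (auto simp: h_eq vec_eq_iff has_integral_iff)
  qed
  have A: "(u has_integral integral UNIV (\<lambda>x. indicator A x * u x)) A"
    if "(\<lambda>x. indicator A x * u x) \<in> borel_measurable borel" "\<And>x. u x \<ge> 0"
      "(\<integral>\<^sup>+x. ennreal (indicator A x * u x) \<partial>lborel) < \<infinity>"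
    for A and u :: "real ^ 'n::_ \<Rightarrow> real"
  proof -
    have "(\<lambda>x. indicator A x * u x) integrable_on UNIV"
      using that by (intro nn_integral_integrable_on) auto
    then have "((\<lambda>x. indicator A x * u x) has_integral integral UNIV (\<lambda>x. indicator A x * u x)) UNIV"
      by (rule integrable_integral)
    then show ?thesis unfolding ind has_integral_restrict_UNIV .
  qed
  have B: "(\<integral>\<^sup>+x. ennreal (indicator A x * u x) \<partial>lborel) = ennreal b"
    if "(u has_integral b) A" "\<And>x. u x \<ge> 0" for A and u :: "real ^ 'n::_ \<Rightarrow> real" and b
    using nn_integral_has_integral_lebesgue[OF that(2) that(1)] by simp
  show ?thesis
  proof (cases "(\<integral>\<^sup>+y. ennreal (indicator (g ` S) y * f y) \<partial>lborel) < \<infinity>")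
    case True
    let ?b = "integral UNIV (\<lambda>y. indicator (g ` S) y * f y)"
    have b: "(f has_integral ?b) (g ` S)" by (rule A[OF m2 f True])
    show ?thesis
      using B[OF b f] B[OF iffD2[OF cov b] h0] unfolding h_eq by simp
  next
    case False
    \<comment> \<open>A finite integral over \<open>S\<close> would, through \<open>cov\<close>,
      give the integral over the image a finite value as well.\<close>
    have "\<not> (\<integral>\<^sup>+x. ennreal (indicator S x * h x) \<partial>lborel) < \<infinity>"
    proof
      assume t: "(\<integral>\<^sup>+x. ennreal (indicator S x * h x) \<partial>lborel) < \<infinity>"
      have "(f has_integral (integral UNIV (\<lambda>x. indicator S x * h x))) (g ` S)"
        by (rule iffD1[OF cov], rule A[OF _ h0 t]) (use m1 in \<open>simp add: h_eq\<close>)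
      from B[OF this f] False show False by simp
    qed
    with False have "(\<integral>\<^sup>+y. ennreal (indicator (g ` S) y * f y) \<partial>lborel) = (\<integral>\<^sup>+x. ennreal (indicator S x * h x) \<partial>lborel)"
      by (simp add: less_top[symmetric])
    then show ?thesis unfolding h_eq .
  qed
qed

definition reindex :: "real ^ 'n wo \<Rightarrow> real ^ 'n" where
  "reindex v = (\<chi> i. v $ Abs_wo i)"

definition unindex :: "real ^ 'n \<Rightarrow> real ^ 'n wo" where
  "unindex w = (\<chi> j. w $ Rep_wo j)"

lemma reindex_unindex [simp]: "reindex (unindex w) = w" "unindex (reindex v) = v"
  by (simp_all add: reindex_def unindex_def Abs_wo_inverse Rep_wo_inverse vec_eq_iff)

lemma bounded_linear_reindex: "bounded_linear (reindex :: real ^ 'n::finite wo \<Rightarrow> _)"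
  and bounded_linear_unindex: "bounded_linear (unindex :: real ^ 'n::finite \<Rightarrow> _)"
  by (auto intro!: linear_conv_bounded_linear[THEN iffD1] linearI simp: reindex_def unindex_def vec_eq_iff)

lemma measurable_reindex [measurable]: "reindex \<in> borel_measurable borel"
  and measurable_unindex [measurable]: "unindex \<in> borel_measurable borel"
  by (auto intro!: borel_measurable_continuous_onI linear_continuous_on bounded_linear_reindex bounded_linear_unindex)

lemma prod_Basis_cart: "(\<Prod>b\<in>Basis. (v :: real ^ 'n) \<bullet> b) = (\<Prod>i\<in>UNIV. v $ i)"
  by (simp add: Basis_vec_def UNION_singleton_eq_range prod.reindex axis_eq_axis inj_on_def inner_axis)

text \<open>Lebesgue measure is determined by its values on boxes, and renaming the coordinates only
  permutes the side lengths of a box.\<close>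

lemma distr_reindex: "distr lborel borel (reindex :: real ^ 'n::finite wo \<Rightarrow> _) = lborel"
proof (rule lborel_eqI[symmetric])
  fix l u :: "real ^ 'n"
  assume lu: "\<And>b. b \<in> Basis \<Longrightarrow> l \<bullet> b \<le> u \<bullet> b"
  have le: "l $ i \<le> u $ i" for i using lu[of "axis i 1"] by (simp add: inner_axis)
  have "reindex -` box l u = box (unindex l) (unindex u)"
    by (auto simp: mem_box_cart reindex_def unindex_def)
       (metis Abs_wo_inverse Rep_wo_inverse UNIV_I)+
  then have "emeasure (distr lborel borel reindex) (box l u) = emeasure lborel (box (unindex l) (unindex u))"
    by (simp add: emeasure_distr)
  also have "\<dots> = (\<Prod>b\<in>Basis. (unindex u - unindex l) \<bullet> b)"
    by (rule emeasure_lborel_box) (use le in \<open>auto simp: Basis_vec_def inner_axis unindex_def\<close>)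
  also have "\<dots> = (\<Prod>j\<in>UNIV. (u - l) $ Rep_wo j)"
    unfolding prod_Basis_cart by (simp add: unindex_def)
  also have "\<dots> = (\<Prod>i\<in>UNIV. (u - l) $ i)"
    using prod.reindex_bij_betw[OF bij_Rep_wo, of "\<lambda>i. (u - l) $ i"] by simp
  finally show "emeasure (distr lborel borel reindex) (box l u) = (\<Prod>b\<in>Basis. (u - l) \<bullet> b)"
    unfolding prod_Basis_cart .
qed simp

text \<open>Conjugation with \<open>Abs_wo\<close> is a bijection between the permutations of the
  two index types that preserves signs; it matches the Leibniz sums term by term.\<close>

lemma det_reindex:
  fixes A :: "real ^ 'n::finite ^ 'n"
  shows "det (\<chi> i j. A $ Rep_wo i $ Rep_wo j) = det A"
proof -
  let ?m = "map_permutation UNIV (Abs_wo :: 'n \<Rightarrow> _)"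
  have bA: "bij (Abs_wo :: 'n \<Rightarrow> _)" by (metis Abs_wo_inverse Rep_wo_inverse UNIV_I bij_betw_def inj_on_inverseI surj_def)
  have inv: "inv_into UNIV Abs_wo x = Rep_wo x" for x :: "'n wo"
    using bA by (metis Rep_wo_inverse bij_inv_eq_iff)
  have m: "?m p x = Abs_wo (p (Rep_wo x))" for p x
    using bij_is_surj[OF bA] by (simp add: map_permutation_def inv)
  have bij: "bij_betw ?m {p. p permutes UNIV} {p. p permutes UNIV}"
  proof (rule bij_betw_byWitness[where f'="\<lambda>q x. Rep_wo (q (Abs_wo x))"])
    show "\<forall>p\<in>{p. p permutes UNIV}. (\<lambda>x. Rep_wo (?m p (Abs_wo x))) = p"
      by (auto simp: m Abs_wo_inverse)
    show "\<forall>q\<in>{q. q permutes UNIV}. ?m (\<lambda>x. Rep_wo (q (Abs_wo x))) = q"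
      by (auto simp: m Rep_wo_inverse)
    show "?m ` {p. p permutes UNIV} \<subseteq> {p. p permutes UNIV}"
      using map_permutation_permutes[OF bA] by auto
    show "(\<lambda>q x. Rep_wo (q (Abs_wo x))) ` {q. q permutes UNIV} \<subseteq> {p. p permutes (UNIV :: 'n set)}"
    proof clarify
      fix q :: "'n wo \<Rightarrow> 'n wo" assume q: "q permutes UNIV"
      show "(\<lambda>x. Rep_wo (q (Abs_wo x))) permutes UNIV"
        by (rule bij_imp_permutes) (use bij_comp[OF bij_comp[OF bA permutes_bij[OF q]] bij_Rep_wo] in \<open>auto simp: o_def\<close>)
    qed
  qed
  have "det (\<chi> i j. A $ Rep_wo i $ Rep_wo j) =
    (\<Sum>p | p permutes (UNIV :: 'n wo set). of_int (sign p) * (\<Prod>i\<in>UNIV. A $ Rep_wo i $ Rep_wo (p i)))"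
    by (simp add: det_def)
  also have "\<dots> = (\<Sum>p | p permutes (UNIV :: 'n set). of_int (sign (?m p)) * (\<Prod>i\<in>UNIV. A $ Rep_wo i $ Rep_wo (?m p i)))"
    using sum.reindex_bij_betw[OF bij, of "\<lambda>p. of_int (sign p) * (\<Prod>i\<in>UNIV. A $ Rep_wo i $ Rep_wo (p i))"] by simp
  also have "\<dots> = (\<Sum>p | p permutes (UNIV :: 'n set). of_int (sign p) * (\<Prod>i\<in>UNIV. A $ i $ p i))"
  proof (rule sum.cong[OF refl])
    fix p :: "'n \<Rightarrow> 'n" assume p: "p \<in> {p. p permutes UNIV}"
    have "sign (?m p) = sign p"
      using p bij_is_inj[OF bA] by (intro sign_map_permutation) auto
    moreover have "(\<Prod>i\<in>UNIV. A $ Rep_wo i $ Rep_wo (?m p i)) = (\<Prod>i\<in>UNIV. A $ Rep_wo i $ p (Rep_wo i))"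
      by (simp add: m Abs_wo_inverse)
    moreover have "\<dots> = (\<Prod>i\<in>UNIV. A $ i $ p i)"
      by (rule prod.reindex_bij_betw[OF bij_Rep_wo])
    ultimately show "of_int (sign (?m p)) * (\<Prod>i\<in>UNIV. A $ Rep_wo i $ Rep_wo (?m p i)) = of_int (sign p) * (\<Prod>i\<in>UNIV. A $ i $ p i)"
      by simp
  qed
  finally show ?thesis by (simp add: det_def)
qed

text \<open>Conjugating \<open>g\<close> with \<open>reindex\<close> transfers the formula:
  \<open>reindex\<close> is linear and preserves Lebesgue measure, and the determinant of the
  derivative does not change.\<close>

theorem nn_integral_change_of_variables:
  fixes f :: "real ^ 'n::finite \<Rightarrow> real" and g :: "real ^ 'n \<Rightarrow> real ^ 'n"
  assumes S: "S \<in> sets borel"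
    and der: "\<And>x. x \<in> S \<Longrightarrow> (g has_derivative g' x) (at x within S)"
    and inj: "inj_on g S" and f: "\<And>y. f y \<ge> 0"
    and m1: "(\<lambda>x. indicator S x * (\<bar>det (matrix (g' x))\<bar> * f (g x))) \<in> borel_measurable borel"
    and m2: "(\<lambda>y. indicator (g ` S) y * f y) \<in> borel_measurable borel"
  shows "(\<integral>\<^sup>+y. ennreal (indicator (g ` S) y * f y) \<partial>lborel) =
    (\<integral>\<^sup>+x. ennreal (indicator S x * (\<bar>det (matrix (g' x))\<bar> * f (g x))) \<partial>lborel)"
proof -
  define S' where "S' = unindex ` S"
  define G where "G = (\<lambda>v. unindex (g (reindex v)))"
  define G' where "G' = (\<lambda>v w. unindex (g' (reindex v) (reindex w)))"
  have S'_eq: "S' = reindex -` S" unfolding S'_def by (auto simp: image_iff) (metis reindex_unindex(2))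
  have S': "S' \<in> sets borel"
    using measurable_sets[OF measurable_reindex S] by (simp add: S'_eq)
  have derG: "(G has_derivative G' v) (at v within S')" if "v \<in> S'" for v
    unfolding G_def G'_def
    by (rule bounded_linear.has_derivative[OF bounded_linear_unindex], rule has_derivative_in_compose2[OF der])
       (use that in \<open>auto simp: S'_eq intro!: bounded_linear.has_derivative[OF bounded_linear_reindex] derivative_eq_intros\<close>)
  have injG: "inj_on G S'"
    unfolding G_def by (intro inj_onI) (metis S'_eq inj inj_onD reindex_unindex vimageE)
  have det: "det (matrix (G' v)) = det (matrix (g' (reindex v)))" for v
  proof -
    have "reindex (axis j 1) = axis (Rep_wo j) 1" for j :: "'n wo"
      by (auto simp: reindex_def axis_def vec_eq_iff Abs_wo_inverse) (metis Rep_wo_inverse)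
    then have "matrix (G' v) = (\<chi> i j. matrix (g' (reindex v)) $ Rep_wo i $ Rep_wo j)"
      by (simp add: G'_def matrix_def unindex_def)
    then show ?thesis by (simp add: det_reindex)
  qed
  have ind1: "indicator S' v = (indicator S (reindex v) :: real)" for v
    by (auto simp: S'_eq indicator_def)
  have ind2: "indicator (G ` S') v = (indicator (g ` S) (reindex v) :: real)" for v
  proof -
    have "v \<in> G ` S'" if "x \<in> S" "reindex v = g x" for x
      using that by (auto simp: G_def S'_eq image_iff simp flip: that(2) intro!: bexI[of _ "unindex x"])
    then show ?thesis by (auto simp: G_def S'_eq indicator_def)
  qed
  have rG: "reindex (G v) = g (reindex v)" for v by (simp add: G_def)
  have tr: "(\<integral>\<^sup>+y. ennreal (u y) \<partial>lborel) = (\<integral>\<^sup>+v. ennreal (u (reindex v)) \<partial>lborel)"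
    if "u \<in> borel_measurable borel" for u :: "real ^ 'n \<Rightarrow> real"
    using that by (subst distr_reindex[symmetric], subst nn_integral_distr) auto
  have "(\<integral>\<^sup>+v. ennreal (indicator (G ` S') v * f (reindex v)) \<partial>lborel) =
     (\<integral>\<^sup>+v. ennreal (indicator S' v * (\<bar>det (matrix (G' v))\<bar> * f (reindex (G v)))) \<partial>lborel)"
    by (rule nn_integral_change_of_variables_wellorder[OF S' derG injG f])
       (use measurable_compose[OF measurable_reindex m1] measurable_compose[OF measurable_reindex m2]
        in \<open>simp_all add: det ind1 ind2 rG\<close>)
  then show ?thesis
    unfolding tr[OF m1] tr[OF m2] det ind1 ind2 rG .
qed

subsection \<open>Tensor calculus in a chart\<close>

text \<open>Components are separate scalar functions, and the inverse metric is a parameter tied to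
  \<open>G\<close> by \<open>inv_G\<close>. Every identity thus concerns finite sums of products of
  scalars and their directional derivatives.\<close>

locale geom = slab I U for I :: "real set" and U :: "(real ^ 'n::finite) set" +
  fixes G Gi :: "'n \<Rightarrow> 'n \<Rightarrow> real \<times> (real ^ 'n) \<Rightarrow> real"
  assumes smooth_G [smooth_intros]: "\<And>i j. smooth (G i j)"
    and smooth_Gi [smooth_intros]: "\<And>i j. smooth (Gi i j)"
    and sym_G: "\<And>i j x. x \<in> Q \<Longrightarrow> G i j x = G j i x"
    and sym_Gi: "\<And>i j x. x \<in> Q \<Longrightarrow> Gi i j x = Gi j i x"
    and inv_G: "\<And>i j x. x \<in> Q \<Longrightarrow> (\<Sum>k\<in>UNIV. Gi i k x * G k j x) = (if i = j then 1 else 0)"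
begin

definition Gam :: "'n \<Rightarrow> 'n \<Rightarrow> 'n \<Rightarrow> real \<times> (real ^ 'n) \<Rightarrow> real" where
  "Gam k i j x = (\<Sum>l\<in>UNIV. 1/2 * Gi k l x * (dx i (G j l) x + dx j (G i l) x - dx l (G i j) x))"

text \<open>The gradient, in contravariant components.\<close>

definition V :: "(real \<times> (real ^ 'n) \<Rightarrow> real) \<Rightarrow> 'n \<Rightarrow> real \<times> (real ^ 'n) \<Rightarrow> real" where
  "V f i x = (\<Sum>j\<in>UNIV. Gi i j x * dx j f x)"

definition H :: "(real \<times> (real ^ 'n) \<Rightarrow> real) \<Rightarrow> 'n \<Rightarrow> 'n \<Rightarrow> real \<times> (real ^ 'n) \<Rightarrow> real" where
  "H f i j x = dx i (dx j f) x - (\<Sum>k\<in>UNIV. Gam k i j x * dx k f x)"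

text \<open>The Hessian with its first index raised. In these mixed components norms become traces
  of products and the Bochner computation has no metric factors.\<close>

definition W :: "(real \<times> (real ^ 'n) \<Rightarrow> real) \<Rightarrow> 'n \<Rightarrow> 'n \<Rightarrow> real \<times> (real ^ 'n) \<Rightarrow> real" where
  "W f i j x = (\<Sum>k\<in>UNIV. Gi i k x * H f k j x)"

text \<open>The inner product of two gradients, written as the derivative of \<open>h\<close> along
  the gradient of \<open>f\<close> so that the metric is hidden in \<open>V\<close>.\<close>

definition Pr :: "(real \<times> (real ^ 'n) \<Rightarrow> real) \<Rightarrow> (real \<times> (real ^ 'n) \<Rightarrow> real) \<Rightarrow> real \<times> (real ^ 'n) \<Rightarrow> real" where
  "Pr f h x = (\<Sum>i\<in>UNIV. V f i x * dx i h x)"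

definition Lap :: "(real \<times> (real ^ 'n) \<Rightarrow> real) \<Rightarrow> real \<times> (real ^ 'n) \<Rightarrow> real" where
  "Lap f x = (\<Sum>i\<in>UNIV. \<Sum>j\<in>UNIV. Gi i j x * H f i j x)"

text \<open>The Riemannian divergence of a vector field.\<close>

definition dv :: "('n \<Rightarrow> real \<times> (real ^ 'n) \<Rightarrow> real) \<Rightarrow> real \<times> (real ^ 'n) \<Rightarrow> real" where
  "dv X x = (\<Sum>i\<in>UNIV. dx i (X i) x + (\<Sum>k\<in>UNIV. Gam i i k x * X k x))"

definition Rm :: "'n \<Rightarrow> 'n \<Rightarrow> 'n \<Rightarrow> 'n \<Rightarrow> real \<times> (real ^ 'n) \<Rightarrow> real" where
  "Rm l k i j x = dx i (Gam l j k) x - dx j (Gam l i k) x +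
     (\<Sum>m\<in>UNIV. Gam l i m x * Gam m j k x - Gam l j m x * Gam m i k x)"

definition Ric :: "'n \<Rightarrow> 'n \<Rightarrow> real \<times> (real ^ 'n) \<Rightarrow> real" where
  "Ric j k x = (\<Sum>i\<in>UNIV. Rm i k i j x)"

lemma smooth_Gam [smooth_intros]: "smooth (Gam k i j)"
  unfolding Gam_def by (intro smooth_intros)

lemma smooth_V [smooth_intros]: "smooth f \<Longrightarrow> smooth (V f i)"
  unfolding V_def by (intro smooth_intros)

lemma smooth_H [smooth_intros]: "smooth f \<Longrightarrow> smooth (H f i j)"
  unfolding H_def by (intro smooth_intros)

lemma smooth_W [smooth_intros]: "smooth f \<Longrightarrow> smooth (W f i j)"
  unfolding W_def by (intro smooth_intros)

lemma smooth_Pr [smooth_intros]: "smooth f \<Longrightarrow> smooth h \<Longrightarrow> smooth (Pr f h)"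
  unfolding Pr_def by (intro smooth_intros)

lemma smooth_Lap [smooth_intros]: "smooth f \<Longrightarrow> smooth (Lap f)"
  unfolding Lap_def by (intro smooth_intros)

lemma dirD_G_sym: "x \<in> Q \<Longrightarrow> dirD Q v (G i j) x = dirD Q v (G j i) x"
  by (rule dirD_cong) (use sym_G in auto)

lemma inv_G': "x \<in> Q \<Longrightarrow> (\<Sum>k\<in>UNIV. G i k x * Gi k j x) = (if i = j then 1 else 0)"
  using inv_G[of x j i] by (simp add: sym_G[of x _ i] sym_Gi[of x _ j] mult.commute eq_commute)

lemma lower_raise:
  assumes "x \<in> Q"
  shows "(\<Sum>m\<in>UNIV. G m j x * (\<Sum>l\<in>UNIV. Gi m l x * u l)) = u j"
proof -
  have "(\<Sum>m\<in>UNIV. G m j x * (\<Sum>l\<in>UNIV. Gi m l x * u l)) = (\<Sum>m\<in>UNIV. \<Sum>l\<in>UNIV. u l * (Gi m l x * G m j x))"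
    by (simp add: sum_distrib_left mult_ac)
  also have "\<dots> = (\<Sum>l\<in>UNIV. \<Sum>m\<in>UNIV. u l * (Gi m l x * G m j x))"
    by (rule sum.swap)
  also have "\<dots> = (\<Sum>l\<in>UNIV. u l * (\<Sum>m\<in>UNIV. Gi l m x * G m j x))"
    by (simp add: sum_distrib_left sym_Gi[OF assms])
  finally show ?thesis using inv_G[OF assms] by (simp add: if_distrib cong: if_cong)
qed

lemma raise_lower:
  assumes "x \<in> Q"
  shows "(\<Sum>b\<in>UNIV. Gi b j x * (\<Sum>m\<in>UNIV. w m * G m b x)) = w j"
proof -
  have "(\<Sum>b\<in>UNIV. Gi b j x * (\<Sum>m\<in>UNIV. w m * G m b x)) = (\<Sum>b\<in>UNIV. \<Sum>m\<in>UNIV. w m * (G m b x * Gi b j x))"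
    by (simp add: sum_distrib_left mult_ac)
  also have "\<dots> = (\<Sum>m\<in>UNIV. \<Sum>b\<in>UNIV. w m * (G m b x * Gi b j x))"
    by (rule sum.swap)
  also have "\<dots> = (\<Sum>m\<in>UNIV. w m * (\<Sum>b\<in>UNIV. G m b x * Gi b j x))"
    by (simp add: sum_distrib_left)
  finally show ?thesis using inv_G'[OF assms] by (simp add: if_distrib cong: if_cong)
qed

lemma Gam_sym: "x \<in> Q \<Longrightarrow> Gam k i j x = Gam k j i x"
  unfolding Gam_def by (simp add: dirD_G_sym[of x _ i j] algebra_simps)

lemma H_sym: "smooth f \<Longrightarrow> x \<in> Q \<Longrightarrow> H f i j x = H f j i x"
  unfolding H_def by (simp add: dx_commute[of f x i j] Gam_sym[of x _ i j])

text \<open>This is \<nabla>g = 0. Lowering the upper index of \<open>Gam\<close> leaves half of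
  three derivatives of the metric; on adding the expression with i and j exchanged, only the
  k-derivative survives.\<close>

lemma metric_compatible:
  assumes x: "x \<in> Q"
  shows "dx k (G i j) x = (\<Sum>m\<in>UNIV. Gam m k i x * G m j x) + (\<Sum>m\<in>UNIV. Gam m k j x * G m i x)"
proof -
  have low: "(\<Sum>m\<in>UNIV. Gam m k i x * G m j x) = 1/2 * (dx k (G i j) x + dx i (G k j) x - dx j (G k i) x)" for i j
    using lower_raise[OF x, of j "\<lambda>l. 1/2 * (dx k (G i l) x + dx i (G k l) x - dx l (G k i) x)"]
    by (simp add: Gam_def mult_ac)
  show ?thesis unfolding low using dirD_G_sym[OF x, of "(0, axis k 1)" i j] by (simp add: field_simps)
qed

text \<open>Differentiate \<open>inv_G\<close> and solve for the derivative of the inverse. The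
  direction is arbitrary, so the rule serves both for space and for the flow in time.\<close>

lemma dirD_Gi:
  assumes x: "x \<in> Q"
  shows "dirD Q v (Gi i j) x = - (\<Sum>a\<in>UNIV. \<Sum>b\<in>UNIV. Gi i a x * Gi b j x * dirD Q v (G a b) x)"
proof -
  have z: "(\<Sum>k\<in>UNIV. Gi i k x * dirD Q v (G k b) x + dirD Q v (Gi i k) x * G k b x) = 0" for b
  proof -
    have "dirD Q v (\<lambda>x. \<Sum>k\<in>UNIV. Gi i k x * G k b x) x = dirD Q v (\<lambda>x. if i = b then 1 else 0) x"
      by (rule dirD_cong) (use inv_G x in auto)
    then show ?thesis using x by (simp add: d_sum d_mult d_const smooth_intros)
  qed
  then have "(\<Sum>k\<in>UNIV. dirD Q v (Gi i k) x * G k b x) = - (\<Sum>k\<in>UNIV. Gi i k x * dirD Q v (G k b) x)" for b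
    using z[of b] unfolding sum.distrib by linarith
  then have "dirD Q v (Gi i j) x = (\<Sum>b\<in>UNIV. Gi b j x * - (\<Sum>k\<in>UNIV. Gi i k x * dirD Q v (G k b) x))"
    using raise_lower[OF x, of j "\<lambda>k. dirD Q v (Gi i k) x"] by simp
  also have "\<dots> = - (\<Sum>b\<in>UNIV. \<Sum>k\<in>UNIV. Gi i k x * Gi b j x * dirD Q v (G k b) x)"
    by (simp add: sum_distrib_left sum_negf mult_ac)
  finally show ?thesis by (subst sum.swap) simp
qed

text \<open>The inverse metric is parallel too; this is \<open>metric_compatible\<close> inserted
  into \<open>dirD_Gi\<close>.\<close>

lemma dx_Gi:
  assumes x: "x \<in> Q"
  shows "dx k (Gi i j) x = - (\<Sum>l\<in>UNIV. Gam i k l x * Gi l j x) - (\<Sum>l\<in>UNIV. Gam j k l x * Gi i l x)"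
proof -
  have "(\<Sum>a\<in>UNIV. \<Sum>b\<in>UNIV. Gi i a x * Gi b j x * dx k (G a b) x)
    = (\<Sum>a\<in>UNIV. Gi i a x * (\<Sum>b\<in>UNIV. Gi b j x * (\<Sum>m\<in>UNIV. Gam m k a x * G m b x)))
    + (\<Sum>a\<in>UNIV. \<Sum>b\<in>UNIV. Gi b j x * (Gi a i x * (\<Sum>m\<in>UNIV. Gam m k b x * G m a x)))"
    by (simp add: metric_compatible[OF x] sum.distrib distrib_left sum_distrib_left mult_ac sym_Gi[OF x, of i])
  also have "(\<Sum>a\<in>UNIV. \<Sum>b\<in>UNIV. Gi b j x * (Gi a i x * (\<Sum>m\<in>UNIV. Gam m k b x * G m a x)))
    = (\<Sum>b\<in>UNIV. Gi b j x * (\<Sum>a\<in>UNIV. (Gi a i x * (\<Sum>m\<in>UNIV. Gam m k b x * G m a x))))"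
    by (subst sum.swap) (simp add: sum_distrib_left)
  finally show ?thesis unfolding dirD_Gi[OF x] raise_lower[OF x]
    by (simp add: mult.commute)
qed

text \<open>Raising an index commutes with covariant differentiation, so the covariant derivative of
  the gradient is the Hessian with one index raised.\<close>

lemma dx_V:
  assumes f: "smooth f" and x: "x \<in> Q"
  shows "dx j (V f i) x = W f i j x - (\<Sum>k\<in>UNIV. Gam i j k x * V f k x)"
proof -
  have dd: "dx j (dx a f) x = H f a j x + (\<Sum>k\<in>UNIV. Gam k j a x * dx k f x)" for a
    using H_sym[OF f x, of a j] by (simp add: H_def)
  have "dx j (V f i) x = (\<Sum>a\<in>UNIV. Gi i a x * dx j (dx a f) x) + (\<Sum>a\<in>UNIV. dx j (Gi i a) x * dx a f x)"
    unfolding V_def using f x by (simp add: d_sum d_mult smooth_intros sum.distrib)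
  also have "(\<Sum>a\<in>UNIV. Gi i a x * dx j (dx a f) x) = W f i j x + (\<Sum>a\<in>UNIV. \<Sum>k\<in>UNIV. Gam k j a x * Gi i a x * dx k f x)"
    unfolding dd W_def by (simp add: distrib_left sum.distrib sum_distrib_left mult_ac)
  also have "(\<Sum>a\<in>UNIV. dx j (Gi i a) x * dx a f x) =
      - (\<Sum>a\<in>UNIV. \<Sum>l\<in>UNIV. Gam i j l x * (Gi l a x * dx a f x)) - (\<Sum>a\<in>UNIV. \<Sum>l\<in>UNIV. Gam a j l x * Gi i l x * dx a f x)"
    unfolding dx_Gi[OF x] by (simp add: sum_subtractf sum_negf algebra_simps sum_distrib_right sum_distrib_left)
  also have "(\<Sum>a\<in>UNIV. \<Sum>l\<in>UNIV. Gam i j l x * (Gi l a x * dx a f x)) = (\<Sum>k\<in>UNIV. Gam i j k x * V f k x)"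
    unfolding V_def by (subst sum.swap) (simp add: sum_distrib_left)
  also have "(\<Sum>a\<in>UNIV. \<Sum>k\<in>UNIV. Gam k j a x * Gi i a x * dx k f x) = (\<Sum>a\<in>UNIV. \<Sum>l\<in>UNIV. Gam a j l x * Gi i l x * dx a f x)"
    by (rule sum.swap)
  finally show ?thesis by simp
qed

lemma Pr_sym: "x \<in> Q \<Longrightarrow> Pr f h x = Pr h f x"
  unfolding Pr_def V_def sum_distrib_right
  by (subst sum.swap) (simp add: sym_Gi mult_ac)

lemma sum_W_dx:
  assumes f: "smooth f" and x: "x \<in> Q"
  shows "(\<Sum>i\<in>UNIV. W f i k x * dx i h x) = (\<Sum>j\<in>UNIV. H f k j x * V h j x)"
  unfolding W_def V_def sum_distrib_right sum_distrib_left
  by (subst sum.swap) (simp add: sym_Gi[OF x] H_sym[OF f x, of k] mult_ac)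

text \<open>The Leibniz rule for \<nabla>: the Christoffel terms of the vector factor
  \<open>V f\<close> and of the covector dh cancel.\<close>

lemma dx_Pr:
  assumes f: "smooth f" and h: "smooth h" and x: "x \<in> Q"
  shows "dx k (Pr f h) x = (\<Sum>j\<in>UNIV. H f k j x * V h j x) + (\<Sum>j\<in>UNIV. H h k j x * V f j x)"
proof -
  have "dx k (Pr f h) x = (\<Sum>i\<in>UNIV. V f i x * dx k (dx i h) x) + (\<Sum>i\<in>UNIV. dx k (V f i) x * dx i h x)"
    unfolding Pr_def using f h x by (simp add: d_sum d_mult smooth_intros sum.distrib)
  also have "(\<Sum>i\<in>UNIV. V f i x * dx k (dx i h) x) =
     (\<Sum>j\<in>UNIV. H h k j x * V f j x) + (\<Sum>i\<in>UNIV. \<Sum>l\<in>UNIV. V f i x * (Gam l k i x * dx l h x))"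
    unfolding H_def by (simp add: algebra_simps sum_subtractf sum_distrib_right sum_distrib_left)
  also have "(\<Sum>i\<in>UNIV. dx k (V f i) x * dx i h x) = (\<Sum>i\<in>UNIV. W f i k x * dx i h x) -
     (\<Sum>i\<in>UNIV. \<Sum>l\<in>UNIV. V f l x * (Gam i k l x * dx i h x))"
    unfolding dx_V[OF f x] by (simp add: algebra_simps sum_subtractf sum_distrib_left)
  also have "(\<Sum>i\<in>UNIV. \<Sum>l\<in>UNIV. V f l x * (Gam i k l x * dx i h x)) = (\<Sum>i\<in>UNIV. \<Sum>l\<in>UNIV. V f i x * (Gam l k i x * dx l h x))"
    by (rule sum.swap)
  finally show ?thesis unfolding sum_W_dx[OF f x] by simp
qed

text \<open>By \<open>dx_Pr\<close> each term on the right is a sum of two Hessian values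
  \<open>B\<close>. By symmetry those of \<open>u\<close> and \<open>v\<close> cancel and that of
  \<open>f\<close> occurs twice, as in the Koszul formula.\<close>

lemma Hessian_polarised:
  assumes f: "smooth f" and u: "smooth u" and v: "smooth v" and x: "x \<in> Q"
  shows "2 * (\<Sum>i\<in>UNIV. \<Sum>j\<in>UNIV. H f i j x * V u i x * V v j x) =
    Pr u (Pr f v) x + Pr v (Pr f u) x - Pr f (Pr u v) x"
proof -
  define B where "B f u v = (\<Sum>i\<in>UNIV. \<Sum>j\<in>UNIV. H f i j x * V u i x * V v j x)" for f u v
  have P: "Pr u (Pr f v) x = B f u v + B v u f" if "smooth f" "smooth v" for u f v
    unfolding Pr_def[of u] dx_Pr[OF that x] B_def
    by (simp add: distrib_left sum.distrib sum_distrib_left mult_ac)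
  have S: "B f u v = B f v u" if "smooth f" for f u v
    unfolding B_def by (subst sum.swap) (simp add: H_sym[OF that x, of _ ] mult_ac)
  show ?thesis
    using P[OF f v, of u] P[OF f u, of v] P[OF u v, of f] S[OF f, of u v] S[OF v, of u f] S[OF u, of v f]
    unfolding B_def[of f u v, symmetric] by linarith
qed

lemma Lap_trace:
  assumes f: "smooth f" and x: "x \<in> Q"
  shows "Lap f x = (\<Sum>i\<in>UNIV. W f i i x)"
  unfolding Lap_def W_def by (simp add: H_sym[OF f x])

text \<open>The Christoffel terms of the divergence cancel those of \<open>dx_V\<close>, which
  leaves the trace of \<open>W\<close>.\<close>

lemma Lap_div:
  assumes f: "smooth f" and x: "x \<in> Q"
  shows "Lap f x = dv (V f) x"
  unfolding Lap_trace[OF f x] dv_def dx_V[OF f x] by simp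

lemma dv_cong: "(\<And>i x. x \<in> Q \<Longrightarrow> X i x = Y i x) \<Longrightarrow> x \<in> Q \<Longrightarrow> dv X x = dv Y x"
  unfolding dv_def by (simp add: dirD_cong[of Q "X _" "Y _"])

lemma dv_add: "(\<And>i. smooth (X i)) \<Longrightarrow> (\<And>i. smooth (Y i)) \<Longrightarrow> x \<in> Q \<Longrightarrow> dv (\<lambda>i x. X i x + Y i x) x = dv X x + dv Y x"
  unfolding dv_def by (simp add: d_add sum.distrib distrib_left)

lemma dv_cmult: "(\<And>i. smooth (X i)) \<Longrightarrow> x \<in> Q \<Longrightarrow> dv (\<lambda>i x. c * X i x) x = c * dv X x"
  unfolding dv_def by (simp add: d_cmult sum_distrib_left distrib_left mult_ac)

lemma V_add: "smooth f \<Longrightarrow> smooth h \<Longrightarrow> x \<in> Q \<Longrightarrow> V (\<lambda>x. f x + h x) i x = V f i x + V h i x"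
  unfolding V_def by (simp add: d_add sum.distrib distrib_left)

lemma V_cmult: "smooth f \<Longrightarrow> x \<in> Q \<Longrightarrow> V (\<lambda>x. c * f x) i x = c * V f i x"
  unfolding V_def by (simp add: d_cmult sum_distrib_left distrib_left mult_ac)

lemma Lap_add: "smooth f \<Longrightarrow> smooth h \<Longrightarrow> x \<in> Q \<Longrightarrow> Lap (\<lambda>x. f x + h x) x = Lap f x + Lap h x"
  using dv_cong[of "V (\<lambda>x. f x + h x)" "\<lambda>i x. V f i x + V h i x"]
  by (simp add: Lap_div smooth_intros dv_add V_add)

lemma Lap_cmult: "smooth f \<Longrightarrow> x \<in> Q \<Longrightarrow> Lap (\<lambda>x. c * f x) x = c * Lap f x"
  using dv_cong[of "V (\<lambda>x. c * f x)" "\<lambda>i x. c * V f i x"]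
  by (simp add: Lap_div smooth_intros dv_cmult V_cmult)

lemma Lap_cong:
  assumes "\<And>x. x \<in> Q \<Longrightarrow> f x = h x" "x \<in> Q"
  shows "Lap f x = Lap h x"
proof -
  have "dx i f y = dx i h y" if "y \<in> Q" for i y using assms(1) that by (rule dirD_cong)
  then have "dx j (dx i f) y = dx j (dx i h) y" "dx i f y = dx i h y" if "y \<in> Q" for i j y
    using that dirD_cong[of Q "dx i f" "dx i h" y] by auto
  with assms(2) show ?thesis by (simp add: Lap_def H_def)
qed

lemma Pr_cong:
  assumes "\<And>x. x \<in> Q \<Longrightarrow> f x = f' x" "\<And>x. x \<in> Q \<Longrightarrow> h x = h' x" "x \<in> Q"
  shows "Pr f h x = Pr f' h' x"
  using assms(3) dirD_cong[of Q f f' x] dirD_cong[of Q h h' x] assms(1,2) by (simp add: Pr_def V_def)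

lemma Lap_diff: "smooth f \<Longrightarrow> smooth h \<Longrightarrow> x \<in> Q \<Longrightarrow> Lap (\<lambda>x. f x - h x) x = Lap f x - Lap h x"
  using Lap_add[of f "\<lambda>x. (-1) * h x" x] Lap_cmult[of h x "-1"] by (simp add: smooth_intros)

lemma Pr_add: "smooth f \<Longrightarrow> smooth h \<Longrightarrow> x \<in> Q \<Longrightarrow> Pr u (\<lambda>x. f x + h x) x = Pr u f x + Pr u h x"
  and Pr_diff: "smooth f \<Longrightarrow> smooth h \<Longrightarrow> x \<in> Q \<Longrightarrow> Pr u (\<lambda>x. f x - h x) x = Pr u f x - Pr u h x"
  and Pr_cmult: "smooth f \<Longrightarrow> x \<in> Q \<Longrightarrow> Pr u (\<lambda>x. c * f x) x = c * Pr u f x"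
  and Pr_mult: "smooth f \<Longrightarrow> smooth h \<Longrightarrow> x \<in> Q \<Longrightarrow> Pr u (\<lambda>x. f x * h x) x = f x * Pr u h x + h x * Pr u f x"
  unfolding Pr_def by (simp_all add: d_add d_diff d_cmult d_mult algebra_simps sum.distrib sum_subtractf sum_distrib_left)

lemma Lap_time:
  assumes s: "smooth s" "\<And>i x. x \<in> Q \<Longrightarrow> dx i s x = 0" and f: "smooth f" and x: "x \<in> Q"
  shows "Lap (\<lambda>x. s x * f x) x = s x * Lap f x"
proof -
  have 1: "dx j (\<lambda>x. s x * f x) y = s y * dx j f y" if "y \<in> Q" for j y
    using that s f by (simp add: d_mult)
  have "dx i (dx j (\<lambda>x. s x * f x)) x = dx i (\<lambda>x. s x * dx j f x) x" for i j
    by (rule dirD_cong) (use 1 x in auto)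
  then have 2: "dx i (dx j (\<lambda>x. s x * f x)) x = s x * dx i (dx j f) x" for i j
    using x s f by (simp add: d_mult smooth_intros)
  show ?thesis unfolding Lap_def H_def 1[OF x] 2
    by (simp add: algebra_simps sum_distrib_left)
qed

lemma Lap_time_const:
  assumes s: "smooth s" "\<And>i x. x \<in> Q \<Longrightarrow> dx i s x = 0" and x: "x \<in> Q"
  shows "Lap s x = 0"
proof -
  have "dx i (dx j s) x = dx i (\<lambda>x. 0) x" for i j
    by (rule dirD_cong) (use s x in auto)
  then show ?thesis unfolding Lap_def H_def using s x by (simp add: d_const)
qed

lemma Pr_time_const:
  assumes s: "\<And>i x. x \<in> Q \<Longrightarrow> dx i s x = 0" and x: "x \<in> Q"
  shows "Pr u s x = 0"
  unfolding Pr_def using s x by simp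

text \<open>The squared norm of S is the trace of the square of the endomorphism obtained by raising
  an index; the symmetry of S allows the regrouping.\<close>

lemma norm_sq_mixed:
  assumes x: "x \<in> Q" and S: "\<And>i j. S i j = S j i"
  shows "(\<Sum>i\<in>UNIV. \<Sum>j\<in>UNIV. \<Sum>k\<in>UNIV. \<Sum>l\<in>UNIV. Gi i k x * Gi j l x * S i j * S k l)
    = (\<Sum>k\<in>UNIV. \<Sum>j\<in>UNIV. (\<Sum>i\<in>UNIV. Gi k i x * S i j) * (\<Sum>i\<in>UNIV. Gi j i x * S i k))"
proof -
  have "(\<Sum>i\<in>UNIV. \<Sum>j\<in>UNIV. \<Sum>k\<in>UNIV. \<Sum>l\<in>UNIV. Gi i k x * Gi j l x * S i j * S k l)
      = (\<Sum>i\<in>UNIV. \<Sum>k\<in>UNIV. \<Sum>j\<in>UNIV. \<Sum>l\<in>UNIV. Gi k i x * S i j * (Gi j l x * S l k))"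
  proof (rule sum.cong[OF refl])
    fix i
    have "Gi i k x * Gi j l x * S i j * S k l = Gi k i x * S i j * (Gi j l x * S l k)" for j k l
      by (simp add: sym_Gi[OF x, of i k] S[of k l])
    then have "(\<Sum>j\<in>UNIV. \<Sum>k\<in>UNIV. \<Sum>l\<in>UNIV. Gi i k x * Gi j l x * S i j * S k l)
      = (\<Sum>j\<in>UNIV. \<Sum>k\<in>UNIV. \<Sum>l\<in>UNIV. Gi k i x * S i j * (Gi j l x * S l k))" by (simp only:)
    then show "(\<Sum>j\<in>UNIV. \<Sum>k\<in>UNIV. \<Sum>l\<in>UNIV. Gi i k x * Gi j l x * S i j * S k l)
      = (\<Sum>k\<in>UNIV. \<Sum>j\<in>UNIV. \<Sum>l\<in>UNIV. Gi k i x * S i j * (Gi j l x * S l k))"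
      by (simp only: sum.swap[of "\<lambda>j k. \<Sum>l\<in>UNIV. Gi k i x * S i j * (Gi j l x * S l k)"])
  qed
  also have "\<dots> = (\<Sum>k\<in>UNIV. \<Sum>i\<in>UNIV. \<Sum>j\<in>UNIV. \<Sum>l\<in>UNIV. Gi k i x * S i j * (Gi j l x * S l k))"
    by (rule sum.swap)
  also have "\<dots> = (\<Sum>k\<in>UNIV. \<Sum>j\<in>UNIV. \<Sum>i\<in>UNIV. \<Sum>l\<in>UNIV. Gi k i x * S i j * (Gi j l x * S l k))"
    by (intro sum.cong refl sum.swap)
  finally show ?thesis by (simp add: sum_product)
qed

lemma V_Pr_self:
  assumes f: "smooth f" and x: "x \<in> Q"
  shows "V (Pr f f) i x = 2 * (\<Sum>j\<in>UNIV. W f i j x * V f j x)"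
proof -
  have "V (Pr f f) i x = 2 * (\<Sum>k\<in>UNIV. \<Sum>j\<in>UNIV. Gi i k x * H f k j x * V f j x)"
    unfolding V_def[of "Pr f f"] dx_Pr[OF f f x] by (simp add: sum_distrib_left mult_ac)
  then show ?thesis unfolding W_def sum_distrib_right by (subst sum.swap)
qed

text \<open>The contracted Ricci identity: the divergence of the Hessian is d(\<Delta>f) plus
  Ric(\<nabla>f). The Christoffel terms of the covariant divergence of \<open>W\<close> stand on the
  right-hand side.\<close>

lemma div_W:
  assumes f: "smooth f" and x: "x \<in> Q"
  shows "(\<Sum>i\<in>UNIV. dx i (W f i j) x) = dx j (Lap f) x + (\<Sum>k\<in>UNIV. Ric j k x * V f k x)
    + (\<Sum>i\<in>UNIV. \<Sum>k\<in>UNIV. Gam i j k x * W f k i x) - (\<Sum>i\<in>UNIV. \<Sum>k\<in>UNIV. Gam i i k x * W f k j x)"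
proof -
  have "dx i (W f i j) x = dx i (\<lambda>x. dx j (V f i) x + (\<Sum>k\<in>UNIV. Gam i j k x * V f k x)) x" for i
    by (rule dirD_cong) (use dx_V f x in auto)
  then have dW: "dx i (W f i j) x = dx i (dx j (V f i)) x +
      (\<Sum>k\<in>UNIV. Gam i j k x * dx i (V f k) x + dx i (Gam i j k) x * V f k x)" for i
    using f x by (simp add: d_add d_sum d_mult smooth_intros)
  have "dx j (Lap f) x = dx j (dv (V f)) x"
    by (rule dirD_cong) (use Lap_div f x in auto)
  also have "\<dots> = (\<Sum>i\<in>UNIV. dx j (dx i (V f i)) x +
      (\<Sum>k\<in>UNIV. Gam i i k x * dx j (V f k) x + dx j (Gam i i k) x * V f k x))"
    unfolding dv_def using f x by (simp add: d_add d_sum d_mult smooth_intros)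
  finally have dL: "dx j (Lap f) x = \<dots>" .
  \<comment> \<open>The second derivatives of \<open>V f\<close> cancel because coordinate
    derivatives commute; what remains contains only Christoffel symbols and first derivatives of
    \<open>V f\<close>.\<close>
  have "(\<Sum>i\<in>UNIV. dx i (W f i j) x) - dx j (Lap f) x =
    (\<Sum>i\<in>UNIV. \<Sum>k\<in>UNIV. Gam i j k x * dx i (V f k) x + dx i (Gam i j k) x * V f k x
       - Gam i i k x * dx j (V f k) x - dx j (Gam i i k) x * V f k x)"
    unfolding dW dL using f x
    by (simp add: dx_commute[of "V f _" x _ j] smooth_intros sum.distrib sum_subtractf)
  also have "\<dots> = (\<Sum>i\<in>UNIV. \<Sum>k\<in>UNIV. Gam i j k x * W f k i x) - (\<Sum>i\<in>UNIV. \<Sum>k\<in>UNIV. Gam i i k x * W f k j x)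
    + ((\<Sum>i\<in>UNIV. \<Sum>k\<in>UNIV. (dx i (Gam i j k) x - dx j (Gam i i k) x) * V f k x)
      + (\<Sum>i\<in>UNIV. \<Sum>k\<in>UNIV. \<Sum>l\<in>UNIV. (Gam i i k x * Gam k j l x - Gam i j k x * Gam k i l x) * V f l x))"
    unfolding dx_V[OF f x] by (simp add: algebra_simps sum.distrib sum_subtractf sum_distrib_left)
  also have "(\<Sum>i\<in>UNIV. \<Sum>k\<in>UNIV. \<Sum>l\<in>UNIV. (Gam i i k x * Gam k j l x - Gam i j k x * Gam k i l x) * V f l x)
     = (\<Sum>i\<in>UNIV. \<Sum>k\<in>UNIV. \<Sum>m\<in>UNIV. (Gam i i m x * Gam m j k x - Gam i j m x * Gam m i k x) * V f k x)"
    by (rule sum.cong[OF refl], rule sum.swap)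
  \<comment> \<open>The derivatives and the products of Christoffel symbols combine to the
    curvature, whose trace is Ricci.\<close>
  also have "(\<Sum>i\<in>UNIV. \<Sum>k\<in>UNIV. (dx i (Gam i j k) x - dx j (Gam i i k) x) * V f k x) + \<dots>
     = (\<Sum>i\<in>UNIV. \<Sum>k\<in>UNIV. Rm i k i j x * V f k x)"
    unfolding Rm_def by (simp add: distrib_right sum.distrib sum_distrib_right)
  also have "\<dots> = (\<Sum>k\<in>UNIV. Ric j k x * V f k x)"
    unfolding Ric_def sum_distrib_right by (rule sum.swap)
  finally show ?thesis by linarith
qed

text \<open>Half the gradient of |\<nabla>f|^2 is the field X obtained by applying
  \<open>W f\<close> to \<nabla>f, so the left-hand side is twice div X. The derivative of \<nabla>f
  yields the trace of the square of the Hessian, that of \<open>W f\<close> the terms of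
  \<open>div_W\<close>.\<close>

lemma Bochner:
  assumes f: "smooth f" and x: "x \<in> Q"
  shows "Lap (Pr f f) x = 2 * (\<Sum>i\<in>UNIV. \<Sum>j\<in>UNIV. W f i j x * W f j i x) + 2 * Pr f (Lap f) x
    + 2 * (\<Sum>j\<in>UNIV. \<Sum>k\<in>UNIV. Ric j k x * V f j x * V f k x)"
proof -
  define X where "X i x = (\<Sum>j\<in>UNIV. W f i j x * V f j x)" for i x
  have sX: "smooth (X i)" for i unfolding X_def using f by (intro smooth_intros)
  have "Lap (Pr f f) x = dv (V (Pr f f)) x" using f x by (intro Lap_div smooth_intros)
  also have "\<dots> = dv (\<lambda>i x. 2 * X i x) x"
    by (rule dv_cong[OF _ x]) (simp add: V_Pr_self[OF f] X_def)
  also have "\<dots> = 2 * dv X x" using sX x by (rule dv_cmult)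
  also have "dv X x = (\<Sum>i\<in>UNIV. \<Sum>j\<in>UNIV. W f i j x * dx i (V f j) x)
      + (\<Sum>i\<in>UNIV. \<Sum>j\<in>UNIV. dx i (W f i j) x * V f j x)
      + (\<Sum>i\<in>UNIV. \<Sum>k\<in>UNIV. \<Sum>j\<in>UNIV. Gam i i k x * W f k j x * V f j x)"
    unfolding dv_def X_def using f x
    by (simp add: d_sum d_mult smooth_intros sum.distrib sum_distrib_left mult_ac)
  also have "(\<Sum>i\<in>UNIV. \<Sum>j\<in>UNIV. W f i j x * dx i (V f j) x) = (\<Sum>i\<in>UNIV. \<Sum>j\<in>UNIV. W f i j x * W f j i x)
      - (\<Sum>i\<in>UNIV. \<Sum>j\<in>UNIV. \<Sum>l\<in>UNIV. Gam j l i x * W f i j x * V f l x)"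
    unfolding dx_V[OF f x]
    by (simp add: right_diff_distrib sum_subtractf sum_distrib_left mult_ac Gam_sym[OF x])
  also have "(\<Sum>i\<in>UNIV. \<Sum>j\<in>UNIV. dx i (W f i j) x * V f j x) = (\<Sum>j\<in>UNIV. (\<Sum>i\<in>UNIV. dx i (W f i j) x) * V f j x)"
    unfolding sum_distrib_right by (rule sum.swap)
  also have "\<dots> = Pr f (Lap f) x + (\<Sum>j\<in>UNIV. \<Sum>k\<in>UNIV. Ric j k x * V f j x * V f k x)
     + (\<Sum>j\<in>UNIV. \<Sum>i\<in>UNIV. \<Sum>k\<in>UNIV. Gam i j k x * W f k i x * V f j x)
     - (\<Sum>j\<in>UNIV. \<Sum>i\<in>UNIV. \<Sum>k\<in>UNIV. Gam i i k x * W f k j x * V f j x)"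
    unfolding div_W[OF f x] Pr_def
    by (simp add: algebra_simps sum.distrib sum_subtractf sum_distrib_left sum_distrib_right)
  also have "(\<Sum>j\<in>UNIV. \<Sum>i\<in>UNIV. \<Sum>k\<in>UNIV. Gam i i k x * W f k j x * V f j x)
    = (\<Sum>i\<in>UNIV. \<Sum>k\<in>UNIV. \<Sum>j\<in>UNIV. Gam i i k x * W f k j x * V f j x)"
    by (subst sum.swap) (intro sum.cong refl sum.swap)
  also have "(\<Sum>j\<in>UNIV. \<Sum>i\<in>UNIV. \<Sum>k\<in>UNIV. Gam i j k x * W f k i x * V f j x)
    = (\<Sum>i\<in>UNIV. \<Sum>j\<in>UNIV. \<Sum>l\<in>UNIV. Gam j l i x * W f i j x * V f l x)"
  proof -
    have "(\<Sum>j\<in>UNIV. \<Sum>i\<in>UNIV. \<Sum>k\<in>UNIV. Gam i j k x * W f k i x * V f j x) =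
      (\<Sum>j\<in>UNIV. \<Sum>k\<in>UNIV. \<Sum>i\<in>UNIV. Gam i j k x * W f k i x * V f j x)"
      by (intro sum.cong refl sum.swap)
    also have "\<dots> = (\<Sum>k\<in>UNIV. \<Sum>j\<in>UNIV. \<Sum>i\<in>UNIV. Gam i j k x * W f k i x * V f j x)" by (rule sum.swap)
    also have "\<dots> = (\<Sum>k\<in>UNIV. \<Sum>i\<in>UNIV. \<Sum>j\<in>UNIV. Gam i j k x * W f k i x * V f j x)"
      by (intro sum.cong refl sum.swap)
    finally show ?thesis .
  qed
  finally show ?thesis by (simp add: algebra_simps)
qed

end

text \<open>\<open>rho\<close> stands for sqrt (det g). It enters through its positivity and
  Jacobi's formula for its logarithmic derivative, valid in time and space directions alike.\<close>

locale geom_volume = geom I U G Gi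
  for I :: "real set" and U :: "(real ^ 'n::finite) set" and G Gi +
  fixes rho :: "real \<times> (real ^ 'n) \<Rightarrow> real"
  assumes smooth_rho [smooth_intros]: "smooth rho"
    and rho_pos: "\<And>x. x \<in> Q \<Longrightarrow> rho x > 0"
    and dirD_rho: "\<And>v x. x \<in> Q \<Longrightarrow>
      dirD Q v rho x = 1/2 * rho x * (\<Sum>i\<in>UNIV. \<Sum>j\<in>UNIV. Gi i j x * dirD Q v (G i j) x)"
begin

definition TG :: "'n \<Rightarrow> real \<times> (real ^ 'n) \<Rightarrow> real" where
  "TG k x = (\<Sum>i\<in>UNIV. Gam i i k x)"

lemma smooth_TG [smooth_intros]: "smooth (TG k)"
  unfolding TG_def by (intro smooth_intros)

text \<open>In the contraction of \<open>Gam\<close> two of the three derivatives of the metric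
  cancel by symmetry; half the trace of the third is the logarithmic derivative of
  \<open>rho\<close>.\<close>

lemma dx_rho:
  assumes x: "x \<in> Q"
  shows "dx k rho x = rho x * TG k x"
proof -
  have "(\<Sum>i\<in>UNIV. \<Sum>l\<in>UNIV. Gi i l x * dx i (G k l) x) = (\<Sum>i\<in>UNIV. \<Sum>l\<in>UNIV. Gi i l x * dx l (G i k) x)"
    by (subst sum.swap) (simp add: sym_Gi[OF x] dirD_G_sym[OF x, of _ k])
  then have "TG k x = 1/2 * (\<Sum>i\<in>UNIV. \<Sum>l\<in>UNIV. Gi i l x * dx k (G i l) x)"
    unfolding TG_def Gam_def
    by (simp add: algebra_simps sum.distrib sum_subtractf flip: sum_divide_distrib)
  then show ?thesis unfolding dirD_rho[OF x] by simp
qed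

lemma dv_TG: "x \<in> Q \<Longrightarrow> dv X x = (\<Sum>i\<in>UNIV. dx i (X i) x) + (\<Sum>k\<in>UNIV. TG k x * X k x)"
  unfolding dv_def TG_def sum.distrib sum_distrib_right by (subst (2) sum.swap) simp

text \<open>Multiplication by \<open>rho\<close> turns the Riemannian divergence into the Euclidean
  one, which is what integration in a chart requires.\<close>

lemma rho_dv:
  assumes "\<And>i. smooth (X i)" and x: "x \<in> Q"
  shows "(\<Sum>i\<in>UNIV. dx i (\<lambda>x. rho x * X i x) x) = rho x * dv X x"
  using assms by (simp add: dv_TG d_mult smooth_intros sum.distrib dx_rho sum_distrib_left distrib_left mult_ac)

end

subsection \<open>Evolution of the entropy density\<close>

locale geom_flow = geom_volume I U G Gi rho
  for I :: "real set" and U :: "(real ^ 'n::finite) set" and G Gi rho +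
  fixes al :: "'n \<Rightarrow> 'n \<Rightarrow> real \<times> (real ^ 'n) \<Rightarrow> real"
  assumes smooth_al [smooth_intros]: "\<And>i j. smooth (al i j)"
    and sym_al: "\<And>i j x. x \<in> Q \<Longrightarrow> al i j x = al j i x"
    and flow: "\<And>i j x. x \<in> Q \<Longrightarrow> dt (G i j) x = - 2 * al i j x"
begin

text \<open>The endomorphism obtained from \<alpha> by raising its first index, the counterpart of
  \<open>W\<close>.\<close>

definition ma :: "'n \<Rightarrow> 'n \<Rightarrow> real \<times> (real ^ 'n) \<Rightarrow> real" where
  "ma i k x = (\<Sum>j\<in>UNIV. Gi i j x * al j k x)"

definition trA :: "real \<times> (real ^ 'n) \<Rightarrow> real" where
  "trA x = (\<Sum>i\<in>UNIV. \<Sum>j\<in>UNIV. Gi i j x * al i j x)"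

text \<open>The divergence of \<alpha>, with its covariant derivative written out.\<close>

definition Dal :: "'n \<Rightarrow> real \<times> (real ^ 'n) \<Rightarrow> real" where
  "Dal k x = (\<Sum>i\<in>UNIV. \<Sum>j\<in>UNIV. Gi i j x * (dx i (al j k) x -
     (\<Sum>l\<in>UNIV. Gam l i j x * al l k x + Gam l i k x * al j l x)))"

lemma smooth_ma [smooth_intros]: "smooth (ma i k)"
  unfolding ma_def by (intro smooth_intros)

lemma smooth_trA [smooth_intros]: "smooth trA"
  unfolding trA_def by (intro smooth_intros)

lemma dt_Gi:
  assumes x: "x \<in> Q"
  shows "dt (Gi i j) x = 2 * (\<Sum>k\<in>UNIV. ma i k x * Gi k j x)"
  unfolding dirD_Gi[OF x] flow[OF x] ma_def sum_distrib_right
  by (subst (2) sum.swap) (simp add: sum_distrib_left sum_negf mult_ac)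

lemma dt_rho:
  assumes x: "x \<in> Q"
  shows "dt rho x = - trA x * rho x"
  unfolding dirD_rho[OF x] flow[OF x] trA_def by (simp add: sum_negf mult_ac flip: sum_distrib_left)

text \<open>\<open>rho * TG k\<close> is the k-th derivative of \<open>rho\<close>, so exchanging
  the derivatives in time and space reduces the claim to \<open>dt_rho\<close>.\<close>

lemma dt_TG:
  assumes x: "x \<in> Q"
  shows "dt (TG k) x = - dx k trA x"
proof -
  have "dt (\<lambda>x. rho x * TG k x) x = dt (dx k rho) x"
    by (rule dirD_cong) (use dx_rho x in auto)
  also have "\<dots> = dx k (dt rho) x"
    by (rule dt_dx_commute[OF smooth_rho x])
  also have "\<dots> = dx k (\<lambda>x. - trA x * rho x) x"
    by (rule dirD_cong) (use dt_rho x in auto)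
  finally have "rho x * dt (TG k) x = - rho x * dx k trA x"
    using x by (simp add: d_mult d_uminus smooth_intros dx_rho dt_rho)
  then have "rho x * (dt (TG k) x + dx k trA x) = 0" by (simp add: distrib_left)
  then show ?thesis using rho_pos[OF x] by (simp add: add_eq_0_iff)
qed

text \<open>The gradient evolves also when f is constant in time, through the inverse metric; this
  contributes twice \<alpha> applied to \<nabla>f.\<close>

lemma dt_V:
  assumes f: "smooth f" and x: "x \<in> Q"
  shows "dt (V f i) x = V (dt f) i x + 2 * (\<Sum>k\<in>UNIV. ma i k x * V f k x)"
proof -
  have "dt (V f i) x = (\<Sum>j\<in>UNIV. Gi i j x * dt (dx j f) x) + (\<Sum>j\<in>UNIV. dt (Gi i j) x * dx j f x)"
    unfolding V_def using f x by (simp add: d_sum d_mult smooth_intros sum.distrib)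
  also have "(\<Sum>j\<in>UNIV. Gi i j x * dt (dx j f) x) = V (dt f) i x"
    unfolding V_def dt_dx_commute[OF f x] ..
  also have "(\<Sum>j\<in>UNIV. dt (Gi i j) x * dx j f x) = 2 * (\<Sum>k\<in>UNIV. ma i k x * V f k x)"
    unfolding dt_Gi[OF x] V_def sum_distrib_left sum_distrib_right
    by (subst sum.swap) (simp add: mult_ac)
  finally show ?thesis .
qed

text \<open>The product rule for the divergence of the field \<alpha>(\<nabla>f): one part is
  Div(\<alpha>) on \<nabla>f, the other the inner product of \<alpha> with the Hessian.\<close>

lemma dv_ma_V:
  assumes f: "smooth f" and x: "x \<in> Q"
  shows "dv (\<lambda>i x. \<Sum>k\<in>UNIV. ma i k x * V f k x) x =
    (\<Sum>k\<in>UNIV. Dal k x * V f k x) + (\<Sum>i\<in>UNIV. \<Sum>k\<in>UNIV. ma i k x * W f k i x)"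
proof -
  \<comment> \<open>The covariant divergence of \<open>ma\<close> in its upper index is
    \<open>Dal\<close>; its connection term for the upper index stands on the left, that for the
    lower index on the right.\<close>
  have D: "(\<Sum>i\<in>UNIV. dx i (ma i k) x) + (\<Sum>i\<in>UNIV. \<Sum>l\<in>UNIV. Gam i i l x * ma l k x)
    = Dal k x + (\<Sum>i\<in>UNIV. \<Sum>l\<in>UNIV. Gam l i k x * ma i l x)" for k
  proof -
    have "(\<Sum>i\<in>UNIV. dx i (ma i k) x) = (\<Sum>i\<in>UNIV. \<Sum>j\<in>UNIV. Gi i j x * dx i (al j k) x)
        + (\<Sum>i\<in>UNIV. \<Sum>j\<in>UNIV. dx i (Gi i j) x * al j k x)"
      unfolding ma_def using x by (simp add: d_sum d_mult smooth_intros sum.distrib)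
    also have "(\<Sum>i\<in>UNIV. \<Sum>j\<in>UNIV. dx i (Gi i j) x * al j k x) =
       - (\<Sum>i\<in>UNIV. \<Sum>j\<in>UNIV. \<Sum>l\<in>UNIV. Gam i i l x * (Gi l j x * al j k x))
       - (\<Sum>i\<in>UNIV. \<Sum>j\<in>UNIV. \<Sum>l\<in>UNIV. Gi i l x * (Gam j i l x * al j k x))"
      unfolding dx_Gi[OF x]
      by (simp add: algebra_simps sum_subtractf sum_negf sum_distrib_left)
    also have "(\<Sum>i\<in>UNIV. \<Sum>j\<in>UNIV. \<Sum>l\<in>UNIV. Gam i i l x * (Gi l j x * al j k x)) =
       (\<Sum>i\<in>UNIV. \<Sum>l\<in>UNIV. Gam i i l x * ma l k x)"
      unfolding ma_def sum_distrib_left by (rule sum.cong[OF refl], rule sum.swap)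
    also have "(\<Sum>i\<in>UNIV. \<Sum>j\<in>UNIV. \<Sum>l\<in>UNIV. Gi i l x * (Gam j i l x * al j k x)) =
       (\<Sum>i\<in>UNIV. \<Sum>j\<in>UNIV. \<Sum>l\<in>UNIV. Gi i j x * (Gam l i j x * al l k x))"
      by (rule sum.cong[OF refl], rule sum.swap)
    finally have 1: "(\<Sum>i\<in>UNIV. dx i (ma i k) x) + (\<Sum>i\<in>UNIV. \<Sum>l\<in>UNIV. Gam i i l x * ma l k x) =
      (\<Sum>i\<in>UNIV. \<Sum>j\<in>UNIV. Gi i j x * dx i (al j k) x) - (\<Sum>i\<in>UNIV. \<Sum>j\<in>UNIV. \<Sum>l\<in>UNIV. Gi i j x * (Gam l i j x * al l k x))"
      by simp
    have "Dal k x = (\<Sum>i\<in>UNIV. \<Sum>j\<in>UNIV. Gi i j x * dx i (al j k) x)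
       - (\<Sum>i\<in>UNIV. \<Sum>j\<in>UNIV. \<Sum>l\<in>UNIV. Gi i j x * (Gam l i j x * al l k x))
       - (\<Sum>i\<in>UNIV. \<Sum>j\<in>UNIV. \<Sum>l\<in>UNIV. Gam l i k x * (Gi i j x * al j l x))"
      unfolding Dal_def
      by (simp add: algebra_simps sum_subtractf sum.distrib sum_distrib_left)
    also have "(\<Sum>i\<in>UNIV. \<Sum>j\<in>UNIV. \<Sum>l\<in>UNIV. Gam l i k x * (Gi i j x * al j l x)) = (\<Sum>i\<in>UNIV. \<Sum>l\<in>UNIV. Gam l i k x * ma i l x)"
      unfolding ma_def sum_distrib_left by (rule sum.cong[OF refl], rule sum.swap)
    finally show ?thesis using 1 by simp
  qed
  have "dv (\<lambda>i x. \<Sum>k\<in>UNIV. ma i k x * V f k x) x =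
     (\<Sum>i\<in>UNIV. \<Sum>k\<in>UNIV. dx i (ma i k) x * V f k x) + (\<Sum>i\<in>UNIV. \<Sum>l\<in>UNIV. \<Sum>k\<in>UNIV. Gam i i l x * ma l k x * V f k x)
     + (\<Sum>i\<in>UNIV. \<Sum>k\<in>UNIV. ma i k x * dx i (V f k) x)"
    unfolding dv_def using f x
    by (simp add: d_sum d_mult smooth_intros sum.distrib sum_distrib_left mult_ac)
  also have "(\<Sum>i\<in>UNIV. \<Sum>k\<in>UNIV. dx i (ma i k) x * V f k x) = (\<Sum>k\<in>UNIV. (\<Sum>i\<in>UNIV. dx i (ma i k) x) * V f k x)"
    unfolding sum_distrib_right by (rule sum.swap)
  also have "(\<Sum>i\<in>UNIV. \<Sum>l\<in>UNIV. \<Sum>k\<in>UNIV. Gam i i l x * ma l k x * V f k x)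
     = (\<Sum>k\<in>UNIV. (\<Sum>i\<in>UNIV. \<Sum>l\<in>UNIV. Gam i i l x * ma l k x) * V f k x)"
  proof -
    have "(\<Sum>i\<in>UNIV. \<Sum>l\<in>UNIV. \<Sum>k\<in>UNIV. Gam i i l x * ma l k x * V f k x) =
      (\<Sum>i\<in>UNIV. \<Sum>k\<in>UNIV. \<Sum>l\<in>UNIV. Gam i i l x * ma l k x * V f k x)"
      by (intro sum.cong refl sum.swap)
    also have "\<dots> = (\<Sum>k\<in>UNIV. \<Sum>i\<in>UNIV. \<Sum>l\<in>UNIV. Gam i i l x * ma l k x * V f k x)" by (rule sum.swap)
    finally show ?thesis by (simp add: sum_distrib_right)
  qed
  also have "(\<Sum>k\<in>UNIV. (\<Sum>i\<in>UNIV. dx i (ma i k) x) * V f k x) + \<dots>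
      = (\<Sum>k\<in>UNIV. Dal k x * V f k x) + (\<Sum>k\<in>UNIV. (\<Sum>i\<in>UNIV. \<Sum>l\<in>UNIV. Gam l i k x * ma i l x) * V f k x)"
    (is "?l = ?r")
  proof -
    have "?l = (\<Sum>k\<in>UNIV. ((\<Sum>i\<in>UNIV. dx i (ma i k) x) + (\<Sum>i\<in>UNIV. \<Sum>l\<in>UNIV. Gam i i l x * ma l k x)) * V f k x)"
      by (simp only: sum.distrib distrib_right)
    also have "\<dots> = ?r" unfolding D by (simp only: sum.distrib distrib_right)
    finally show ?thesis .
  qed
  also have "(\<Sum>i\<in>UNIV. \<Sum>k\<in>UNIV. ma i k x * dx i (V f k) x) = (\<Sum>i\<in>UNIV. \<Sum>k\<in>UNIV. ma i k x * W f k i x)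
      - (\<Sum>i\<in>UNIV. \<Sum>l\<in>UNIV. \<Sum>k\<in>UNIV. Gam l i k x * ma i l x * V f k x)"
    unfolding dx_V[OF f x] by (simp add: algebra_simps sum_subtractf sum_distrib_left)
  also have "(\<Sum>i\<in>UNIV. \<Sum>l\<in>UNIV. \<Sum>k\<in>UNIV. Gam l i k x * ma i l x * V f k x)
     = (\<Sum>k\<in>UNIV. (\<Sum>i\<in>UNIV. \<Sum>l\<in>UNIV. Gam l i k x * ma i l x) * V f k x)"
  proof -
    have "(\<Sum>i\<in>UNIV. \<Sum>l\<in>UNIV. \<Sum>k\<in>UNIV. Gam l i k x * ma i l x * V f k x) =
      (\<Sum>i\<in>UNIV. \<Sum>k\<in>UNIV. \<Sum>l\<in>UNIV. Gam l i k x * ma i l x * V f k x)"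
      by (intro sum.cong refl sum.swap)
    also have "\<dots> = (\<Sum>k\<in>UNIV. \<Sum>i\<in>UNIV. \<Sum>l\<in>UNIV. Gam l i k x * ma i l x * V f k x)" by (rule sum.swap)
    finally show ?thesis by (simp add: sum_distrib_right)
  qed
  finally show ?thesis by simp
qed

text \<open>Differentiate \<Delta>f as the divergence of \<nabla>f. The evolution of the gradient
  contributes 2 div(\<alpha>(\<nabla>f)), that of the contracted Christoffel symbol the term with
  the gradient of A.\<close>

lemma dt_Lap:
  assumes f: "smooth f" and x: "x \<in> Q"
  shows "dt (Lap f) x = Lap (dt f) x + 2 * (\<Sum>i\<in>UNIV. \<Sum>k\<in>UNIV. ma i k x * W f k i x)
    + (\<Sum>k\<in>UNIV. (2 * Dal k x - dx k trA x) * V f k x)"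
proof -
  define X where "X i x = (\<Sum>k\<in>UNIV. ma i k x * V f k x)" for i x
  have sX: "smooth (X i)" for i unfolding X_def using f by (intro smooth_intros)
  have "dt (Lap f) x = dt (\<lambda>x. (\<Sum>i\<in>UNIV. dx i (V f i) x) + (\<Sum>k\<in>UNIV. TG k x * V f k x)) x"
    by (rule dirD_cong) (use Lap_div[OF f] dv_TG x in auto)
  also have "\<dots> = (\<Sum>i\<in>UNIV. dt (dx i (V f i)) x) + (\<Sum>k\<in>UNIV. TG k x * dt (V f k) x) + (\<Sum>k\<in>UNIV. dt (TG k) x * V f k x)"
    using f x by (simp add: d_add d_sum d_mult smooth_intros sum.distrib)
  also have "(\<Sum>i\<in>UNIV. dt (dx i (V f i)) x) = (\<Sum>i\<in>UNIV. dx i (\<lambda>x. V (dt f) i x + 2 * X i x) x)"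
  proof (rule sum.cong[OF refl])
    fix i
    have "dt (dx i (V f i)) x = dx i (dt (V f i)) x" using f x by (intro dt_dx_commute smooth_intros)
    also have "\<dots> = dx i (\<lambda>x. V (dt f) i x + 2 * X i x) x"
      by (rule dirD_cong) (use dt_V[OF f] x in \<open>auto simp: X_def\<close>)
    finally show "dt (dx i (V f i)) x = \<dots>" .
  qed
  also have "(\<Sum>k\<in>UNIV. TG k x * dt (V f k) x) = (\<Sum>k\<in>UNIV. TG k x * (V (dt f) k x + 2 * X k x))"
    by (simp add: dt_V[OF f x] X_def)
  also have "(\<Sum>i\<in>UNIV. dx i (\<lambda>x. V (dt f) i x + 2 * X i x) x) + \<dots> = dv (\<lambda>i x. V (dt f) i x + 2 * X i x) x"
    using x by (simp add: dv_TG)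
  also have "\<dots> = Lap (dt f) x + 2 * dv X x"
    using f x sX by (simp add: dv_add dv_cmult smooth_intros Lap_div)
  also have "dv X x = (\<Sum>k\<in>UNIV. Dal k x * V f k x) + (\<Sum>i\<in>UNIV. \<Sum>k\<in>UNIV. ma i k x * W f k i x)"
    unfolding X_def by (rule dv_ma_V[OF f x])
  finally show ?thesis
    by (simp add: dt_TG[OF x] algebra_simps sum_subtractf sum_distrib_left sum_negf)
qed

lemma dt_Pr_self:
  assumes f: "smooth f" and x: "x \<in> Q"
  shows "dt (Pr f f) x = 2 * (\<Sum>j\<in>UNIV. \<Sum>k\<in>UNIV. al j k x * V f j x * V f k x) + 2 * Pr f (dt f) x"
proof -
  have "dt (Pr f f) x = (\<Sum>i\<in>UNIV. V f i x * dt (dx i f) x) + (\<Sum>i\<in>UNIV. dt (V f i) x * dx i f x)"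
    unfolding Pr_def using f x by (simp add: d_sum d_mult smooth_intros sum.distrib)
  also have "(\<Sum>i\<in>UNIV. V f i x * dt (dx i f) x) = Pr f (dt f) x"
    unfolding Pr_def dt_dx_commute[OF f x] ..
  also have "(\<Sum>i\<in>UNIV. dt (V f i) x * dx i f x) = Pr (dt f) f x + 2 * (\<Sum>i\<in>UNIV. \<Sum>k\<in>UNIV. ma i k x * V f k x * dx i f x)"
    unfolding dt_V[OF f x] Pr_def
    by (simp add: algebra_simps sum.distrib sum_distrib_left)
  also have "(\<Sum>i\<in>UNIV. \<Sum>k\<in>UNIV. ma i k x * V f k x * dx i f x) = (\<Sum>j\<in>UNIV. \<Sum>k\<in>UNIV. al j k x * V f j x * V f k x)"
  proof -
    have "(\<Sum>i\<in>UNIV. \<Sum>k\<in>UNIV. ma i k x * V f k x * dx i f x)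
      = (\<Sum>i\<in>UNIV. \<Sum>k\<in>UNIV. \<Sum>j\<in>UNIV. Gi j i x * dx i f x * al j k x * V f k x)"
      unfolding ma_def by (simp add: sum_distrib_right sum_distrib_left sym_Gi[OF x] mult_ac)
    also have "\<dots> = (\<Sum>i\<in>UNIV. \<Sum>j\<in>UNIV. \<Sum>k\<in>UNIV. Gi j i x * dx i f x * al j k x * V f k x)"
      by (intro sum.cong refl sum.swap)
    also have "\<dots> = (\<Sum>j\<in>UNIV. \<Sum>i\<in>UNIV. \<Sum>k\<in>UNIV. Gi j i x * dx i f x * al j k x * V f k x)"
      by (rule sum.swap)
    also have "\<dots> = (\<Sum>j\<in>UNIV. \<Sum>k\<in>UNIV. \<Sum>i\<in>UNIV. Gi j i x * dx i f x * al j k x * V f k x)"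
      by (intro sum.cong refl sum.swap)
    also have "\<dots> = (\<Sum>j\<in>UNIV. \<Sum>k\<in>UNIV. al j k x * V f j x * V f k x)"
      unfolding V_def[of f] by (simp add: sum_distrib_left sum_distrib_right mult_ac)
    finally show ?thesis .
  qed
  finally show ?thesis unfolding Pr_sym[OF x, of "dt f" f] by simp
qed

text \<open>The product rule: the inverse metric evolves by \<open>dt_Gi\<close> and contributes
  2|\<alpha>|^2, here in mixed components.\<close>

lemma dt_trA:
  assumes x: "x \<in> Q"
  shows "dt trA x = 2 * (\<Sum>i\<in>UNIV. \<Sum>k\<in>UNIV. ma i k x * ma k i x) + (\<Sum>i\<in>UNIV. \<Sum>j\<in>UNIV. Gi i j x * dt (al i j) x)"
proof -
  have "dt trA x = (\<Sum>i\<in>UNIV. \<Sum>j\<in>UNIV. dt (Gi i j) x * al i j x) + (\<Sum>i\<in>UNIV. \<Sum>j\<in>UNIV. Gi i j x * dt (al i j) x)"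
    unfolding trA_def using x by (simp add: d_sum d_mult smooth_intros sum.distrib)
  also have "(\<Sum>i\<in>UNIV. \<Sum>j\<in>UNIV. dt (Gi i j) x * al i j x) = 2 * (\<Sum>i\<in>UNIV. \<Sum>j\<in>UNIV. \<Sum>k\<in>UNIV. ma i k x * (Gi k j x * al j i x))"
    unfolding dt_Gi[OF x] by (simp add: sum_distrib_left sum_distrib_right sym_al[OF x] mult_ac)
  also have "(\<Sum>i\<in>UNIV. \<Sum>j\<in>UNIV. \<Sum>k\<in>UNIV. ma i k x * (Gi k j x * al j i x)) = (\<Sum>i\<in>UNIV. \<Sum>k\<in>UNIV. ma i k x * ma k i x)"
  proof -
    have "(\<Sum>i\<in>UNIV. \<Sum>j\<in>UNIV. \<Sum>k\<in>UNIV. ma i k x * (Gi k j x * al j i x))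
      = (\<Sum>i\<in>UNIV. \<Sum>k\<in>UNIV. \<Sum>j\<in>UNIV. ma i k x * (Gi k j x * al j i x))"
      by (intro sum.cong refl sum.swap)
    then show ?thesis by (simp add: ma_def[of k i for k i] flip: sum_distrib_left)
  qed
  finally show ?thesis .
qed

text \<open>|\<alpha> + \<nabla>\<nabla>f + g/(2s)|^2, where \<open>s\<close> will be
  \<sigma>.\<close>

definition NS :: "(real \<times> (real ^ 'n) \<Rightarrow> real) \<Rightarrow> (real \<times> (real ^ 'n) \<Rightarrow> real) \<Rightarrow> real \<times> (real ^ 'n) \<Rightarrow> real" where
  "NS s f x = (\<Sum>i\<in>UNIV. \<Sum>j\<in>UNIV. \<Sum>k\<in>UNIV. \<Sum>l\<in>UNIV. Gi i k x * Gi j l x *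
      (al i j x + H f i j x + 1 / (2 * s x) * G i j x) * (al k l x + H f k l x + 1 / (2 * s x) * G k l x))"

text \<open>\<Theta>(- \<nabla>f); the minus signs are kept in front of \<open>V f\<close> to match
  \<open>Theta_local\<close> literally.\<close>

definition Th :: "(real \<times> (real ^ 'n) \<Rightarrow> real) \<Rightarrow> real \<times> (real ^ 'n) \<Rightarrow> real" where
  "Th f x = (\<Sum>i\<in>UNIV. \<Sum>j\<in>UNIV. (Ric i j x - al i j x) * - V f i x * - V f j x) +
     (\<Sum>k\<in>UNIV. (dx k trA x - 2 * Dal k x) * - V f k x) +
     1/2 * ((\<Sum>i\<in>UNIV. \<Sum>j\<in>UNIV. Gi i j x * dt (al i j) x) - Lap trA x)"

text \<open>The density w of the overview, in coordinates.\<close>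

definition dens :: "(real \<times> (real ^ 'n) \<Rightarrow> real) \<Rightarrow> (real \<times> (real ^ 'n) \<Rightarrow> real) \<Rightarrow> real \<times> (real ^ 'n) \<Rightarrow> real" where
  "dens s f x = s x * (2 * Lap f x - Pr f f x + trA x) - f x + real CARD('n)"

text \<open>In mixed components g/(2s) is the multiple \<open>c\<close> of the identity. Its
  products with the other summands are traces, giving (A + \<Delta>f)/s, and its square gives
  n/(4s^2).\<close>

lemma NS_expand:
  assumes f: "smooth f" and x: "x \<in> Q" and s: "s x > 0"
  shows "NS s f x = (\<Sum>i\<in>UNIV. \<Sum>k\<in>UNIV. ma i k x * ma k i x) + 2 * (\<Sum>i\<in>UNIV. \<Sum>k\<in>UNIV. ma i k x * W f k i x)
    + (\<Sum>i\<in>UNIV. \<Sum>k\<in>UNIV. W f i k x * W f k i x) + (trA x + Lap f x) / s x + real CARD('n) / (4 * (s x)\<^sup>2)"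
proof -
  define c where "c = 1 / (2 * s x)"
  define S where "S i j = al i j x + H f i j x + c * G i j x" for i j
  define d :: "'n \<Rightarrow> 'n \<Rightarrow> real" where "d i j = (if i = j then 1 else 0)" for i j
  have S: "S i j = S j i" for i j
    unfolding S_def using sym_al[OF x, of i j] H_sym[OF f x, of i j] sym_G[OF x, of i j] by simp
  have M: "(\<Sum>i\<in>UNIV. Gi k i x * S i j) = ma k j x + W f k j x + c * d k j" for k j
    unfolding S_def ma_def W_def d_def inv_G[OF x, symmetric]
    by (simp add: algebra_simps sum.distrib sum_distrib_left)
  have dl: "(\<Sum>k\<in>UNIV. \<Sum>j\<in>UNIV. d k j * g k j) = (\<Sum>k\<in>UNIV. g k k)" for g
    unfolding d_def by (simp add: if_distrib[of "\<lambda>a. a * _"] cong: if_cong)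
  have "NS s f x = (\<Sum>k\<in>UNIV. \<Sum>j\<in>UNIV. (ma k j x + W f k j x + c * d k j) * (ma j k x + W f j k x + c * d j k))"
    using norm_sq_mixed[OF x, of S, OF S] unfolding M by (simp add: NS_def S_def c_def)
  also have "\<dots> = (\<Sum>k\<in>UNIV. \<Sum>j\<in>UNIV. (ma k j x * ma j k x + ma k j x * W f j k x + ma j k x * W f k j x + W f k j x * W f j k x)
      + (d k j * (c * (ma j k x + W f j k x + ma k j x + W f k j x) + c * c * d j k)))"
    by (intro sum.cong refl) (simp add: algebra_simps d_def)
  also have "\<dots> = (\<Sum>i\<in>UNIV. \<Sum>k\<in>UNIV. ma i k x * ma k i x) + (\<Sum>i\<in>UNIV. \<Sum>k\<in>UNIV. ma i k x * W f k i x)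
     + (\<Sum>i\<in>UNIV. \<Sum>k\<in>UNIV. ma k i x * W f i k x) + (\<Sum>i\<in>UNIV. \<Sum>k\<in>UNIV. W f i k x * W f k i x)
     + (\<Sum>k\<in>UNIV. c * (ma k k x + W f k k x + ma k k x + W f k k x) + c * c * d k k)"
    by (simp only: sum.distrib dl)
  also have "(\<Sum>i\<in>UNIV. \<Sum>k\<in>UNIV. ma k i x * W f i k x) = (\<Sum>i\<in>UNIV. \<Sum>k\<in>UNIV. ma i k x * W f k i x)"
    by (rule sum.swap)
  also have "(\<Sum>k\<in>UNIV. c * (ma k k x + W f k k x + ma k k x + W f k k x) + c * c * d k k)
     = 2 * c * ((\<Sum>k\<in>UNIV. ma k k x) + (\<Sum>k\<in>UNIV. W f k k x)) + c * c * real CARD('n)"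
    by (simp add: d_def sum.distrib algebra_simps sum_distrib_left)
  also have "(\<Sum>k\<in>UNIV. ma k k x) = trA x"
    unfolding ma_def trA_def by (simp add: sym_al[OF x])
  finally show ?thesis using s
    by (simp add: Lap_trace[OF f x] c_def power2_eq_square field_simps)
qed

text \<open>With w = s F - f + n, the operator applied to \<open>F\<close> yields 2(|\<alpha> +
  \<nabla>\<nabla>f|^2 + \<Theta>). The remaining terms 2(A + \<Delta>f) + n/(2s) are exactly what
  completes the square with g/(2s).\<close>

lemma entropy_identity:
  assumes f: "smooth f" and sm: "smooth s" and s0: "\<And>i x. x \<in> Q \<Longrightarrow> dx i s x = 0"
    and s1: "\<And>x. x \<in> Q \<Longrightarrow> dt s x = 1" and spos: "\<And>x. x \<in> Q \<Longrightarrow> s x > 0"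
    and evo: "\<And>x. x \<in> Q \<Longrightarrow> dt f x = - Lap f x + Pr f f x - trA x - real CARD('n) / (2 * s x)"
    and x: "x \<in> Q"
  shows "dt (dens s f) x + Lap (dens s f) x - 2 * Pr f (dens s f) x = 2 * s x * (NS s f x + Th f x)"
proof -
  define F where "F x = 2 * Lap f x - Pr f f x + trA x" for x
  \<comment> \<open>The term n/(2\<sigma>) of the evolution equation; constant in space, it drops
    out of \<open>Lap (dt f)\<close> and \<open>Pr f (dt f)\<close>.\<close>
  define k where "k x = real CARD('n) / 2 * inverse (s x)" for x
  have sF: "smooth F" unfolding F_def using f by (intro smooth_intros)
  have sk: "smooth k" unfolding k_def using sm spos by (intro smooth_intros smooth_on_inverse) auto
  have k0: "dx i k y = 0" if "y \<in> Q" for i y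
  proof -
    have "dx i (\<lambda>y. inverse (s y)) y = - inverse (s y ^ 2) * dx i s y"
      by (rule dirD_compose_real[OF ample_Q that sm])
         (use spos[OF that] in \<open>auto intro!: derivative_eq_intros simp: power2_eq_square divide_simps\<close>)
    then show ?thesis unfolding k_def
      using d_cmult[OF that smooth_on_inverse[OF sm spos], of "(0, axis i 1)" "real CARD('n) / 2"] s0[OF that] by simp
  qed
  have evo': "dt f y = Pr f f y - Lap f y - trA y - k y" if "y \<in> Q" for y
    using evo[OF that] spos[OF that] by (simp add: k_def field_simps)
  have w: "dens s f = (\<lambda>x. s x * F x - f x + real CARD('n))"
    unfolding dens_def F_def by auto
  have c0: "Lap (\<lambda>x. real CARD('n)) x = 0" "Pr f (\<lambda>x. real CARD('n)) x = 0"
    by (auto intro!: Lap_time_const Pr_time_const smooth_intros x simp: d_const)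
  have dtw: "dt (dens s f) x = s x * dt F x + F x - dt f x"
    unfolding w using x sm sF f by (simp add: d_add d_diff d_mult d_const smooth_intros s1)
  have Lw: "Lap (dens s f) x = s x * Lap F x - Lap f x"
    unfolding w using x sm sF f by (simp add: Lap_add Lap_diff smooth_intros Lap_time[OF sm s0] c0)
  have Pw: "Pr f (dens s f) x = s x * Pr f F x - Pr f f x"
    unfolding w using x sm sF f by (simp add: Pr_add Pr_diff Pr_mult smooth_intros Pr_time_const[OF s0] c0)
  have dtF: "dt F x = 2 * dt (Lap f) x - dt (Pr f f) x + dt trA x"
    unfolding F_def using x f by (simp add: d_add d_diff d_cmult smooth_intros)
  have LF: "Lap F x = 2 * Lap (Lap f) x - Lap (Pr f f) x + Lap trA x"
    unfolding F_def using x f by (simp add: Lap_add Lap_diff Lap_cmult smooth_intros)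
  have PF: "Pr f F x = 2 * Pr f (Lap f) x - Pr f (Pr f f) x + Pr f trA x"
    unfolding F_def using x f by (simp add: Pr_add Pr_diff Pr_cmult smooth_intros)
  have "Lap (dt f) x = Lap (\<lambda>y. Pr f f y - Lap f y - trA y - k y) x"
    by (rule Lap_cong) (use evo' x in auto)
  then have Lt: "Lap (dt f) x = Lap (Pr f f) x - Lap (Lap f) x - Lap trA x"
    using x f sk k0 by (simp add: Lap_diff smooth_intros Lap_time_const[of k])
  have "Pr f (dt f) x = Pr f (\<lambda>y. Pr f f y - Lap f y - trA y - k y) x"
    by (rule Pr_cong) (use evo' x in auto)
  then have Pt: "Pr f (dt f) x = Pr f (Pr f f) x - Pr f (Lap f) x - Pr f trA x"
    using x f sk k0 by (simp add: Pr_diff smooth_intros Pr_time_const[of k])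
  define WW MW MM R AV DV TV B where
    "WW = (\<Sum>i\<in>UNIV. \<Sum>j\<in>UNIV. W f i j x * W f j i x)" and
    "MW = (\<Sum>i\<in>UNIV. \<Sum>k\<in>UNIV. ma i k x * W f k i x)" and
    "MM = (\<Sum>i\<in>UNIV. \<Sum>k\<in>UNIV. ma i k x * ma k i x)" and
    "R = (\<Sum>j\<in>UNIV. \<Sum>k\<in>UNIV. Ric j k x * V f j x * V f k x)" and
    "AV = (\<Sum>j\<in>UNIV. \<Sum>k\<in>UNIV. al j k x * V f j x * V f k x)" and
    "DV = (\<Sum>k\<in>UNIV. Dal k x * V f k x)" and
    "TV = Pr f trA x" and
    "B = (\<Sum>i\<in>UNIV. \<Sum>j\<in>UNIV. Gi i j x * dt (al i j) x)"
  have Th: "Th f x = R - AV - TV + 2 * DV + 1/2 * (B - Lap trA x)"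
    unfolding Th_def R_def AV_def TV_def DV_def B_def Pr_def
    by (simp add: algebra_simps sum_subtractf sum.distrib sum_negf sum_distrib_left)
  have NS: "NS s f x = MM + 2 * MW + WW + (trA x + Lap f x) / s x + real CARD('n) / (4 * (s x)\<^sup>2)"
    unfolding NS_expand[of f x s, OF f x spos[OF x]] MM_def MW_def WW_def ..
  have Bo: "Lap (Pr f f) x = 2 * WW + 2 * Pr f (Lap f) x + 2 * R"
    unfolding WW_def R_def by (rule Bochner[OF f x])
  have T1: "dt (Lap f) x = Lap (dt f) x + 2 * MW + 2 * DV - TV"
    unfolding dt_Lap[OF f x] MW_def DV_def TV_def Pr_def
    by (simp add: algebra_simps sum_subtractf sum_distrib_left)
  have T2: "dt (Pr f f) x = 2 * AV + 2 * Pr f (dt f) x"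
    unfolding AV_def by (rule dt_Pr_self[OF f x])
  have T3: "dt trA x = 2 * MM + B"
    unfolding MM_def B_def by (rule dt_trA[OF x])
  \<comment> \<open>The iterated Laplacians and the terms \<open>Pr f (Pr f f)\<close> cancel. A
    single \<open>Lap (Pr f f)\<close> is left; Bochner's formula converts it into Hessian and Ricci
    terms and removes \<open>Pr f (Lap f)\<close>.\<close>
  have 1: "dt F x + Lap F x - 2 * Pr f F x = 2 * (MM + 2 * MW + WW + Th f x)"
    unfolding dtF LF PF T1 T2 T3 Lt Pt Bo Th TV_def[symmetric] by (simp add: algebra_simps)
  have "dt (dens s f) x + Lap (dens s f) x - 2 * Pr f (dens s f) x =
      s x * (dt F x + Lap F x - 2 * Pr f F x) + (F x - dt f x - Lap f x + 2 * Pr f f x)"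
    unfolding dtw Lw Pw by (simp add: algebra_simps)
  also have "F x - dt f x - Lap f x + 2 * Pr f f x = 2 * (trA x + Lap f x) + real CARD('n) / (2 * s x)"
    unfolding evo[OF x] F_def by simp
  also have "s x * (dt F x + Lap F x - 2 * Pr f F x) + \<dots> = 2 * s x * (NS s f x + Th f x)"
    unfolding 1 NS using spos[OF x] by (simp add: field_simps power2_eq_square)
  finally show ?thesis .
qed

end

subsection \<open>Determinants and positive definite forms\<close>

text \<open>Along the segment from the identity to A the form stays positive definite, hence the
  matrix invertible; the determinant keeps the sign it has at the identity.\<close>

lemma det_pos_of_pos_def:
  fixes A :: "real ^ 'n::finite ^ 'n"
  assumes pos: "\<And>v. v \<noteq> 0 \<Longrightarrow> v \<bullet> (A *v v) > 0"
  shows "det A > 0"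
proof -
  define B where "B s = (1 - s) *\<^sub>R mat 1 + s *\<^sub>R A" for s
  have nz: "det (B s) \<noteq> 0" if "s \<in> {0..1}" for s
  proof
    assume "det (B s) = 0"
    then have "\<not> invertible (B s)" by (simp add: invertible_det_nz)
    then obtain v where v: "v \<noteq> 0" "B s *v v = 0"
      by (auto simp: invertible_left_inverse matrix_left_invertible_ker)
    have "v \<bullet> (B s *v v) = (1 - s) * (v \<bullet> v) + s * (v \<bullet> (A *v v))"
      by (simp add: B_def matrix_vector_mult_add_rdistrib scaleR_matrix_vector_assoc[symmetric] inner_add_right)
    moreover have "(1 - s) * (v \<bullet> v) \<ge> 0" "s * (v \<bullet> (A *v v)) \<ge> 0" "v \<bullet> v > 0" "v \<bullet> (A *v v) > 0"
      using that pos[OF v(1)] v(1) by auto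
    ultimately show False using v(2) that
      by (cases "s = 0") (auto simp: add_nonneg_eq_0_iff)
  qed
  have cont: "continuous_on {0..1} (\<lambda>s. det (B s))"
    unfolding det_def B_def by (intro continuous_intros)
  show ?thesis
  proof (rule ccontr)
    assume "\<not> det A > 0"
    then have "det (B 1) \<le> 0" "0 \<le> det (B 0)" by (simp_all add: B_def)
    then obtain s where "0 \<le> s" "s \<le> 1" "det (B s) = 0"
      using IVT2'[of "\<lambda>s. det (B s)" 1 0 0] cont by auto
    with nz show False by auto
  qed
qed

lemma matrix_inv_mult:
  fixes A :: "real ^ 'n::finite ^ 'n"
  assumes "det A \<noteq> 0"
  shows "A ** matrix_inv A = mat 1" "matrix_inv A ** A = mat 1"
proof -
  have "\<exists>A'. A ** A' = mat 1 \<and> A' ** A = mat 1"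
    using assms invertible_det_nz[of A] by (auto simp: invertible_def)
  then have "A ** matrix_inv A = mat 1 \<and> matrix_inv A ** A = mat 1"
    unfolding matrix_inv_def by (rule someI_ex)
  then show "A ** matrix_inv A = mat 1" "matrix_inv A ** A = mat 1" by auto
qed

text \<open>Cramer's rule expresses the entries of the inverse by determinants, from which
  smoothness and continuity in a parameter can be read off.\<close>

lemma matrix_inv_cramer:
  fixes A :: "real ^ 'n::finite ^ 'n"
  assumes "det A \<noteq> 0"
  shows "matrix_inv A $ i $ j = det (\<chi> a b. if b = i then (if a = j then 1 else 0) else A $ a $ b) * inverse (det A)"
proof -
  define x where "x = matrix_inv A *v axis j 1"
  have Ax: "A *v x = axis j 1"
    by (simp add: x_def matrix_vector_mul_assoc matrix_inv_mult[OF assms])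
  have xi: "x $ i = matrix_inv A $ i $ j"
    by (simp add: x_def matrix_vector_mult_def axis_def if_distrib cong: if_cong)
  have "det (\<chi> a b. if b = i then axis j 1 $ a else A $ a $ b) = matrix_inv A $ i $ j * det A"
    using cramer_lemma[where A=A and x=x and k=i] unfolding Ax xi .
  then show ?thesis using assms by (simp add: axis_def field_simps cong: if_cong)
qed

lemma matrix_inv_symmetric:
  fixes A :: "real ^ 'n::finite ^ 'n"
  assumes "det A \<noteq> 0" "transpose A = A"
  shows "transpose (matrix_inv A) = matrix_inv A"
proof -
  have "transpose (matrix_inv A) ** A = mat 1"
    using arg_cong[OF matrix_inv_mult(1)[OF assms(1)], of transpose] assms(2)
    by (simp add: matrix_transpose_mul)
  then have "transpose (matrix_inv A) ** (A ** matrix_inv A) = matrix_inv A"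
    by (simp add: matrix_mul_assoc)
  then show ?thesis by (simp add: matrix_inv_mult[OF assms(1)])
qed

lemma smooth_on_det [smooth_intros]:
  fixes M :: "'a::real_normed_vector \<Rightarrow> real ^ 'n::finite ^ 'n"
  assumes "\<And>i j. smooth_on (\<lambda>x. M x $ i $ j) S"
  shows "smooth_on (\<lambda>x. det (M x)) S"
  unfolding det_def by (intro smooth_intros assms)

lemma smooth_on_matrix_inv:
  fixes M :: "'a::real_normed_vector \<Rightarrow> real ^ 'n::finite ^ 'n"
  assumes M: "\<And>i j. smooth_on (\<lambda>x. M x $ i $ j) S" and pos: "\<And>x. x \<in> S \<Longrightarrow> det (M x) > 0"
  shows "smooth_on (\<lambda>x. matrix_inv (M x) $ i $ j) S"
proof -
  have "smooth_on (\<lambda>x. det (\<chi> a b. if b = i then (if a = j then 1 else 0) else M x $ a $ b) * inverse (det (M x))) S"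
  proof (intro smooth_on_mult smooth_on_inverse smooth_on_det pos M)
    show "smooth_on (\<lambda>x. (\<chi> a b. if b = i then (if a = j then 1 else 0) else M x $ a $ b) $ a $ b) S" for a b
      by (cases "b = i"; cases "a = j") (simp_all add: smooth_on_const M)
  qed
  moreover have "matrix_inv (M x) $ i $ j =
      det (\<chi> a b. if b = i then (if a = j then 1 else 0) else M x $ a $ b) * inverse (det (M x))" if "x \<in> S" for x
    by (rule matrix_inv_cramer) (use pos[OF that] in simp)
  ultimately show ?thesis by (subst smooth_on_cong) auto
qed

text \<open>Jacobi's formula. The derivative of the Leibniz sum is a sum of determinants
  \<open>R i v\<close> with one row differentiated; Cramer's rule evaluates each of them.\<close>

lemma has_derivative_det:
  fixes M :: "'a::real_normed_vector \<Rightarrow> real ^ 'n::finite ^ 'n"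
  assumes M: "\<And>i j. ((\<lambda>x. M x $ i $ j) has_derivative M' i j) (at x within S)"
    and nz: "det (M x) \<noteq> 0"
  shows "((\<lambda>x. det (M x)) has_derivative
    (\<lambda>v. det (M x) * (\<Sum>i\<in>UNIV. \<Sum>j\<in>UNIV. matrix_inv (M x) $ j $ i * M' i j v))) (at x within S)"
proof -
  let ?P = "{p. p permutes (UNIV :: 'n set)}"
  define R where "R i v = (\<chi> a. if a = i then (\<chi> j. M' i j v) else row a (M x))" for i v
  have "((\<lambda>x. det (M x)) has_derivative
      (\<lambda>v. \<Sum>p\<in>?P. of_int (sign p) * (\<Sum>i\<in>UNIV. M' i (p i) v * (\<Prod>k\<in>UNIV - {i}. M x $ k $ p k)))) (at x within S)"
    unfolding det_def
    by (intro has_derivative_sum has_derivative_mult_right has_derivative_prod M)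
  moreover have "(\<Sum>p\<in>?P. of_int (sign p) * (\<Sum>i\<in>UNIV. M' i (p i) v * (\<Prod>k\<in>UNIV - {i}. M x $ k $ p k)))
      = det (M x) * (\<Sum>i\<in>UNIV. \<Sum>j\<in>UNIV. matrix_inv (M x) $ j $ i * M' i j v)" for v
  proof -
    have "(\<Sum>p\<in>?P. of_int (sign p) * (\<Sum>i\<in>UNIV. M' i (p i) v * (\<Prod>k\<in>UNIV - {i}. M x $ k $ p k)))
      = (\<Sum>i\<in>UNIV. \<Sum>p\<in>?P. of_int (sign p) * (M' i (p i) v * (\<Prod>k\<in>UNIV - {i}. M x $ k $ p k)))"
      unfolding sum_distrib_left by (rule sum.swap)
    also have "\<dots> = (\<Sum>i\<in>UNIV. det (R i v))"
    proof (rule sum.cong[OF refl])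
      fix i :: 'n
      have "(\<Prod>k\<in>UNIV. R i v $ k $ p k) = M' i (p i) v * (\<Prod>k\<in>UNIV - {i}. M x $ k $ p k)" for p
        by (subst prod.remove[of _ i]) (auto simp: R_def row_def intro!: prod.cong)
      then show "(\<Sum>p\<in>?P. of_int (sign p) * (M' i (p i) v * (\<Prod>k\<in>UNIV - {i}. M x $ k $ p k))) = det (R i v)"
        by (simp add: det_def)
    qed
    also have "\<dots> = (\<Sum>i\<in>UNIV. (\<Sum>j\<in>UNIV. matrix_inv (M x) $ j $ i * M' i j v) * det (M x))"
    proof (rule sum.cong[OF refl])
      fix i :: 'n
      \<comment> \<open>The coefficients of the differentiated row in the basis formed by the rows
        of \<open>M x\<close>; in the i-th row only the i-th coefficient contributes to the
        determinant.\<close>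
      define z where "z = (\<chi> k. \<Sum>j\<in>UNIV. M' i j v * matrix_inv (M x) $ j $ k)"
      define w where "w = (\<chi> j. M' i j v)"
      have zw: "z = w v* matrix_inv (M x)" by (simp add: z_def w_def vector_matrix_mult_def mult.commute vec_eq_iff)
      have "(\<Sum>k\<in>UNIV. z $ k *s row k (M x)) = z v* M x"
        by (simp add: vec_eq_iff vector_matrix_mult_def row_def sum_component mult.commute)
      also have "\<dots> = w v* (matrix_inv (M x) ** M x)" unfolding zw by (rule vector_matrix_mul_assoc)
      also have "\<dots> = w" by (simp add: matrix_inv_mult[OF nz])
      finally have eqw: "(\<Sum>k\<in>UNIV. z $ k *s row k (M x)) = w" .
      have "R i v = (\<chi> a. if a = i then (\<Sum>k\<in>UNIV. z $ k *s row k (M x)) else row a (M x))"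
        unfolding eqw R_def w_def ..
      then show "det (R i v) = (\<Sum>j\<in>UNIV. matrix_inv (M x) $ j $ i * M' i j v) * det (M x)"
        by (simp add: cramer_lemma_transpose z_def mult.commute)
    qed
    finally show ?thesis by (simp add: sum_distrib_left mult.commute)
  qed
  ultimately show ?thesis by simp
qed

text \<open>Lagrange reduction, completing one square at a time. The induction is over a set of
  indices outside which the rows of \<open>P\<close> vanish.\<close>

lemma psd_rank_one_sum:
  fixes P :: "'n::finite \<Rightarrow> 'n \<Rightarrow> real"
  assumes "\<And>i j. P i j = P j i" "\<And>v. (\<Sum>i\<in>UNIV. \<Sum>j\<in>UNIV. P i j * v i * v j) \<ge> 0"
  shows "\<exists>N w. \<forall>i j. P i j = (\<Sum>m<(N::nat). w m i * w m j)"
proof -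
  have ex: "\<exists>N w. \<forall>i j. P i j = (\<Sum>m<(N::nat). w m i * w m j)"
    if "finite A" "\<And>i j. P i j = P j i" "\<And>v. (\<Sum>i\<in>UNIV. \<Sum>j\<in>UNIV. P i j * v i * v j) \<ge> 0"
      "\<And>i j. i \<notin> A \<Longrightarrow> P i j = 0" for A and P :: "'n \<Rightarrow> 'n \<Rightarrow> real"
    using that
  proof (induction A arbitrary: P rule: finite_induct)
    case empty
    then show ?case by (intro exI[of _ 0]) auto
  next
    case (insert a A)
    note sym = insert.prems(1) and psd = insert.prems(2)
    \<comment> \<open>Semidefiniteness tested on vectors supported on two indices.\<close>
    have two: "P i i * x * x + 2 * P i j * x * y + P j j * y * y \<ge> 0" if "i \<noteq> j" for i j x y
    proof -
      have "(\<Sum>k\<in>UNIV. \<Sum>l\<in>UNIV. P k l * (if k = i then x else if k = j then y else 0) * (if l = i then x else if l = j then y else 0))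
        = (\<Sum>k\<in>{i, j}. \<Sum>l\<in>{i, j}. P k l * (if k = i then x else if k = j then y else 0) * (if l = i then x else if l = j then y else 0))"
        by (intro sum.mono_neutral_cong_right) auto
      also have "\<dots> = P i i * x * x + 2 * P i j * x * y + P j j * y * y"
        using that sym[of j i] by (simp add: algebra_simps)
      finally show ?thesis using psd[of "\<lambda>k. if k = i then x else if k = j then y else 0"] by simp
    qed
    have diag: "P a a \<ge> 0"
    proof -
      have "(\<Sum>k\<in>UNIV. \<Sum>l\<in>UNIV. P k l * (if k = a then 1 else 0) * (if l = a then 1 else 0)) = P a a"
        by (simp add: if_distrib[of "\<lambda>u. _ * u"] cong: if_cong)
      then show ?thesis using psd[of "\<lambda>k. if k = a then 1 else 0"] by simp
    qed
    show ?case
    proof (cases "P a a = 0")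
      case True
      have "P a j = 0" for j
      proof (cases "j = a")
        case False
        have "2 * P a j * x + P j j \<ge> 0" for x using two[of a j x 1] False True by simp
        \<comment> \<open>At this \<open>x\<close> the expression would equal -1 if
          \<open>P a j\<close> were nonzero.\<close>
        from this[of "- (P j j + 1) / (2 * P a j)"] show ?thesis by (cases "P a j = 0") auto
      qed (simp add: True)
      then have "P i j = 0" if "i \<notin> A" for i j using that insert.prems(3)[of i j] by (cases "i = a") auto
      then show ?thesis using insert.IH[of P] sym psd by blast
    next
      case False
      then have pos: "P a a > 0" using diag by simp
      \<comment> \<open>Subtracting this form of rank one clears row and column \<open>a\<close>, so
        the induction hypothesis applies to the rest.\<close>
      define P' where "P' i j = P i j - P a i * P a j / P a a" for i j
      have "P' i j = P' j i" for i j by (simp add: P'_def sym[of i j] mult.commute)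
      moreover have "(\<Sum>i\<in>UNIV. \<Sum>j\<in>UNIV. P' i j * v i * v j) \<ge> 0" for v
      proof -
        define m where "m = (\<Sum>i\<in>UNIV. P a i * v i)"
        define q where "q = (\<Sum>i\<in>UNIV. \<Sum>j\<in>UNIV. P i j * v i * v j)"
        define r where "r = m / P a a"
        have d: "(\<Sum>i\<in>UNIV. (if i = a then r else 0) * f i) = r * f a" for f
          by (simp add: if_distrib[of "\<lambda>u. u * _"] cong: if_cong)
        \<comment> \<open>the minimum of the quadratic form along the line in direction \<open>a\<close> through \<open>v\<close>\<close>
        have "(\<Sum>i\<in>UNIV. \<Sum>j\<in>UNIV. P i j * (v i - (if i = a then r else 0)) * (v j - (if j = a then r else 0)))
          = q - (\<Sum>i\<in>UNIV. (if i = a then r else 0) * (\<Sum>j\<in>UNIV. P i j * v j))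
            - (\<Sum>j\<in>UNIV. (if j = a then r else 0) * (\<Sum>i\<in>UNIV. P i j * v i))
            + (\<Sum>i\<in>UNIV. (if i = a then r else 0) * (\<Sum>j\<in>UNIV. (if j = a then r else 0) * P i j))"
        proof -
          have sw: "(\<Sum>j\<in>UNIV. (if j = a then r else 0) * (\<Sum>i\<in>UNIV. P i j * v i)) =
            (\<Sum>i\<in>UNIV. \<Sum>j\<in>UNIV. (if j = a then r else 0) * (P i j * v i))"
            unfolding sum_distrib_left by (rule sum.swap)
          show ?thesis unfolding sw q_def
            by (simp only: sum_distrib_left sum.distrib[symmetric] sum_subtractf[symmetric])
               (intro sum.cong refl, simp add: algebra_simps)
        qed
        also have "\<dots> = q - r * m - r * m + r * (r * P a a)"
        proof -
          have "(\<Sum>i\<in>UNIV. P i a * v i) = m"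
            unfolding m_def by (rule sum.cong[OF refl]) (metis sym)
          then show ?thesis unfolding d m_def by simp
        qed
        also have "\<dots> = q - m * m / P a a" using pos by (simp add: r_def field_simps)
        also have "\<dots> = (\<Sum>i\<in>UNIV. \<Sum>j\<in>UNIV. P' i j * v i * v j)"
          unfolding q_def m_def sum_product P'_def
          by (simp add: algebra_simps sum_subtractf sum_divide_distrib)
        finally show ?thesis using psd[of "\<lambda>i. v i - (if i = a then r else 0)"] by simp
      qed
      moreover have "P' i j = 0" if "i \<notin> A" for i j
        using that insert.prems(3)[of i] pos sym[of i a] by (cases "i = a") (auto simp: P'_def)
      ultimately obtain N w where w: "\<And>i j. P' i j = (\<Sum>m<(N::nat). w m i * w m j)"
        using insert.IH[of P'] by metis
      have PN: "P i j = (\<Sum>m<Suc N. (if m = N then P a i / sqrt (P a a) else w m i) * (if m = N then P a j / sqrt (P a a) else w m j))" for i j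
        using w[of i j] pos by (simp add: P'_def)
      show ?thesis by (intro exI[of _ "Suc N"] exI[of _ "\<lambda>m i. if m = N then P a i / sqrt (P a a) else w m i"] allI) (rule PN)
    qed
  qed
  show ?thesis by (rule ex[where A=UNIV and P=P, OF finite assms]) simp
qed

text \<open>With P a sum of rank-one forms, the quadruple sum becomes a sum of squares of
  \<open>T m n\<close>, the values of S on the vectors w. If it vanishes, so do all
  \<open>T m n\<close>, and with them S with both indices raised.\<close>

lemma tensor_norm_sq_psd:
  fixes P S :: "'n::finite \<Rightarrow> 'n \<Rightarrow> real"
  assumes P: "\<And>i j. P i j = P j i" "\<And>v. (\<Sum>i\<in>UNIV. \<Sum>j\<in>UNIV. P i j * v i * v j) \<ge> 0"
  defines "N \<equiv> (\<Sum>i\<in>UNIV. \<Sum>j\<in>UNIV. \<Sum>k\<in>UNIV. \<Sum>l\<in>UNIV. P i k * P j l * S i j * S k l)"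
  shows "N \<ge> 0" and "N = 0 \<Longrightarrow> (\<Sum>i\<in>UNIV. \<Sum>j\<in>UNIV. P a i * P b j * S i j) = 0"
proof -
  obtain K w where w: "\<And>i j. P i j = (\<Sum>m<(K::nat). w m i * w m j)"
    using psd_rank_one_sum[of P, OF P] by metis
  define T where "T m n = (\<Sum>i\<in>UNIV. \<Sum>j\<in>UNIV. w m i * w n j * S i j)" for m n
  have sw4: "(\<Sum>i\<in>UNIV. \<Sum>j\<in>UNIV. \<Sum>m<K. \<Sum>n<K. f i j m n) = (\<Sum>m<K. \<Sum>n<K. \<Sum>i\<in>UNIV. \<Sum>j\<in>UNIV. f i j m n)"
    for f :: "'n \<Rightarrow> 'n \<Rightarrow> nat \<Rightarrow> nat \<Rightarrow> real"
    by (simp only: sum.swap[of _ "{..<K}" "UNIV :: 'n set"])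
  have "N = (\<Sum>i\<in>UNIV. \<Sum>j\<in>UNIV. \<Sum>k\<in>UNIV. \<Sum>l\<in>UNIV. \<Sum>m<K. \<Sum>n<K. (w m i * w n j * S i j) * (w m k * w n l * S k l))"
  proof -
    have "P i k * P j l * S i j * S k l = (\<Sum>m<K. \<Sum>n<K. (w m i * w n j * S i j) * (w m k * w n l * S k l))" for i j k l
      unfolding w by (subst sum_product) (simp add: sum_distrib_left sum_distrib_right mult_ac)
    then show ?thesis unfolding N_def by (simp only:)
  qed
  also have "\<dots> = (\<Sum>i\<in>UNIV. \<Sum>j\<in>UNIV. \<Sum>m<K. \<Sum>n<K. \<Sum>k\<in>UNIV. \<Sum>l\<in>UNIV. (w m i * w n j * S i j) * (w m k * w n l * S k l))"
    by (intro sum.cong refl sw4)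
  also have "\<dots> = (\<Sum>m<K. \<Sum>n<K. \<Sum>i\<in>UNIV. \<Sum>j\<in>UNIV. \<Sum>k\<in>UNIV. \<Sum>l\<in>UNIV. (w m i * w n j * S i j) * (w m k * w n l * S k l))"
    by (rule sw4)
  also have "\<dots> = (\<Sum>m<K. \<Sum>n<K. T m n * T m n)"
    unfolding T_def sum_distrib_right unfolding sum_distrib_left ..
  finally have N: "N = (\<Sum>m<K. \<Sum>n<K. T m n * T m n)" .
  then show "N \<ge> 0" by (simp add: sum_nonneg)
  assume "N = 0"
  then have T: "T m n = 0" if "m < K" "n < K" for m n
    using that by (simp add: N sum_nonneg_eq_0_iff sum_nonneg)
  have "(\<Sum>i\<in>UNIV. \<Sum>j\<in>UNIV. P a i * P b j * S i j) = (\<Sum>i\<in>UNIV. \<Sum>j\<in>UNIV. \<Sum>m<K. \<Sum>n<K. w m a * w n b * (w m i * w n j * S i j))"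
  proof -
    have "P a i * P b j * S i j = (\<Sum>m<K. \<Sum>n<K. w m a * w n b * (w m i * w n j * S i j))" for i j
      unfolding w by (subst sum_product) (simp add: sum_distrib_left sum_distrib_right mult_ac)
    then show ?thesis by (simp only:)
  qed
  also have "\<dots> = (\<Sum>m<K. \<Sum>n<K. \<Sum>i\<in>UNIV. \<Sum>j\<in>UNIV. w m a * w n b * (w m i * w n j * S i j))"
    by (rule sw4)
  also have "\<dots> = (\<Sum>m<K. \<Sum>n<K. w m a * w n b * T m n)"
    unfolding T_def by (simp add: sum_distrib_left)
  finally show "(\<Sum>i\<in>UNIV. \<Sum>j\<in>UNIV. P a i * P b j * S i j) = 0" using T by simp
qed

subsection \<open>Charts and the Riemannian volume\<close>

lemma pd_eqI: "((f \<circ> inv_coord c) has_derivative D) (at (coord c p)) \<Longrightarrow> pd c i f p = D (axis i 1)"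
  unfolding pd_def by (metis frechet_derivative_at)

locale closed_manifold =
  fixes \<A> :: "('m::t2_space, 'n::finite) chart set"
  assumes compact_M: "compact (UNIV :: 'm set)" and atlas: "smooth_atlas \<A>"
begin

lemma chart:
  assumes "c \<in> \<A>"
  shows open_dom: "open (dom_of c)" and open_range: "open (range_of c)"
    and chart_homeomorphism: "homeomorphism (dom_of c) (range_of c) (coord c) (inv_coord c)"
  using atlas assms by (auto simp: smooth_atlas_def is_chart_def)

lemma inv_coord_coord [simp]: "c \<in> \<A> \<Longrightarrow> p \<in> dom_of c \<Longrightarrow> inv_coord c (coord c p) = p"
  and coord_inv_coord [simp]: "c \<in> \<A> \<Longrightarrow> y \<in> range_of c \<Longrightarrow> coord c (inv_coord c y) = y"
  and inv_coord_in_dom [simp]: "c \<in> \<A> \<Longrightarrow> y \<in> range_of c \<Longrightarrow> inv_coord c y \<in> dom_of c"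
  and continuous_coord: "c \<in> \<A> \<Longrightarrow> continuous_on (dom_of c) (coord c)"
  and continuous_inv_coord: "c \<in> \<A> \<Longrightarrow> continuous_on (range_of c) (inv_coord c)"
  using chart_homeomorphism[of c] unfolding homeomorphism_def by auto

lemma open_coord_image:
  assumes "c \<in> \<A>" "open S" "S \<subseteq> dom_of c"
  shows "open (coord c ` S)"
proof -
  have "openin (top_of_set (range_of c)) (coord c ` S)"
    by (rule homeomorphism_imp_open_map[OF chart_homeomorphism[OF assms(1)]])
       (use assms in \<open>auto simp: openin_open\<close>)
  then show ?thesis using open_range[OF assms(1)] by (simp add: openin_open_eq)
qed

lemma dom_cover: "\<exists>c\<in>\<A>. p \<in> dom_of c"
  using atlas by (auto simp: smooth_atlas_def)

lemma chart_at: "chart_at \<A> p \<in> \<A>" "p \<in> dom_of (chart_at \<A> p)"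
proof -
  have "chart_at \<A> p \<in> \<A> \<and> p \<in> dom_of (chart_at \<A> p)"
    unfolding chart_at_def by (rule someI_ex) (use dom_cover[of p] in blast)
  then show "chart_at \<A> p \<in> \<A>" "p \<in> dom_of (chart_at \<A> p)" by auto
qed

lemma on_M_eq:
  assumes "\<And>c d. c \<in> \<A> \<Longrightarrow> d \<in> \<A> \<Longrightarrow> p \<in> dom_of c \<Longrightarrow> p \<in> dom_of d \<Longrightarrow> F c p = F d p"
    and "c \<in> \<A>" "p \<in> dom_of c"
  shows "on_M \<A> F p = F c p"
  unfolding on_M_def using assms chart_at by blast

definition overlap :: "('m, 'n) chart \<Rightarrow> ('m, 'n) chart \<Rightarrow> (real ^ 'n) set" where
  "overlap c d = coord c ` (dom_of c \<inter> dom_of d)"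

lemma open_overlap: "c \<in> \<A> \<Longrightarrow> d \<in> \<A> \<Longrightarrow> open (overlap c d)"
  unfolding overlap_def by (intro open_coord_image) (auto intro: open_dom)

lemma overlap_iff: "c \<in> \<A> \<Longrightarrow> y \<in> overlap c d \<longleftrightarrow> y \<in> range_of c \<and> inv_coord c y \<in> dom_of d"
  unfolding overlap_def by force

lemma smooth_transition: "c \<in> \<A> \<Longrightarrow> d \<in> \<A> \<Longrightarrow> smooth_on (coord d \<circ> inv_coord c) (overlap c d)"
  using atlas unfolding smooth_atlas_def overlap_def by blast

lemma transition_has_derivative:
  assumes "c \<in> \<A>" "d \<in> \<A>" "p \<in> dom_of c" "p \<in> dom_of d"
  shows "((coord d \<circ> inv_coord c) has_derivative (\<lambda>v. transition_jacobian c d p *v v)) (at (coord c p))"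
proof -
  have y: "coord c p \<in> overlap c d" using assms by (auto simp: overlap_def)
  have "(coord d \<circ> inv_coord c) differentiable (at (coord c p) within overlap c d)"
    by (rule smooth_on_imp_differentiable[OF smooth_transition[OF assms(1,2)] y])
  then have "(coord d \<circ> inv_coord c) differentiable (at (coord c p))"
    using at_within_open[OF y open_overlap[OF assms(1,2)]] by simp
  then show ?thesis unfolding transition_jacobian_def by (simp add: jacobian_works)
qed

lemma chart_change_derivative:
  assumes cd: "c \<in> \<A>" "d \<in> \<A>" and p: "p \<in> dom_of c" "p \<in> dom_of d"
    and f: "((f \<circ> inv_coord d) has_derivative D) (at (coord d p))"
  shows "((f \<circ> inv_coord c) has_derivative (\<lambda>v. D (transition_jacobian c d p *v v))) (at (coord c p))"
proof -
  have "((f \<circ> inv_coord d) \<circ> (coord d \<circ> inv_coord c) has_derivative D \<circ> (\<lambda>v. transition_jacobian c d p *v v)) (at (coord c p))"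
    by (rule diff_chain_at[OF transition_has_derivative[OF cd p]]) (use f cd p in simp)
  then have "((f \<circ> inv_coord c) has_derivative D \<circ> (\<lambda>v. transition_jacobian c d p *v v)) (at (coord c p))"
  proof (rule has_derivative_transform_within_open[OF _ open_overlap[OF cd]])
    show "coord c p \<in> overlap c d" using p by (auto simp: overlap_def)
    show "(f \<circ> inv_coord d \<circ> (coord d \<circ> inv_coord c)) y = (f \<circ> inv_coord c) y" if "y \<in> overlap c d" for y
      using that cd by (simp add: overlap_iff)
  qed
  then show ?thesis by (simp add: o_def)
qed

lemma pd_chart_change:
  assumes cd: "c \<in> \<A>" "d \<in> \<A>" and p: "p \<in> dom_of c" "p \<in> dom_of d"
    and f: "(f \<circ> inv_coord d) differentiable (at (coord d p))"
  shows "pd c i f p = (\<Sum>k\<in>UNIV. transition_jacobian c d p $ k $ i * pd d k f p)"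
proof -
  obtain D where D: "((f \<circ> inv_coord d) has_derivative D) (at (coord d p))"
    using f by (auto simp: differentiable_def)
  have lin: "linear D" using D by (rule has_derivative_linear)
  let ?v = "transition_jacobian c d p *v axis i 1"
  have "pd c i f p = D ?v"
    by (rule pd_eqI[OF chart_change_derivative[OF cd p D]])
  also have "?v = (\<Sum>k\<in>UNIV. (?v $ k) *\<^sub>R axis k 1)"
    by (simp add: vec_eq_iff axis_def if_distrib cong: if_cong)
  also have "D \<dots> = (\<Sum>k\<in>UNIV. ?v $ k * D (axis k 1))"
    using lin by (simp add: linear_sum linear_scale)
  finally show ?thesis
    by (simp add: pd_eqI[OF D] matrix_vector_mult_def axis_def if_distrib cong: if_cong)
qed

lemma continuous_from_charts:
  assumes "\<And>c. c \<in> \<A> \<Longrightarrow> continuous_on (range_of c) (f \<circ> inv_coord c)"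
  shows "continuous_on UNIV f"
proof -
  have "continuous_on (\<Union>c\<in>\<A>. dom_of c) f"
  proof (rule continuous_on_open_UN)
    fix c assume c: "c \<in> \<A>"
    show "open (dom_of c)" using c by (rule open_dom)
    have "continuous_on (dom_of c) ((f \<circ> inv_coord c) \<circ> coord c)"
      by (rule continuous_on_compose[OF continuous_coord[OF c]]) (use assms[OF c] in simp)
    then show "continuous_on (dom_of c) f"
      by (rule continuous_on_cong[THEN iffD1, rotated 2]) (use c in auto)
  qed
  moreover have "(\<Union>c\<in>\<A>. dom_of c) = UNIV" using dom_cover by auto
  ultimately show ?thesis by simp
qed

text \<open>\<open>inv_coord\<close> is uncontrolled outside the range of the chart; a constant
  value there makes the map Borel measurable on the whole space.\<close>

definition icoord :: "('m, 'n) chart \<Rightarrow> real ^ 'n \<Rightarrow> 'm" where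
  "icoord c y = (if y \<in> range_of c then inv_coord c y else undefined)"

lemma measurable_icoord [measurable]:
  assumes "c \<in> \<A>"
  shows "icoord c \<in> borel_measurable borel"
  unfolding icoord_def
  by (subst measurable_If_restrict_space_iff)
     (use open_range[OF assms] continuous_inv_coord[OF assms] in
      \<open>auto intro!: borel_measurable_continuous_on_restrict\<close>)

lemma coord_image_eq:
  assumes "c \<in> \<A>" "S \<subseteq> dom_of c"
  shows "coord c ` S = {y \<in> range_of c. icoord c y \<in> S}"
proof -
  have "y \<in> coord c ` S" if "y \<in> range_of c" "icoord c y \<in> S" for y
    using that assms(1) unfolding icoord_def by (metis coord_inv_coord image_eqI)
  moreover have "coord c p \<in> range_of c" "icoord c (coord c p) \<in> S" if "p \<in> S" for p
  proof -
    have "p \<in> dom_of c" using that assms by blast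
    then show "coord c p \<in> range_of c" by blast
    then show "icoord c (coord c p) \<in> S" using that assms(1) \<open>p \<in> dom_of c\<close> by (simp add: icoord_def)
  qed
  ultimately show ?thesis by blast
qed

lemma coord_image_borel:
  assumes "c \<in> \<A>" "S \<in> sets borel" "S \<subseteq> dom_of c"
  shows "coord c ` S \<in> sets borel"
proof -
  have "coord c ` S = range_of c \<inter> icoord c -` S"
    unfolding coord_image_eq[OF assms(1,3)] by auto
  moreover have "icoord c -` S \<in> sets borel"
    using measurable_sets[OF measurable_icoord[OF assms(1)] assms(2)] by simp
  ultimately show ?thesis using open_range[OF assms(1)] by auto
qed

lemma finite_subatlas:
  obtains cs where "set cs \<subseteq> \<A>" "(\<Union>c\<in>set cs. dom_of c) = UNIV"
proof -
  have "UNIV \<subseteq> (\<Union>c\<in>\<A>. dom_of c)" using dom_cover by auto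
  then obtain C where "C \<subseteq> \<A>" "finite C" "UNIV \<subseteq> (\<Union>c\<in>C. dom_of c)"
    using compactE_image[OF compact_M, of \<A> dom_of] open_dom by metis
  moreover obtain cs where "set cs = C" using finite_list[OF \<open>finite C\<close>] by blast
  ultimately show ?thesis using that[of cs] by blast
qed

end

section \<open>The Riemannian volume of a single continuous metric\<close>

locale metric_manifold = closed_manifold \<A>
  for \<A> :: "('m::t2_space, 'n::finite) chart set" +
  fixes g :: "('m, 'n) tensor2"
  assumes riem: "is_riemannian_metric \<A> g"
    and g_cont: "\<And>c i j. c \<in> \<A> \<Longrightarrow> continuous_on (range_of c) (\<lambda>y. g c (inv_coord c y) $ i $ j)"
begin

lemma det_g_pos: "c \<in> \<A> \<Longrightarrow> p \<in> dom_of c \<Longrightarrow> det (g c p) > 0"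
  using riem by (intro det_pos_of_pos_def) (auto simp: is_riemannian_metric_def)

lemma g_transform:
  assumes "c \<in> \<A>" "d \<in> \<A>" "p \<in> dom_of c" "p \<in> dom_of d"
  shows "g c p = transpose (transition_jacobian c d p) ** g d p ** transition_jacobian c d p"
  using riem assms unfolding is_riemannian_metric_def is_symmetric_tensor_def by blast

definition vol :: "('m, 'n) chart \<Rightarrow> real ^ 'n \<Rightarrow> real" where
  "vol c y = (if y \<in> range_of c then sqrt (det (g c (inv_coord c y))) else 0)"

lemma vol_nonneg: "c \<in> \<A> \<Longrightarrow> vol c y \<ge> 0"
  unfolding vol_def using det_g_pos[of c "inv_coord c y"] by auto

lemma vol_transform:
  assumes "c \<in> \<A>" "d \<in> \<A>" "p \<in> dom_of c" "p \<in> dom_of d"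
  shows "vol c (coord c p) = \<bar>det (transition_jacobian c d p)\<bar> * vol d (coord d p)"
  using assms det_g_pos[of d p]
  by (simp add: vol_def g_transform[OF assms] det_mul det_transpose real_sqrt_mult mult_ac
      flip: real_sqrt_abs power2_eq_square)

lemma continuous_vol: "c \<in> \<A> \<Longrightarrow> continuous_on (range_of c) (vol c)"
proof -
  assume c: "c \<in> \<A>"
  have "continuous_on (range_of c) (\<lambda>y. sqrt (det (g c (inv_coord c y))))"
    unfolding det_def by (intro continuous_intros g_cont c)
  then show ?thesis by (rule continuous_on_cong[THEN iffD1, rotated 2]) (auto simp: vol_def)
qed

lemma measurable_vol [measurable]:
  assumes "c \<in> \<A>"
  shows "vol c \<in> borel_measurable borel"
proof -
  have "(\<lambda>y. if y \<in> range_of c then vol c y else 0) \<in> borel_measurable borel"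
    by (intro borel_measurable_continuous_on_if continuous_vol assms continuous_intros)
       (use open_range[OF assms] in auto)
  moreover have "(\<lambda>y. if y \<in> range_of c then vol c y else 0) = vol c" by (auto simp: vol_def)
  ultimately show ?thesis by simp
qed

text \<open>The push-forward of the coordinate density to M. The value of \<open>icoord\<close> off
  the range is harmless, since \<open>vol\<close> is zero there.\<close>

definition chart_measure :: "('m, 'n) chart \<Rightarrow> 'm measure" where
  "chart_measure c = distr (density lborel (\<lambda>y. ennreal (vol c y))) borel (icoord c)"

lemma emeasure_chart_measure:
  assumes c: "c \<in> \<A>" and S: "S \<in> sets borel" "S \<subseteq> dom_of c"
  shows "emeasure (chart_measure c) S = (\<integral>\<^sup>+ y \<in> coord c ` S. ennreal (sqrt (det (g c (inv_coord c y)))) \<partial>lborel)"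
proof -
  have m: "icoord c -` S \<in> sets borel"
    using measurable_sets[OF measurable_icoord[OF c] S(1)] by simp
  have "emeasure (chart_measure c) S = (\<integral>\<^sup>+ y. ennreal (vol c y) * indicator (icoord c -` S) y \<partial>lborel)"
    unfolding chart_measure_def using c S m
    by (simp add: emeasure_distr emeasure_density)
  also have "\<dots> = (\<integral>\<^sup>+ y \<in> coord c ` S. ennreal (sqrt (det (g c (inv_coord c y)))) \<partial>lborel)"
    unfolding coord_image_eq[OF c S(2)]
    by (rule nn_integral_cong) (auto simp: vol_def indicator_def)
  finally show ?thesis .
qed

text \<open>By \<open>vol_transform\<close> the two densities differ by the absolute Jacobian
  determinant, the factor of the change of variables.\<close>

lemma chart_measure_overlap:
  assumes c: "c \<in> \<A>" and d: "d \<in> \<A>" and S: "S \<in> sets borel" "S \<subseteq> dom_of c" "S \<subseteq> dom_of d"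
  shows "emeasure (chart_measure c) S = emeasure (chart_measure d) S"
proof -
  let ?T = "coord d \<circ> inv_coord c"
  let ?J = "\<lambda>y v. transition_jacobian c d (inv_coord c y) *v v"
  have cS: "coord c ` S \<in> sets borel" and dS: "coord d ` S \<in> sets borel"
    using coord_image_borel assms by auto
  have im: "?T ` (coord c ` S) = coord d ` S"
    unfolding image_image comp_def using c S(2) by (intro image_cong) auto
  have sub: "vol c y = \<bar>det (matrix (?J y))\<bar> * vol d (?T y)" if yS: "y \<in> coord c ` S" for y
  proof -
    obtain p where p: "p \<in> S" "y = coord c p" using yS by blast
    then have "inv_coord c y = p" "p \<in> dom_of c" "p \<in> dom_of d" using S c by auto
    then show ?thesis using vol_transform[OF c d, of p] p(2) by simp
  qed
  have eqc: "indicator (coord c ` S) y * (\<bar>det (matrix (?J y))\<bar> * vol d (?T y)) = indicator (coord c ` S) y * vol c y" for y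
    using sub[of y] by (auto simp: indicator_def)
  have "(\<integral>\<^sup>+y. ennreal (indicator (?T ` (coord c ` S)) y * vol d y) \<partial>lborel) =
    (\<integral>\<^sup>+y. ennreal (indicator (coord c ` S) y * (\<bar>det (matrix (?J y))\<bar> * vol d (?T y))) \<partial>lborel)"
  proof (rule nn_integral_change_of_variables[OF cS])
    fix y assume "y \<in> coord c ` S"
    then obtain p where "p \<in> S" "y = coord c p" by auto
    then have "inv_coord c y = p" "p \<in> dom_of c" "p \<in> dom_of d" using S c by auto
    then show "(?T has_derivative ?J y) (at y within coord c ` S)"
      using transition_has_derivative[OF c d, of p] \<open>y = coord c p\<close> by (simp add: has_derivative_at_withinI)
  next
    show "inj_on ?T (coord c ` S)"
      by (rule inj_onI) (use c d S in \<open>auto simp: subset_iff\<close>, metis inv_coord_coord)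
    show "vol d y \<ge> 0" for y by (rule vol_nonneg[OF d])
    show "(\<lambda>y. indicator (coord c ` S) y * (\<bar>det (matrix (?J y))\<bar> * vol d (?T y))) \<in> borel_measurable borel"
      unfolding eqc using cS c by measurable
    show "(\<lambda>y. indicator (?T ` coord c ` S) y * vol d y) \<in> borel_measurable borel"
      unfolding im using dS d by measurable
  qed
  then have "(\<integral>\<^sup>+y. ennreal (indicator (coord d ` S) y * vol d y) \<partial>lborel) =
    (\<integral>\<^sup>+y. ennreal (indicator (coord c ` S) y * vol c y) \<partial>lborel)"
    unfolding im eqc .
  moreover have "emeasure (chart_measure e) S = (\<integral>\<^sup>+y. ennreal (indicator (coord e ` S) y * vol e y) \<partial>lborel)"
    if "e \<in> \<A>" "S \<subseteq> dom_of e" for e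
    unfolding emeasure_chart_measure[OF that(1) S(1) that(2)] using that(2)
    by (intro nn_integral_cong) (auto simp: vol_def indicator_def)
  ultimately show ?thesis using c d S by simp
qed

definition RV :: "'m measure" where "RV = riemannian_volume \<A> g"

text \<open>M is cut into finitely many disjoint Borel pieces, each inside one chart, and the chart
  measures are added up. Agreement on overlaps gives the prescribed values in every chart, and the
  same pieces force uniqueness.\<close>

lemma RV_props: "sets RV = sets borel"
  and emeasure_RV: "c \<in> \<A> \<Longrightarrow> S \<in> sets borel \<Longrightarrow> S \<subseteq> dom_of c \<Longrightarrow> emeasure RV S = emeasure (chart_measure c) S"
proof -
  obtain cs where cs: "set cs \<subseteq> \<A>" "(\<Union>c\<in>set cs. dom_of c) = UNIV" by (rule finite_subatlas)
  define N where "N = length cs"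
  have csA: "cs ! k \<in> \<A>" if "k < N" for k using cs(1) that by (auto simp: N_def)
  define B where "B k = dom_of (cs ! k) - (\<Union>j<k. dom_of (cs ! j))" for k
  have B_sets: "B k \<in> sets borel" if "k < N" for k
    unfolding B_def using that csA open_dom by (intro sets.Diff sets.finite_UN) auto
  have B_sub: "B k \<subseteq> dom_of (cs ! k)" for k by (auto simp: B_def)
  have B_disj: "disjoint_family_on B {..<N}"
  proof -
    have "B m \<inter> B n = {}" if "m < n" for m n using that by (auto simp: B_def)
    then show ?thesis unfolding disjoint_family_on_def by (metis Int_commute linorder_neqE_nat)
  qed
  have B_un: "(\<Union>k<N. B k) = UNIV"
  proof -
    have "p \<in> (\<Union>k<N. B k)" for p
    proof -
      have ex: "\<exists>k. k < N \<and> p \<in> dom_of (cs ! k)"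
      proof -
        obtain c where "c \<in> set cs" "p \<in> dom_of c" using cs(2) by blast
        then show ?thesis by (auto simp: N_def in_set_conv_nth)
      qed
      define k where "k = (LEAST k. k < N \<and> p \<in> dom_of (cs ! k))"
      have "k < N \<and> p \<in> dom_of (cs ! k)" unfolding k_def by (rule LeastI_ex[OF ex])
      moreover have "p \<notin> dom_of (cs ! j)" if "j < k" for j
        using not_less_Least[of j "\<lambda>k. k < N \<and> p \<in> dom_of (cs ! k)"] that calculation unfolding k_def[symmetric] by auto
      ultimately show ?thesis by (auto simp: B_def)
    qed
    then show ?thesis by blast
  qed
  have split: "emeasure \<mu> S = (\<Sum>k<N. emeasure \<mu> (S \<inter> B k))" if "sets \<mu> = sets borel" "S \<in> sets borel" for \<mu> :: "'m measure" and S
  proof -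
    have "(\<Sum>k<N. emeasure \<mu> (S \<inter> B k)) = emeasure \<mu> (\<Union>k<N. S \<inter> B k)"
    proof (rule sum_emeasure)
      show "disjoint_family_on (\<lambda>k. S \<inter> B k) {..<N}"
        using B_disj unfolding disjoint_family_on_def by blast
    qed (use that B_sets in auto)
    also have "(\<Union>k<N. S \<inter> B k) = S" using B_un by auto
    finally show ?thesis ..
  qed
  have sets_cm: "sets (chart_measure c) = sets borel" for c by (simp add: chart_measure_def)
  define \<mu>0 where "\<mu>0 S = (\<Sum>k<N. emeasure (chart_measure (cs ! k)) (S \<inter> B k))" for S
  define \<mu> where "\<mu> = measure_of UNIV (sets borel) \<mu>0"
  have sets_\<mu>: "sets \<mu> = sets borel" unfolding \<mu>_def by (simp add: sets.sigma_sets_eq[of borel, simplified])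
  have em: "emeasure \<mu> S = \<mu>0 S" if "S \<in> sets borel" for S
    unfolding \<mu>_def
  proof (rule emeasure_measure_of_sigma)
    show "sigma_algebra UNIV (sets (borel :: 'm measure))"
      using sets.sigma_algebra_axioms[of "borel :: 'm measure"] by simp
    show "positive (sets borel) \<mu>0" by (simp add: positive_def \<mu>0_def)
    show "countably_additive (sets borel) \<mu>0"
    proof (rule countably_additiveI)
      fix F :: "nat \<Rightarrow> 'm set" assume F: "range F \<subseteq> sets borel" "disjoint_family F"
      have "(\<Sum>i. \<mu>0 (F i)) = (\<Sum>k<N. \<Sum>i. emeasure (chart_measure (cs ! k)) (F i \<inter> B k))"
        unfolding \<mu>0_def by (rule suminf_sum) simp
      also have "\<dots> = (\<Sum>k<N. emeasure (chart_measure (cs ! k)) (\<Union>i. F i \<inter> B k))"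
        by (intro sum.cong refl suminf_emeasure)
           (use F B_sets sets_cm in \<open>auto simp: disjoint_family_on_def\<close>)
      finally show "(\<Sum>i. \<mu>0 (F i)) = \<mu>0 (\<Union>i. F i)" by (simp add: \<mu>0_def)
    qed
  qed (use that in auto)
  have em_chart: "emeasure \<mu> S = emeasure (chart_measure c) S" if "c \<in> \<A>" "S \<in> sets borel" "S \<subseteq> dom_of c" for c S
  proof -
    have "emeasure \<mu> S = (\<Sum>k<N. emeasure (chart_measure c) (S \<inter> B k))"
      unfolding em[OF that(2)] \<mu>0_def
      by (intro sum.cong refl chart_measure_overlap) (use that B_sets B_sub csA in auto)
    then show ?thesis using split[OF sets_cm that(2)] by simp
  qed
  have "RV = \<mu>"
    unfolding RV_def riemannian_volume_def
  proof (rule the_equality)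
    show "sets \<mu> = sets borel \<and> (\<forall>c\<in>\<A>. \<forall>S\<in>sets borel. S \<subseteq> dom_of c \<longrightarrow>
      emeasure \<mu> S = (\<integral>\<^sup>+ y \<in> coord c ` S. ennreal (sqrt (det (g c (inv_coord c y)))) \<partial>lborel))"
      using sets_\<mu> em_chart emeasure_chart_measure by simp
  next
    fix \<nu> :: "'m measure"
    assume \<nu>: "sets \<nu> = sets borel \<and> (\<forall>c\<in>\<A>. \<forall>S\<in>sets borel. S \<subseteq> dom_of c \<longrightarrow>
      emeasure \<nu> S = (\<integral>\<^sup>+ y \<in> coord c ` S. ennreal (sqrt (det (g c (inv_coord c y)))) \<partial>lborel))"
    show "\<nu> = \<mu>"
    proof (rule measure_eqI)
      show "sets \<nu> = sets \<mu>" using \<nu> sets_\<mu> by simp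
      fix S assume "S \<in> sets \<nu>"
      then have S: "S \<in> sets borel" using \<nu> by simp
      have "emeasure \<nu> (S \<inter> B k) = emeasure \<mu> (S \<inter> B k)" if "k < N" for k
      proof -
        have s: "S \<inter> B k \<in> sets borel" "S \<inter> B k \<subseteq> dom_of (cs ! k)"
          using B_sub[of k] B_sets[OF that] S by auto
        have "emeasure \<nu> (S \<inter> B k) =
            (\<integral>\<^sup>+ y \<in> coord (cs ! k) ` (S \<inter> B k). ennreal (sqrt (det (g (cs ! k) (inv_coord (cs ! k) y)))) \<partial>lborel)"
          using \<nu> csA[OF that] s by blast
        then show ?thesis
          using em_chart[OF csA[OF that] s] emeasure_chart_measure[OF csA[OF that] s] by simp
      qed
      then show "emeasure \<nu> S = emeasure \<mu> S"
        using split[of \<nu> S] split[of \<mu> S] \<nu> sets_\<mu> S by simp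
    qed
  qed
  then show "sets RV = sets borel"
    "c \<in> \<A> \<Longrightarrow> S \<in> sets borel \<Longrightarrow> S \<subseteq> dom_of c \<Longrightarrow> emeasure RV S = emeasure (chart_measure c) S"
    using sets_\<mu> em_chart by auto
qed

lemma space_RV [simp]: "space RV = UNIV"
  using sets_eq_imp_space_eq[OF RV_props] by simp

lemma measurable_RV: "f \<in> borel_measurable borel \<Longrightarrow> f \<in> borel_measurable RV"
  using measurable_cong_sets[OF RV_props refl] by blast

text \<open>After restriction to the chart domain the volume coincides with the chart measure, whose
  density is explicit; for \<open>f\<close> supported in the domain the restriction has no
  effect.\<close>

lemma
  fixes f :: "'m \<Rightarrow> real"
  assumes c: "c \<in> \<A>" and f: "f \<in> borel_measurable borel" and supp: "\<And>p. p \<notin> dom_of c \<Longrightarrow> f p = 0"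
  shows integral_RV_chart: "integral\<^sup>L RV f = (\<integral>y. vol c y * f (icoord c y) \<partial>lborel)"
    and integrable_RV_chart: "integrable RV f \<longleftrightarrow> integrable lborel (\<lambda>y. vol c y * f (icoord c y))"
proof -
  have D: "dom_of c \<in> sets borel" using open_dom[OF c] by simp
  have sets_cm: "sets (chart_measure c) = sets borel" by (simp add: chart_measure_def)
  have eq: "density RV (indicator (dom_of c)) = density (chart_measure c) (indicator (dom_of c))"
  proof (rule measure_eqI)
    fix S assume "S \<in> sets (density RV (indicator (dom_of c)))"
    then have S: "S \<in> sets borel" by (simp add: RV_props)
    have "emeasure (density \<mu> (indicator (dom_of c))) S = emeasure \<mu> (dom_of c \<inter> S)" if "sets \<mu> = sets borel" for \<mu> :: "'m measure"
    proof -
      have "dom_of c \<in> sets \<mu>" "S \<in> sets \<mu>" using that D S by auto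
      then show ?thesis
        by (simp add: emeasure_density indicator_inter_arith[symmetric])
    qed
    then show "emeasure (density RV (indicator (dom_of c))) S = emeasure (density (chart_measure c) (indicator (dom_of c))) S"
      using emeasure_RV[OF c, of "dom_of c \<inter> S"] D S RV_props sets_cm by auto
  qed (simp add: RV_props sets_cm)
  have fi: "(\<lambda>p. indicator (dom_of c) p * f p) = f" using supp by (auto simp: indicator_def fun_eq_iff)
  have fm: "f \<in> borel_measurable (chart_measure c)" "f \<in> borel_measurable RV"
    using f measurable_cong_sets[OF sets_cm refl] measurable_RV by auto
  have e: "density \<mu> (indicator (dom_of c)) = density \<mu> (\<lambda>p. ennreal (indicator (dom_of c) p))" for \<mu> :: "'m measure"
    by (rule arg_cong[of _ _ "density \<mu>"]) (auto simp: indicator_def)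
  have Dr: "(\<lambda>p. indicator (dom_of c) p :: real) \<in> borel_measurable \<mu>" if "sets \<mu> = sets borel" for \<mu> :: "'m measure"
    using D that by simp
  have i1: "integral\<^sup>L (density \<mu> (indicator (dom_of c))) f = integral\<^sup>L \<mu> f"
    and i2: "integrable (density \<mu> (indicator (dom_of c))) f \<longleftrightarrow> integrable \<mu> f"
    if "sets \<mu> = sets borel" "f \<in> borel_measurable \<mu>" for \<mu> :: "'m measure"
    unfolding e using integral_density[OF that(2) Dr[OF that(1)]] integrable_density[OF that(2) Dr[OF that(1)]] fi
    by auto
  have ic: "icoord c \<in> measurable (density lborel (\<lambda>y. ennreal (vol c y))) borel"
    using measurable_icoord[OF c] by simp
  have fic: "(\<lambda>y. f (icoord c y)) \<in> borel_measurable lborel"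
    using measurable_compose[OF measurable_icoord[OF c] f] by simp
  have v: "vol c \<in> borel_measurable lborel" "AE y in lborel. 0 \<le> vol c y"
    using measurable_vol[OF c] vol_nonneg[OF c] by auto
  have "integral\<^sup>L RV f = integral\<^sup>L (chart_measure c) f"
    using i1[of RV] i1[of "chart_measure c"] eq fm RV_props sets_cm by simp
  also have "\<dots> = (\<integral>y. f (icoord c y) \<partial>density lborel (\<lambda>y. ennreal (vol c y)))"
    unfolding chart_measure_def by (rule integral_distr[OF ic f])
  also have "\<dots> = (\<integral>y. vol c y * f (icoord c y) \<partial>lborel)"
    using integral_density[OF fic v] by simp
  finally show "integral\<^sup>L RV f = (\<integral>y. vol c y * f (icoord c y) \<partial>lborel)" .
  have "integrable RV f \<longleftrightarrow> integrable (chart_measure c) f"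
    using i2[of RV] i2[of "chart_measure c"] eq fm RV_props sets_cm by simp
  also have "\<dots> \<longleftrightarrow> integrable (density lborel (\<lambda>y. ennreal (vol c y))) (\<lambda>y. f (icoord c y))"
    unfolding chart_measure_def by (rule integrable_distr_eq[OF ic f])
  also have "\<dots> \<longleftrightarrow> integrable lborel (\<lambda>y. vol c y * f (icoord c y))"
    using integrable_density[OF fic v] by simp
  finally show "integrable RV f \<longleftrightarrow> integrable lborel (\<lambda>y. vol c y * f (icoord c y))" .
qed

end

subsection \<open>Green's formula\<close>

text \<open>On an open set the derivative is unique, so the local derivatives are all given by
  \<open>frechet_derivative\<close> and glue together.\<close>

lemma Ck_on_local:
  assumes "\<And>x. x \<in> S \<Longrightarrow> \<exists>V. open V \<and> x \<in> V \<and> Ck_on k f V"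
  shows "Ck_on k f S"
  using assms
proof (induction k arbitrary: f)
  case 0
  have "isCont f x" if "x \<in> S" for x
    using 0[OF that] continuous_on_eq_continuous_at by auto
  then show ?case by (simp add: continuous_at_imp_continuous_on)
next
  case (Suc k)
  have V: "\<exists>V. open V \<and> x \<in> V \<and> (\<forall>z\<in>V. (f has_derivative frechet_derivative f (at z)) (at z))
      \<and> (\<forall>v. Ck_on k (\<lambda>z. frechet_derivative f (at z) v) V)" if "x \<in> S" for x
  proof -
    obtain V where V: "open V" "x \<in> V" "Ck_on (Suc k) f V" using Suc.prems[OF \<open>x \<in> S\<close>] by blast
    then obtain f' where f': "\<And>z. z \<in> V \<Longrightarrow> (f has_derivative f' z) (at z within V)"
      "\<And>v. Ck_on k (\<lambda>x. f' x v) V" by (metis Ck_on_SucE)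
    have d: "(f has_derivative f' z) (at z)" if "z \<in> V" for z
      using f'(1)[OF that] at_within_open[OF that V(1)] by simp
    then have e: "frechet_derivative f (at z) = f' z" if "z \<in> V" for z
      using that by (metis frechet_derivative_at)
    have "Ck_on k (\<lambda>z. frechet_derivative f (at z) v) V" for v
      using f'(2)[of v] Ck_on_cong[of V "\<lambda>z. frechet_derivative f (at z) v" "\<lambda>x. f' x v" k] e by simp
    with V d e show ?thesis by metis
  qed
  show ?case
  proof (rule Ck_on_SucI[where f'="\<lambda>z. frechet_derivative f (at z)"])
    show "(f has_derivative frechet_derivative f (at x)) (at x within S)" if "x \<in> S" for x
      using V[OF that] has_derivative_at_withinI by blast
    show "Ck_on k (\<lambda>x. frechet_derivative f (at x) v) S" for v
      by (rule Suc.IH) (use V in blast)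
  qed
qed

lemma Ck_on_1D:
  assumes "Ck_on 1 f U" "open U"
  shows "y \<in> U \<Longrightarrow> (f has_derivative frechet_derivative f (at y)) (at y)"
    and "continuous_on U (\<lambda>y. frechet_derivative f (at y) v)"
proof -
  from assms(1) obtain f' where f': "\<And>x. x \<in> U \<Longrightarrow> (f has_derivative f' x) (at x within U)"
    "\<And>v. continuous_on U (\<lambda>x. f' x v)"
    by (metis One_nat_def Ck_on_SucE Ck_on.simps(1))
  have d: "(f has_derivative f' y) (at y)" if "y \<in> U" for y
    using f'(1)[OF that] at_within_open[OF that assms(2)] by simp
  then have e: "frechet_derivative f (at y) = f' y" if "y \<in> U" for y
    using that by (metis frechet_derivative_at)
  show "y \<in> U \<Longrightarrow> (f has_derivative frechet_derivative f (at y)) (at y)" using d e by simp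
  show "continuous_on U (\<lambda>y. frechet_derivative f (at y) v)"
    using f'(2)[of v] continuous_on_cong[of U U "\<lambda>y. frechet_derivative f (at y) v" "\<lambda>x. f' x v"] e by simp
qed

text \<open>The open sets U and - K cover the space; the extension is f on the first and 0 on the
  second.\<close>

lemma Ck_on_extend_zero:
  assumes "open U" "compact K" "K \<subseteq> U" "Ck_on k f U" "\<And>y. y \<in> U - K \<Longrightarrow> f y = 0"
  shows "Ck_on k (\<lambda>y. if y \<in> U then f y else 0) S"
proof (rule Ck_on_local)
  fix x assume "x \<in> S"
  show "\<exists>V. open V \<and> x \<in> V \<and> Ck_on k (\<lambda>y. if y \<in> U then f y else 0) V"
  proof (cases "x \<in> U")
    case True
    have "Ck_on k (\<lambda>y. if y \<in> U then f y else 0) U"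
      using assms(4) Ck_on_cong[of U "\<lambda>y. if y \<in> U then f y else 0" f k] by simp
    with True assms(1) show ?thesis by blast
  next
    case False
    have "Ck_on k (\<lambda>y. if y \<in> U then f y else 0) (- K)"
      by (subst Ck_on_cong[of _ _ "\<lambda>y. 0"]) (use assms(5) in \<open>auto intro: Ck_on_const\<close>)
    with False assms show ?thesis by (metis ComplI closed_def compact_imp_closed subsetD)
  qed
qed

lemma integral_compact_support:
  fixes f :: "'a::euclidean_space \<Rightarrow> real"
  assumes "continuous_on UNIV f" "\<And>y. y \<notin> cbox a b \<Longrightarrow> f y = 0"
  shows "integrable lborel f" "(\<integral>y. f y \<partial>lborel) = integral (cbox a b) f"
proof -
  have e: "(\<lambda>y. indicator (cbox a b) y *\<^sub>R f y) = f"
    using assms(2) by (auto simp: indicator_def fun_eq_iff)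
  have c: "continuous_on (cbox a b) f" using assms(1) continuous_on_subset by blast
  have i: "set_integrable lborel (cbox a b) f"
    unfolding set_integrable_def by (rule borel_integrable_compact[OF compact_cbox c])
  then show "integrable lborel f" unfolding set_integrable_def e .
  show "(\<integral>y. f y \<partial>lborel) = integral (cbox a b) f"
    using set_borel_integral_eq_integral(2)[OF i] unfolding set_lebesgue_integral_def e .
qed

text \<open>By translation invariance the integral of Z(y + s v) does not depend on s; its
  derivative at s = 0 is the integral of the directional derivative.\<close>

lemma integral_derivative_zero:
  fixes Z :: "'a::euclidean_space \<Rightarrow> real"
  assumes der: "\<And>y. (Z has_derivative Z' y) (at y)" and cont: "continuous_on UNIV (\<lambda>y. Z' y v)"
    and K: "compact K" "\<And>y. y \<notin> K \<Longrightarrow> Z y = 0"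
  shows "integrable lborel (\<lambda>y. Z' y v)" "(\<integral>y. Z' y v \<partial>lborel) = 0"
proof -
  have Z'0: "Z' y v = 0" if "y \<notin> K" for y
  proof -
    have "((\<lambda>y. 0) has_derivative Z' y) (at y)"
      by (rule has_derivative_transform_within_open[OF der, of "- K"])
         (use K that in \<open>auto simp: compact_imp_closed open_Compl\<close>)
    then have "Z' y = (\<lambda>h. 0)" using has_derivative_unique has_derivative_const by blast
    then show ?thesis by simp
  qed
  obtain r where r: "K \<subseteq> cball 0 r" using bounded_subset_ballD[OF compact_imp_bounded[OF K(1)], of 0] ball_subset_cball by blast
  \<comment> \<open>Enlarging the ball by \<open>norm v\<close> lets one box contain the support of
    every translate with |s| \<le> 1.\<close>
  obtain a b :: 'a where ab: "cball 0 (r + norm v) \<subseteq> cbox a b"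
    using bounded_subset_cbox_symmetric[OF bounded_cball, of 0 "r + norm v"] by metis
  have out: "y + s *\<^sub>R v \<notin> K" if "y \<notin> cbox a b" "s \<in> {-1..1}" for y :: 'a and s
  proof
    assume "y + s *\<^sub>R v \<in> K"
    then have "norm (y + s *\<^sub>R v) \<le> r" using r by auto
    moreover have "norm (s *\<^sub>R v) \<le> norm v"
      using that(2) mult_right_mono[of "\<bar>s\<bar>" 1 "norm v"] by (auto simp: abs_le_iff)
    moreover have "norm y \<le> norm (y + s *\<^sub>R v) + norm (s *\<^sub>R v)"
      using norm_triangle_ineq4[of "y + s *\<^sub>R v" "s *\<^sub>R v"] by simp
    ultimately have "y \<in> cball 0 (r + norm v)" by simp
    with ab that(1) show False by auto
  qed
  have cZ: "continuous_on UNIV Z"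
    using der by (auto intro!: continuous_at_imp_continuous_on has_derivative_continuous)
  define F where "F s = integral (cbox a b) (\<lambda>y. Z (y + s *\<^sub>R v))" for s
  have F: "F s = (\<integral>y. Z y \<partial>lborel)" if "s \<in> {-1..1}" for s
  proof -
    have "F s = (\<integral>y. Z (y + s *\<^sub>R v) \<partial>lborel)"
      unfolding F_def
      by (rule integral_compact_support(2)[symmetric])
         (use out that K(2) in \<open>auto intro!: continuous_on_compose2[OF cZ] continuous_intros\<close>)
    also have "\<dots> = (\<integral>y. Z y \<partial>distr lborel borel ((+) (s *\<^sub>R v)))"
      by (subst integral_distr) (use cZ in \<open>auto simp: add.commute borel_measurable_continuous_onI\<close>)
    finally show ?thesis unfolding lborel_distr_plus .
  qed
  have "(F has_vector_derivative integral (cbox a b) (\<lambda>y. Z' (y + 0 *\<^sub>R v) v)) (at 0 within {-1..1})"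
    unfolding F_def
  proof (rule leibniz_rule_vector_derivative[where fx="\<lambda>s y. Z' (y + s *\<^sub>R v) v"])
    show "((\<lambda>s. Z (y + s *\<^sub>R v)) has_vector_derivative Z' (y + s *\<^sub>R v) v) (at s within {- 1..1})" for s y
    proof -
      have "((\<lambda>s. Z (y + s *\<^sub>R v)) has_derivative (\<lambda>r. Z' (y + s *\<^sub>R v) (r *\<^sub>R v))) (at s within {- 1..1})"
        by (rule has_derivative_compose[OF _ der]) (auto intro!: derivative_eq_intros)
      then show ?thesis
        by (simp add: has_vector_derivative_def linear_scale[OF has_derivative_linear[OF der]])
    qed
    show "(\<lambda>y. Z (y + s *\<^sub>R v)) integrable_on cbox a b" for s
      by (intro integrable_continuous continuous_on_compose2[OF cZ] continuous_intros) auto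
    show "continuous_on ({- 1..1} \<times> cbox a b) (\<lambda>(s, y). Z' (y + s *\<^sub>R v) v)"
      unfolding split_beta by (intro continuous_on_compose2[OF cont] continuous_intros) auto
  qed auto
  moreover have "(F has_vector_derivative 0) (at 0 within {-1..1})"
    by (rule has_vector_derivative_transform[where f="\<lambda>_. \<integral>y. Z y \<partial>lborel"]) (use F in auto)
  moreover have "at (0::real) within {-1..1} \<noteq> bot"
    by (simp add: trivial_limit_within islimpt_Icc)
  ultimately have "integral (cbox a b) (\<lambda>y. Z' (y + 0 *\<^sub>R v) v) = 0"
    by (metis vector_derivative_unique_within)
  moreover have "integrable lborel (\<lambda>y. Z' y v)" "(\<integral>y. Z' y v \<partial>lborel) = integral (cbox a b) (\<lambda>y. Z' y v)"
    by (rule integral_compact_support[OF cont], use out[of _ 0] Z'0 in auto)+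
  ultimately show "integrable lborel (\<lambda>y. Z' y v)" "(\<integral>y. Z' y v \<partial>lborel) = 0" by simp_all
qed

lemma integral_divergence_zero:
  fixes X :: "'n::finite \<Rightarrow> real ^ 'n \<Rightarrow> real"
  assumes U: "open U" "compact K" "K \<subseteq> U"
    and X: "\<And>i. Ck_on 1 (X i) U" "\<And>i y. y \<in> U - K \<Longrightarrow> X i y = 0"
  shows "(\<integral>y. (if y \<in> U then \<Sum>i\<in>UNIV. frechet_derivative (X i) (at y) (axis i 1) else 0) \<partial>lborel) = 0"
proof -
  define Z where "Z i = (\<lambda>y. if y \<in> U then X i y else 0)" for i
  have Z: "Ck_on 1 (Z i) UNIV" for i
    unfolding Z_def by (rule Ck_on_extend_zero[OF U X(1)]) (use X(2) in auto)
  have "frechet_derivative (Z i) (at y) = frechet_derivative (X i) (at y)" if "y \<in> U" for i y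
  proof -
    have "(Z i has_derivative frechet_derivative (X i) (at y)) (at y)"
      by (rule has_derivative_transform_within_open[OF Ck_on_1D(1)[OF X(1) U(1) that] U(1) that])
         (simp add: Z_def)
    then show ?thesis by (metis frechet_derivative_at)
  qed
  moreover have "frechet_derivative (Z i) (at y) = (\<lambda>v. 0)" if "y \<notin> U" for i y
  proof -
    have "((\<lambda>y. 0) has_derivative (\<lambda>v. 0)) (at y)" by simp
    then have "(Z i has_derivative (\<lambda>v. 0)) (at y)"
      by (rule has_derivative_transform_within_open[where s="- K"])
         (use U that X(2) in \<open>auto simp: Z_def compact_imp_closed open_Compl\<close>)
    then show ?thesis by (metis frechet_derivative_at)
  qed
  ultimately have "(\<lambda>y. if y \<in> U then \<Sum>i\<in>UNIV. frechet_derivative (X i) (at y) (axis i 1) else 0)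
    = (\<lambda>y. \<Sum>i\<in>UNIV. frechet_derivative (Z i) (at y) (axis i 1))"
    by (auto simp: fun_eq_iff)
  moreover have "(\<integral>y. (\<Sum>i\<in>UNIV. frechet_derivative (Z i) (at y) (axis i 1)) \<partial>lborel)
    = (\<Sum>i\<in>UNIV. \<integral>y. frechet_derivative (Z i) (at y) (axis i 1) \<partial>lborel)"
    by (rule Bochner_Integration.integral_sum, rule integral_derivative_zero(1)[where K=K and Z="Z i" for i])
       (use Ck_on_1D[OF Z open_UNIV] U X(2) in \<open>auto simp: Z_def\<close>)
  moreover have "(\<integral>y. frechet_derivative (Z i) (at y) (axis i 1) \<partial>lborel) = 0" for i
    by (rule integral_derivative_zero(2)[where K=K and Z="Z i"])
       (use Ck_on_1D[OF Z open_UNIV] U X(2) in \<open>auto simp: Z_def\<close>)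
  ultimately show ?thesis by simp
qed

lemma continuous_on_extend_zero:
  fixes F :: "'a::real_normed_vector \<times> 'b::real_normed_vector \<Rightarrow> real"
  assumes "open U" "compact K" "K \<subseteq> U" "continuous_on (I \<times> U) F"
    and "continuous_on U h" "\<And>y. y \<in> U - K \<Longrightarrow> h y = 0"
  shows "continuous_on (I \<times> UNIV) (\<lambda>(t, y). if y \<in> U then h y * F (t, y) else 0)"
proof -
  have "continuous_on (I \<times> U \<union> I \<times> (- K)) (\<lambda>x. if snd x \<in> U then h (snd x) * F x else 0)"
  proof (rule continuous_on_Un_local_open)
    show "openin (top_of_set (I \<times> U \<union> I \<times> - K)) (I \<times> U)"
      using assms(1) by (auto simp: openin_open intro!: exI[of _ "UNIV \<times> U"] open_Times)
    show "openin (top_of_set (I \<times> U \<union> I \<times> - K)) (I \<times> - K)"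
      using assms(2) by (auto simp: openin_open compact_imp_closed open_Compl intro!: exI[of _ "UNIV \<times> - K"] open_Times)
    have "continuous_on (I \<times> U) (\<lambda>x. h (snd x) * F x)"
      by (intro continuous_intros assms continuous_on_compose2[OF assms(5)]) auto
    then show "continuous_on (I \<times> U) (\<lambda>x. if snd x \<in> U then h (snd x) * F x else 0)"
      by (rule continuous_on_cong[THEN iffD1, rotated 2]) auto
    have "continuous_on (I \<times> - K) (\<lambda>x. 0 :: real)" by simp
    then show "continuous_on (I \<times> - K) (\<lambda>x. if snd x \<in> U then h (snd x) * F x else 0)"
      by (rule continuous_on_cong[THEN iffD1, rotated 2]) (use assms(6) in auto)
  qed
  moreover have "I \<times> U \<union> I \<times> - K = I \<times> UNIV" using assms(3) by auto
  moreover have "(\<lambda>(t, y). if y \<in> U then h y * F (t, y) else 0) = (\<lambda>x. if snd x \<in> U then h (snd x) * F x else 0)"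
    by auto
  ultimately show ?thesis by simp
qed

text \<open>The time-independent cutoff \<open>h\<close>, later a member of a partition of unity,
  confines all integrals to one box, where the Leibniz rule within \<open>I\<close> applies, end
  points included.\<close>

lemma (in slab) has_derivative_integral_slab:
  assumes K: "compact K" "K \<subseteq> U" and F: "smooth F"
    and h: "continuous_on U h" "\<And>y. y \<in> U - K \<Longrightarrow> h y = 0" and t: "t \<in> I"
  shows "((\<lambda>s. \<integral>y. (if y \<in> U then h y * F (s, y) else 0) \<partial>lborel) has_real_derivative
     (\<integral>y. (if y \<in> U then h y * dt F (t, y) else 0) \<partial>lborel)) (at t within I)"
proof -
  obtain a b where ab: "K \<subseteq> cbox a b"
    using compact_imp_bounded[OF K(1)] bounded_subset_cbox_symmetric by metis
  have ext: "continuous_on (I \<times> UNIV) (\<lambda>(t, y). if y \<in> U then h y * G (t, y) else 0)" if "smooth G" for G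
    by (rule continuous_on_extend_zero[OF open_U K smooth_on_imp_continuous_on[OF that] h])
  have cP: "continuous_on S (\<lambda>y. (s, y))" for s :: real and S :: "(real ^ 'n) set"
    by (intro continuous_intros)
  have ints: "(\<integral>y. (if y \<in> U then h y * G (s, y) else 0) \<partial>lborel) = integral (cbox a b) (\<lambda>y. if y \<in> U then h y * G (s, y) else 0)"
    if "smooth G" "s \<in> I" for G s
  proof (rule integral_compact_support(2))
    show "continuous_on UNIV (\<lambda>y. if y \<in> U then h y * G (s, y) else 0)"
      using continuous_on_compose2[OF ext[OF that(1)] cP[of UNIV s]] that(2) by auto
    show "(if y \<in> U then h y * G (s, y) else 0) = 0" if "y \<notin> cbox a b" for y
      using that h(2) ab by auto
  qed
  have "((\<lambda>s. integral (cbox a b) (\<lambda>y. if y \<in> U then h y * F (s, y) else 0)) has_vector_derivative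
     integral (cbox a b) (\<lambda>y. if y \<in> U then h y * dt F (t, y) else 0)) (at t within I)"
  proof (rule leibniz_rule_vector_derivative[where U=I and fx="\<lambda>s y. if y \<in> U then h y * dt F (s, y) else 0"])
    fix s y assume s: "s \<in> I"
    show "((\<lambda>s. if y \<in> U then h y * F (s, y) else 0) has_vector_derivative (if y \<in> U then h y * dt F (s, y) else 0)) (at s within I)"
    proof (cases "y \<in> U")
      case True
      have "((\<lambda>s. F (s, y)) has_derivative (\<lambda>r. dirD Q (r, 0) F (s, y))) (at s within I)"
        by (rule has_derivative_in_compose2[OF smooth_on_has_derivative[OF F], where f="\<lambda>s. (s, y)"])
           (use s True in \<open>auto intro!: derivative_eq_intros\<close>)
      moreover have "(\<lambda>r. dirD Q (r, 0) F (s, y)) = (*) (dt F (s, y))"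
      proof
        show "dirD Q (r, 0) F (s, y) = dt F (s, y) * r" for r
          using linear_scale[OF has_derivative_linear[OF smooth_on_has_derivative[OF F]], of "(s, y)" r "(1, 0)"] s True
          by simp
      qed
      ultimately have "((\<lambda>s. F (s, y)) has_real_derivative dt F (s, y)) (at s within I)"
        by (simp only: has_field_derivative_def)
      then have "((\<lambda>s. h y * F (s, y)) has_real_derivative h y * dt F (s, y)) (at s within I)"
        by (rule DERIV_cmult)
      then show ?thesis using True by (simp add: has_real_derivative_iff_has_vector_derivative)
    qed simp
  next
    fix s assume "s \<in> I"
    then have "continuous_on (cbox a b) (\<lambda>y. if y \<in> U then h y * F (s, y) else 0)"
      using continuous_on_compose2[OF ext[OF F] cP[of "cbox a b" s]] by auto
    then show "(\<lambda>y. if y \<in> U then h y * F (s, y) else 0) integrable_on cbox a b"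
      by (rule integrable_continuous)
  next
    show "continuous_on (I \<times> cbox a b) (\<lambda>(s, y). if y \<in> U then h y * dt F (s, y) else 0)"
      by (rule continuous_on_subset[OF ext]) (auto intro: smooth_intros F)
    show "t \<in> I" by (rule t)
    show "convex I" using interval(1) by (simp add: is_interval_convex)
  qed
  then have "((\<lambda>s. integral (cbox a b) (\<lambda>y. if y \<in> U then h y * F (s, y) else 0)) has_real_derivative
     (\<integral>y. (if y \<in> U then h y * dt F (t, y) else 0) \<partial>lborel)) (at t within I)"
    using ints[OF smooth_dirD[OF F] t] by (simp add: has_real_derivative_iff_has_vector_derivative)
  then show ?thesis
    by (rule has_field_derivative_transform_within[where d=1]) (use ints[OF F] t in auto)
qed

section \<open>Partitions of unity of class C^1\<close>

lemma has_real_derivative_max_0_sq: "((\<lambda>x::real. (max 0 x)\<^sup>2) has_real_derivative 2 * max 0 x) (at x)"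
proof -
  consider "x > 0" | "x < 0" | "x = 0" by linarith
  then show ?thesis
  proof cases
    case 1
    have "((\<lambda>x::real. x\<^sup>2) has_real_derivative 2 * max 0 x) (at x)"
      using 1 by (auto intro!: derivative_eq_intros)
    then show ?thesis
      by (rule DERIV_cong_ev[THEN iffD1, rotated 3, OF _ refl _ refl])
         (use 1 in \<open>auto intro!: eventually_mono[OF eventually_nhds_in_open[of "{0<..}"]]\<close>)
  next
    case 2
    have "((\<lambda>x::real. 0) has_real_derivative 2 * max 0 x) (at x)"
      using 2 by (auto intro!: derivative_eq_intros)
    then show ?thesis
      by (rule DERIV_cong_ev[THEN iffD1, rotated 3, OF _ refl _ refl])
         (use 2 in \<open>auto intro!: eventually_mono[OF eventually_nhds_in_open[of "{..<0}"]]\<close>)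
  next
    case 3
    have "(\<lambda>h::real. (max 0 h)\<^sup>2 / h) \<midarrow>0\<rightarrow> 0"
    proof (rule tendsto_0_le[where K=1 and f="\<lambda>h. h"])
      show "(\<lambda>h::real. h) \<midarrow>0\<rightarrow> 0" by (rule tendsto_ident_at)
      show "\<forall>\<^sub>F h::real in at 0. norm ((max 0 h)\<^sup>2 / h) \<le> norm h * 1"
        by (rule always_eventually) (auto simp: max_def power2_eq_square)
    qed
    then show ?thesis using 3 by (simp add: DERIV_def)
  qed
qed

text \<open>The profile of the bump functions: squaring the positive part makes it continuously
  differentiable across 0.\<close>

lemma Ck_on_1_max_0_sq: "Ck_on 1 (\<lambda>x::real. (max 0 x)\<^sup>2) S"
  unfolding One_nat_def
  by (rule Ck_on_real_derivI[where f'="\<lambda>x. 2 * max 0 x"])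
     (auto intro!: has_field_derivative_at_within[OF has_real_derivative_max_0_sq] continuous_intros)

context closed_manifold
begin

lemma bump_function:
  "\<exists>b c K U. c \<in> \<A> \<and> compact K \<and> K \<subseteq> dom_of c \<and> open U \<and> p \<in> U \<and>
    (\<forall>q. (0::real) \<le> b q) \<and> (\<forall>q\<in>U. b q > 0) \<and> (\<forall>q. q \<notin> K \<longrightarrow> b q = 0) \<and>
    (\<forall>d\<in>\<A>. Ck_on 1 (b \<circ> inv_coord d) (range_of d))"
proof -
  obtain c where c: "c \<in> \<A>" "p \<in> dom_of c" using dom_cover by blast
  define y0 where "y0 = coord c p"
  obtain r where r: "r > 0" "cball y0 r \<subseteq> range_of c"
    using open_range[OF c(1)] c(2) unfolding y0_def open_contains_cball by blast
  define K where "K = inv_coord c ` cball y0 r"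
  define U where "U = {q \<in> dom_of c. coord c q \<in> ball y0 r}"
  \<comment> \<open>The squared distance is spelled out as a polynomial in the coordinates, so that
    its composition with a transition map is handled by sums and products.\<close>
  define w where "w y = r\<^sup>2 - (\<Sum>i\<in>UNIV. (y $ i - y0 $ i)\<^sup>2)" for y
  define b where "b q = (if q \<in> dom_of c then (max 0 (w (coord c q)))\<^sup>2 else 0)" for q
  have w: "w y = r\<^sup>2 - (dist y0 y)\<^sup>2" for y
    by (simp add: w_def dist_norm norm_vec_def L2_set_def sum_nonneg norm_minus_commute power2_commute)
  have K: "compact K" unfolding K_def
    by (rule compact_continuous_image[OF continuous_on_subset[OF continuous_inv_coord[OF c(1)] r(2)] compact_cball])
  have KD: "K \<subseteq> dom_of c" unfolding K_def using r(2) c(1) by auto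
  have oU: "open U"
    using continuous_open_preimage[OF continuous_coord[OF c(1)] open_dom[OF c(1)] open_ball[of y0 r]]
    by (simp add: U_def vimage_def Int_def)
  have bK: "b q = 0" if "q \<notin> K" for q
  proof (cases "q \<in> dom_of c")
    case True
    have "coord c q \<notin> cball y0 r"
      using that True c(1) unfolding K_def by (metis imageI inv_coord_coord)
    then have "r\<^sup>2 \<le> (dist y0 (coord c q))\<^sup>2" using r(1) by (intro power_mono) auto
    then show ?thesis by (simp add: b_def w)
  qed (simp add: b_def)
  have Ck: "Ck_on 1 (b \<circ> inv_coord d) (range_of d)" if d: "d \<in> \<A>" for d
  proof (rule Ck_on_local)
    fix y assume y: "y \<in> range_of d"
    show "\<exists>V. open V \<and> y \<in> V \<and> Ck_on 1 (b \<circ> inv_coord d) V"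
    proof (cases "y \<in> overlap d c")
      case True
      have comp: "Ck_on 1 (\<lambda>y. (coord c \<circ> inv_coord d) y $ i) (overlap d c)" for i
        using smooth_transition[OF d c(1)] Ck_on_bounded_linear_compose[OF bounded_linear_vec_nth]
        unfolding smooth_on_def by blast
      have "Ck_on 1 (\<lambda>y. (max 0 (w ((coord c \<circ> inv_coord d) y)))\<^sup>2) (overlap d c)"
        unfolding w_def power2_eq_square[of "_ - _"]
        by (rule Ck_on_compose_real[OF _ Ck_on_1_max_0_sq[of UNIV]])
           (intro Ck_on_diff Ck_on_sum Ck_on_mult Ck_on_const comp UNIV_I)+
      moreover have "(b \<circ> inv_coord d) z = (max 0 (w ((coord c \<circ> inv_coord d) z)))\<^sup>2" if "z \<in> overlap d c" for z
        using that d by (simp add: b_def overlap_iff)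
      ultimately have "Ck_on 1 (b \<circ> inv_coord d) (overlap d c)"
        by (subst Ck_on_cong) auto
      with True open_overlap[OF d c(1)] show ?thesis by blast
    next
      case False
      \<comment> \<open>A point outside the domain of \<open>c\<close> has a neighbourhood missing
        \<open>K\<close>, which is closed because M is Hausdorff; there the bump function is
        zero.\<close>
      define V where "V = range_of d \<inter> inv_coord d -` (- K)"
      have "open V" unfolding V_def
        by (rule continuous_open_preimage[OF continuous_inv_coord[OF d] open_range[OF d]])
           (simp add: open_Compl compact_imp_closed K)
      moreover have "y \<in> V" using False y KD d by (auto simp: V_def overlap_iff)
      moreover have "Ck_on 1 (b \<circ> inv_coord d) V"
        by (subst Ck_on_cong[of _ _ "\<lambda>_. 0"]) (auto simp: V_def bK Ck_on_const)
      ultimately show ?thesis by blast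
    qed
  qed
  have bp: "b q > 0" if "q \<in> U" for q
  proof -
    have "(dist y0 (coord c q))\<^sup>2 < r\<^sup>2" using that r(1) by (intro power_strict_mono) (auto simp: U_def)
    then show ?thesis using that by (simp add: b_def w U_def)
  qed
  have pU: "p \<in> U" using c r by (simp add: U_def y0_def)
  have bn: "b q \<ge> 0" for q by (simp add: b_def)
  show ?thesis
    by (intro exI[of _ b] exI[of _ c] exI[of _ K] exI[of _ U] conjI allI ballI impI c(1) K KD oU pU bn bp bK Ck)
qed

text \<open>The index set consists of points because a bump function is attached to each point.
  Chart, support and regularity are recorded for all indices, so only the sum refers to membership
  in \<open>N\<close>.\<close>

definition partition_of_unity ::
    "'m set \<Rightarrow> ('m \<Rightarrow> ('m, 'n) chart) \<Rightarrow> ('m \<Rightarrow> 'm set) \<Rightarrow> ('m \<Rightarrow> 'm \<Rightarrow> real) \<Rightarrow> bool" where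
  "partition_of_unity N cf Kf \<eta> \<longleftrightarrow> finite N \<and>
    (\<forall>p. cf p \<in> \<A> \<and> compact (Kf p) \<and> Kf p \<subseteq> dom_of (cf p) \<and> (\<forall>q. q \<notin> Kf p \<longrightarrow> \<eta> p q = 0)) \<and>
    (\<forall>q. (\<Sum>p\<in>N. \<eta> p q) = 1) \<and> (\<forall>p. \<forall>d\<in>\<A>. Ck_on 1 (\<eta> p \<circ> inv_coord d) (range_of d))"

lemma partition_of_unityD:
  assumes "partition_of_unity N cf Kf \<eta>"
  shows "finite N" "\<And>p. cf p \<in> \<A>" "\<And>p. compact (Kf p)" "\<And>p. Kf p \<subseteq> dom_of (cf p)"
    "\<And>p q. q \<notin> Kf p \<Longrightarrow> \<eta> p q = 0" "\<And>q. (\<Sum>p\<in>N. \<eta> p q) = 1"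
    "\<And>p d. d \<in> \<A> \<Longrightarrow> Ck_on 1 (\<eta> p \<circ> inv_coord d) (range_of d)"
  using assms unfolding partition_of_unity_def by blast+

text \<open>By compactness finitely many of the sets on which a bump function is positive cover M,
  so the sum of these functions is positive everywhere and can be divided by.\<close>

lemma partition_exists: "\<exists>N cf Kf \<eta>. partition_of_unity N cf Kf \<eta>"
proof -
  have "\<forall>p. \<exists>b c K U. c \<in> \<A> \<and> compact K \<and> K \<subseteq> dom_of c \<and> open U \<and> p \<in> U \<and>
    (\<forall>q. (0::real) \<le> b q) \<and> (\<forall>q\<in>U. b q > 0) \<and> (\<forall>q. q \<notin> K \<longrightarrow> b q = 0) \<and>
    (\<forall>d\<in>\<A>. Ck_on 1 (b \<circ> inv_coord d) (range_of d))"
    (is "\<forall>p. \<exists>b c K U. ?P p b c K U")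
    by (intro allI bump_function)
  then obtain b cf Kf Uf where P: "\<And>p. ?P p (b p) (cf p) (Kf p) (Uf p)" by metis
  have "UNIV \<subseteq> (\<Union>p\<in>UNIV. Uf p)" using P by blast
  then obtain N where N: "finite N" "UNIV \<subseteq> (\<Union>p\<in>N. Uf p)"
    using compactE_image[OF compact_M, of UNIV Uf] P by metis
  define s where "s q = (\<Sum>p\<in>N. b p q)" for q
  have s: "s q > 0" for q
  proof -
    obtain p where p: "p \<in> N" "q \<in> Uf p" using N(2) by blast
    then have "b p q > 0" using P by blast
    also have "b p q \<le> s q" unfolding s_def by (rule member_le_sum) (use p N P in auto)
    finally show ?thesis .
  qed
  define \<eta> where "\<eta> p q = b p q * inverse (s q)" for p q
  have "partition_of_unity N cf Kf \<eta>"
    unfolding partition_of_unity_def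
  proof (intro conjI allI ballI impI)
    show "finite N" by (rule N(1))
    show "cf p \<in> \<A>" "compact (Kf p)" "Kf p \<subseteq> dom_of (cf p)" for p using P by blast+
    show "\<eta> p q = 0" if "q \<notin> Kf p" for p q using P that by (simp add: \<eta>_def)
    show "(\<Sum>p\<in>N. \<eta> p q) = 1" for q
      using s[of q] by (simp add: \<eta>_def s_def flip: sum_distrib_right)
    show "Ck_on 1 (\<eta> p \<circ> inv_coord d) (range_of d)" if "d \<in> \<A>" for p d
    proof -
      have b: "Ck_on 1 (\<lambda>y. b p (inv_coord d y)) (range_of d)" for p
        using P that by (auto simp: comp_def)
      show ?thesis unfolding \<eta>_def comp_def
        by (intro Ck_on_mult b Ck_on_compose_real[OF _ Ck_on_inverse_pos])
           (use s in \<open>auto simp: s_def intro!: Ck_on_sum b[unfolded One_nat_def]\<close>)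
    qed
  qed
  then show ?thesis by blast
qed

end

context metric_manifold
begin

lemma g_sym: "c \<in> \<A> \<Longrightarrow> p \<in> dom_of c \<Longrightarrow> transpose (g c p) = g c p"
  using riem unfolding is_riemannian_metric_def is_symmetric_tensor_def by blast

lemma ginv_mult:
  assumes "c \<in> \<A>" "p \<in> dom_of c"
  shows "g c p ** ginv g c p = mat 1" "ginv g c p ** g c p = mat 1"
  using matrix_inv_mult[of "g c p"] det_g_pos[OF assms] unfolding ginv_def by auto

lemma ginv_sym: "c \<in> \<A> \<Longrightarrow> p \<in> dom_of c \<Longrightarrow> ginv g c p $ i $ j = ginv g c p $ j $ i"
proof -
  assume "c \<in> \<A>" "p \<in> dom_of c"
  then have "transpose (ginv g c p) = ginv g c p"
    using matrix_inv_symmetric[OF _ g_sym, of c p] det_g_pos[of c p] unfolding ginv_def by simp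
  from arg_cong[OF this, of "\<lambda>M. M $ j $ i"] show ?thesis by (simp add: transpose_def)
qed

text \<open>Inverting the transformation law of g: the transposed Jacobian has a right inverse,
  which is then also a left inverse and can be moved to the other side.\<close>

lemma ginv_transform:
  assumes "c \<in> \<A>" "d \<in> \<A>" "p \<in> dom_of c" "p \<in> dom_of d"
  shows "ginv g d p = transition_jacobian c d p ** ginv g c p ** transpose (transition_jacobian c d p)"
proof -
  let ?J = "transition_jacobian c d p" and ?c = "ginv g c p" and ?d = "ginv g d p"
  have "transpose ?J ** (g d p ** ?J ** ?c) = mat 1"
    using ginv_mult(1)[OF assms(1,3)] unfolding g_transform[OF assms] by (simp add: matrix_mul_assoc)
  then have "(g d p ** ?J ** ?c) ** transpose ?J = mat 1"
    using matrix_left_right_inverse by blast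
  then have "?d ** (g d p ** (?J ** ?c ** transpose ?J)) = ?d"
    by (simp add: matrix_mul_assoc)
  then show ?thesis
    by (simp add: matrix_mul_assoc ginv_mult(2)[OF assms(2,4)])
qed

text \<open>The inner product of two differentials, equal to that of the gradients; it involves
  first derivatives only, so its chart independence needs no connection.\<close>

definition ip :: "('m, 'n) chart \<Rightarrow> ('m \<Rightarrow> real) \<Rightarrow> ('m \<Rightarrow> real) \<Rightarrow> 'm \<Rightarrow> real" where
  "ip c f u p = (\<Sum>i\<in>UNIV. \<Sum>j\<in>UNIV. ginv g c p $ i $ j * pd c i f p * pd c j u p)"

lemma ip_chart:
  assumes cd: "c \<in> \<A>" "d \<in> \<A>" "p \<in> dom_of c" "p \<in> dom_of d"
    and f: "(f \<circ> inv_coord d) differentiable (at (coord d p))"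
    and u: "(u \<circ> inv_coord d) differentiable (at (coord d p))"
  shows "ip c f u p = ip d f u p"
proof -
  let ?J = "transition_jacobian c d p"
  define F where "F = (\<chi> k. pd d k f p)"
  define U where "U = (\<chi> k. pd d k u p)"
  have e: "(\<Sum>i\<in>UNIV. \<Sum>j\<in>UNIV. M $ i $ j * a $ i * b $ j) = a \<bullet> (M *v b)" for M :: "real ^ 'n ^ 'n" and a b
    by (simp add: inner_vec_def matrix_vector_mult_def sum_distrib_left mult_ac)
  have F: "(\<chi> i. pd c i f p) = transpose ?J *v F" and U: "(\<chi> i. pd c i u p) = transpose ?J *v U"
    unfolding F_def U_def
    by (simp_all add: vec_eq_iff matrix_vector_mult_def transpose_def pd_chart_change[OF cd f] pd_chart_change[OF cd u])
  have "ip c f u p = (transpose ?J *v F) \<bullet> (ginv g c p *v (transpose ?J *v U))"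
    unfolding F[symmetric] U[symmetric] e[symmetric] ip_def by simp
  also have "\<dots> = F \<bullet> (?J *v (ginv g c p *v (transpose ?J *v U)))"
  proof -
    have "(transpose ?J *v F) \<bullet> w = F \<bullet> (?J *v w)" for w
      by (simp add: dot_lmul_matrix transpose_matrix_vector)
    then show ?thesis .
  qed
  also have "\<dots> = F \<bullet> (ginv g d p *v U)"
    by (simp only: ginv_transform[OF cd] matrix_vector_mul_assoc matrix_mul_assoc)
  finally show ?thesis unfolding e[symmetric] by (simp add: ip_def F_def U_def)
qed

definition IP :: "('m \<Rightarrow> real) \<Rightarrow> ('m \<Rightarrow> real) \<Rightarrow> 'm \<Rightarrow> real" where
  "IP f u = on_M \<A> (\<lambda>c. ip c f u)"

end

context closed_manifold
begin

definition C1 :: "('m \<Rightarrow> real) \<Rightarrow> bool" where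
  "C1 f \<longleftrightarrow> (\<forall>c\<in>\<A>. Ck_on 1 (f \<circ> inv_coord c) (range_of c))"

lemma C1_derivative:
  assumes "C1 f" "c \<in> \<A>" "y \<in> range_of c"
  shows "((f \<circ> inv_coord c) has_derivative frechet_derivative (f \<circ> inv_coord c) (at y)) (at y)"
  using Ck_on_1D(1)[OF _ open_range] assms unfolding C1_def by blast

lemma C1_differentiable: "C1 f \<Longrightarrow> c \<in> \<A> \<Longrightarrow> p \<in> dom_of c \<Longrightarrow> (f \<circ> inv_coord c) differentiable (at (coord c p))"
  using C1_derivative[of f c "coord c p"] differentiableI by blast

lemma pd_inv_coord: "c \<in> \<A> \<Longrightarrow> y \<in> range_of c \<Longrightarrow> pd c i f (inv_coord c y) = frechet_derivative (f \<circ> inv_coord c) (at y) (axis i 1)"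
  by (simp add: pd_def)

lemma C1_pd_continuous: "C1 f \<Longrightarrow> c \<in> \<A> \<Longrightarrow> continuous_on (range_of c) (\<lambda>y. pd c i f (inv_coord c y))"
  using Ck_on_1D(2)[OF _ open_range, where f="f \<circ> inv_coord c" and v="axis i 1"] unfolding C1_def
  by (subst continuous_on_cong[OF refl pd_inv_coord]) auto

lemma C1_continuous: "C1 f \<Longrightarrow> continuous_on UNIV f"
  unfolding C1_def by (rule continuous_from_charts) (blast intro: Ck_on_imp_continuous_on)

lemma C1_mult: "C1 f \<Longrightarrow> C1 u \<Longrightarrow> C1 (\<lambda>p. f p * u p)"
  unfolding C1_def comp_def by (auto intro: Ck_on_mult simp del: One_nat_def)

lemma pd_zero_outside:
  assumes "c \<in> \<A>" "p \<in> dom_of c" "closed K" "p \<notin> K" "\<And>q. q \<notin> K \<Longrightarrow> f q = 0"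
  shows "pd c i f p = 0"
proof -
  have "((\<lambda>y. 0) has_derivative (\<lambda>v. 0)) (at (coord c p))" by simp
  then have "((f \<circ> inv_coord c) has_derivative (\<lambda>v. 0)) (at (coord c p))"
  proof (rule has_derivative_transform_within_open)
    show "open (range_of c \<inter> inv_coord c -` (- K))"
      by (rule continuous_open_preimage[OF continuous_inv_coord open_range]) (use assms in auto)
    show "coord c p \<in> range_of c \<inter> inv_coord c -` (- K)" using assms by auto
  qed (use assms(5) in auto)
  from pd_eqI[OF this] show ?thesis by simp
qed

lemma pd_sum:
  assumes "finite N" "\<And>p. p \<in> N \<Longrightarrow> C1 (f p)" "c \<in> \<A>" "q \<in> dom_of c"
  shows "pd c i (\<lambda>q. \<Sum>p\<in>N. f p q) q = (\<Sum>p\<in>N. pd c i (f p) q)"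
proof -
  have "((\<lambda>y. \<Sum>p\<in>N. (f p \<circ> inv_coord c) y) has_derivative
      (\<lambda>v. \<Sum>p\<in>N. frechet_derivative (f p \<circ> inv_coord c) (at (coord c q)) v)) (at (coord c q))"
    by (rule has_derivative_sum) (use C1_derivative[OF assms(2) assms(3), of _ "coord c q"] assms(4) in blast)
  then show ?thesis by (subst pd_eqI[where D="\<lambda>v. \<Sum>p\<in>N. frechet_derivative (f p \<circ> inv_coord c) (at (coord c q)) v"])
      (auto simp: comp_def pd_def)
qed

end

context metric_manifold
begin

lemma IP_eq: "C1 f \<Longrightarrow> C1 u \<Longrightarrow> c \<in> \<A> \<Longrightarrow> p \<in> dom_of c \<Longrightarrow> IP f u p = ip c f u p"
  unfolding IP_def by (rule on_M_eq) (auto intro: ip_chart C1_differentiable)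

lemma ginv_continuous:
  assumes "c \<in> \<A>"
  shows "continuous_on (range_of c) (\<lambda>y. ginv g c (inv_coord c y) $ i $ j)"
proof -
  have d: "continuous_on (range_of c) (\<lambda>y. det (g c (inv_coord c y)))"
    unfolding det_def by (intro continuous_intros g_cont assms)
  have nz: "det (g c (inv_coord c y)) \<noteq> 0" if "y \<in> range_of c" for y
    using det_g_pos[OF assms, of "inv_coord c y"] that assms by simp
  have "continuous_on (range_of c) (\<lambda>y. det (\<chi> a b. if b = i then (if a = j then 1 else 0) else g c (inv_coord c y) $ a $ b) *
      inverse (det (g c (inv_coord c y))))"
  proof (intro continuous_intros d ballI nz)
    show "continuous_on (range_of c) (\<lambda>y. det (\<chi> a b. if b = i then (if a = j then 1 else 0) else g c (inv_coord c y) $ a $ b))"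
    proof -
      have "continuous_on (range_of c) (\<lambda>y. (\<chi> a b. if b = i then (if a = j then 1 else 0) else g c (inv_coord c y) $ a $ b) $ k $ l)" for k l
        by (cases "l = i") (auto intro: g_cont[OF assms])
      then show ?thesis
        unfolding det_def by (intro continuous_on_sum continuous_on_mult continuous_on_prod continuous_on_const)
    qed
  qed
  then show ?thesis
    by (rule continuous_on_cong[THEN iffD1, rotated 2]) (auto simp: ginv_def matrix_inv_cramer[OF nz])
qed

lemma IP_continuous:
  assumes "C1 f" "C1 u"
  shows "continuous_on UNIV (IP f u)"
proof (rule continuous_from_charts)
  fix c assume c: "c \<in> \<A>"
  have "continuous_on (range_of c) (\<lambda>y. ip c f u (inv_coord c y))"
    unfolding ip_def by (intro continuous_intros ginv_continuous C1_pd_continuous assms c)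
  then show "continuous_on (range_of c) (IP f u \<circ> inv_coord c)"
    by (rule continuous_on_cong[THEN iffD1, rotated 2]) (use IP_eq[OF assms c] c in auto)
qed

lemma integrable_compact_chart:
  assumes c: "c \<in> \<A>" and K: "compact K" "K \<subseteq> dom_of c" and f: "continuous_on UNIV f" "\<And>p. p \<notin> K \<Longrightarrow> f p = (0::real)"
  shows "integrable RV f"
proof -
  have cK: "continuous_on K (coord c)" using continuous_coord[OF c] K(2) continuous_on_subset by blast
  have "compact (coord c ` K)" using compact_continuous_image[OF cK K(1)] .
  moreover have "continuous_on (coord c ` K) (\<lambda>y. vol c y * f (inv_coord c y))"
  proof (rule continuous_on_subset)
    show "continuous_on (range_of c) (\<lambda>y. vol c y * f (inv_coord c y))"
      by (intro continuous_intros continuous_vol c continuous_on_compose2[OF f(1) continuous_inv_coord[OF c]]) auto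
  qed (use K in auto)
  ultimately have "integrable lborel (\<lambda>y. indicator (coord c ` K) y *\<^sub>R (vol c y * f (inv_coord c y)))"
    by (rule borel_integrable_compact)
  moreover have "indicator (coord c ` K) y *\<^sub>R (vol c y * f (inv_coord c y)) = vol c y * f (icoord c y)" for y
  proof (cases "y \<in> range_of c")
    case True
    then have "y \<in> coord c ` K \<longleftrightarrow> inv_coord c y \<in> K"
      using coord_image_eq[OF c K(2)] by (simp add: icoord_def)
    then show ?thesis using True f(2) by (auto simp: icoord_def indicator_def)
  next
    case False
    then show ?thesis using K(2) by (auto simp: vol_def indicator_def)
  qed
  ultimately have "integrable lborel (\<lambda>y. vol c y * f (icoord c y))" by (simp only:)
  then show ?thesis
    by (subst integrable_RV_chart[OF c])
       (use f K in \<open>auto intro: borel_measurable_continuous_onI\<close>)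
qed

lemma integrable_continuous_RV:
  fixes f :: "'m \<Rightarrow> real"
  assumes "continuous_on UNIV f"
  shows "integrable RV f"
proof -
  obtain N cf Kf \<eta> where "partition_of_unity N cf Kf \<eta>" using partition_exists by blast
  note P = partition_of_unityD[OF this]
  have "integrable RV (\<lambda>q. \<Sum>p\<in>N. \<eta> p q * f q)"
  proof (rule Bochner_Integration.integrable_sum)
    fix p assume "p \<in> N"
    have "C1 (\<eta> p)" using P(7) by (simp add: C1_def)
    then show "integrable RV (\<lambda>q. \<eta> p q * f q)"
      by (intro integrable_compact_chart[OF P(2)[of p] P(3)[of p] P(4)[of p]] continuous_intros assms C1_continuous) (simp_all add: P(5))
  qed
  then show ?thesis by (simp add: P(6) flip: sum_distrib_right)
qed

text \<open>\<open>L\<close> plays the role of \<Delta>f and \<open>Y c\<close> that of the volume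
  density times \<nabla>f, so \<open>div\<close> is the divergence form of the Laplacian. A
  partition of unity splits h into summands, each giving the Euclidean divergence of a compactly
  supported field.\<close>

lemma green:
  assumes f: "C1 f" and h: "C1 h" and L: "continuous_on UNIV L"
    and Y: "\<And>c i. c \<in> \<A> \<Longrightarrow> Ck_on 1 (Y c i) (range_of c)"
    and Y_eq: "\<And>c i y. c \<in> \<A> \<Longrightarrow> y \<in> range_of c \<Longrightarrow>
      Y c i y = vol c y * (\<Sum>j\<in>UNIV. ginv g c (inv_coord c y) $ i $ j * pd c j f (inv_coord c y))"
    and div: "\<And>c y. c \<in> \<A> \<Longrightarrow> y \<in> range_of c \<Longrightarrow>
      (\<Sum>i\<in>UNIV. frechet_derivative (Y c i) (at y) (axis i 1)) = vol c y * L (inv_coord c y)"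
  shows "(\<integral>p. (h p * L p + IP f h p) \<partial>RV) = 0"
proof -
  obtain N cf Kf \<eta> where "partition_of_unity N cf Kf \<eta>" using partition_exists by blast
  note P = partition_of_unityD[OF this]
  define hp where "hp p q = \<eta> p q * h q" for p q
  have C: "C1 (hp p)" for p
    unfolding hp_def using P(7) by (intro C1_mult h) (simp add: C1_def)
  define u where "u p q = hp p q * L q + IP f (hp p) q" for p q
  have ucont: "continuous_on UNIV (u p)" for p
    unfolding u_def by (intro continuous_intros C1_continuous C L IP_continuous f)
  have u0: "u p q = 0" if "q \<notin> Kf p" for p q
  proof -
    have "pd (chart_at \<A> q) j (hp p) q = 0" for j
      by (rule pd_zero_outside[OF chart_at compact_imp_closed[OF P(3)] that]) (simp add: hp_def P(5))
    then show ?thesis using that by (simp add: u_def hp_def P(5) IP_def on_M_def ip_def)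
  qed
  have zero: "integral\<^sup>L RV (u p) = 0" for p
  proof -
    define c where "c = cf p"
    have c: "c \<in> \<A>" and KD: "Kf p \<subseteq> dom_of c" using P by (auto simp: c_def)
    \<comment> \<open>The product rule for this field produces both terms of \<open>u p\<close>,
      each times the volume density.\<close>
    define X where "X i y = hp p (inv_coord c y) * Y c i y" for i y
    have hC: "Ck_on 1 (hp p \<circ> inv_coord c) (range_of c)" using C c by (simp add: C1_def)
    have "integral\<^sup>L RV (u p) = (\<integral>y. vol c y * u p (icoord c y) \<partial>lborel)"
      by (rule integral_RV_chart[OF c borel_measurable_continuous_onI[OF ucont]]) (use KD u0 in blast)
    also have "\<dots> = (\<integral>y. (if y \<in> range_of c then \<Sum>i\<in>UNIV. frechet_derivative (X i) (at y) (axis i 1) else 0) \<partial>lborel)"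
    proof (rule Bochner_Integration.integral_cong[OF refl])
      fix y
      show "vol c y * u p (icoord c y) = (if y \<in> range_of c then \<Sum>i\<in>UNIV. frechet_derivative (X i) (at y) (axis i 1) else 0)"
      proof (cases "y \<in> range_of c")
        case True
        define q where "q = inv_coord c y"
        have q: "q \<in> dom_of c" using True c by (simp add: q_def)
        have "frechet_derivative (X i) (at y) (axis i 1) =
            hp p q * frechet_derivative (Y c i) (at y) (axis i 1) + pd c i (hp p) q * Y c i y" for i
        proof -
          have "(X i has_derivative (\<lambda>v. (hp p \<circ> inv_coord c) y * frechet_derivative (Y c i) (at y) v
              + frechet_derivative (hp p \<circ> inv_coord c) (at y) v * Y c i y)) (at y)"
            unfolding X_def
            using has_derivative_mult[OF C1_derivative[OF C c True] Ck_on_1D(1)[OF Y[OF c] open_range[OF c] True]]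
            by simp
          from frechet_derivative_at[OF this, symmetric] show ?thesis
            using pd_inv_coord[OF c True] by (simp add: q_def)
        qed
        then have "(\<Sum>i\<in>UNIV. frechet_derivative (X i) (at y) (axis i 1)) =
            hp p q * (vol c y * L q) + (\<Sum>i\<in>UNIV. pd c i (hp p) q * Y c i y)"
          by (simp add: sum.distrib div[OF c True, folded q_def] flip: sum_distrib_left)
        also have "(\<Sum>i\<in>UNIV. pd c i (hp p) q * Y c i y) = vol c y * ip c f (hp p) q"
          unfolding Y_eq[OF c True] ip_def q_def[symmetric] sum_distrib_left
          by (subst sum.swap) (simp add: ginv_sym[OF c q] mult_ac)
        finally show ?thesis
          using True by (simp add: u_def icoord_def q_def[symmetric] IP_eq[OF f C c q] algebra_simps)
      qed (simp add: vol_def)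
    qed
    also have "\<dots> = 0"
    proof (rule integral_divergence_zero[OF open_range[OF c], of "coord c ` Kf p"])
      show "compact (coord c ` Kf p)"
        using compact_continuous_image[OF continuous_on_subset[OF continuous_coord[OF c] KD] P(3)] .
      show "coord c ` Kf p \<subseteq> range_of c" using KD by auto
      show "Ck_on 1 (X i) (range_of c)" for i
        unfolding X_def using hC by (intro Ck_on_mult Y c) (simp add: comp_def)
      show "X i y = 0" if "y \<in> range_of c - coord c ` Kf p" for i y
      proof -
        have "inv_coord c y \<notin> Kf p" using that c by (metis DiffD1 DiffD2 coord_inv_coord image_eqI)
        then show ?thesis by (simp add: X_def hp_def P(5))
      qed
    qed
    finally show ?thesis .
  qed
  have "(\<integral>p. (h p * L p + IP f h p) \<partial>RV) = (\<integral>q. (\<Sum>p\<in>N. u p q) \<partial>RV)"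
  proof (rule Bochner_Integration.integral_cong[OF refl])
    fix q
    have hs: "(\<Sum>p\<in>N. hp p q) = h q" for q
      unfolding hp_def by (simp add: P(6) flip: sum_distrib_right)
    have "pd (chart_at \<A> q) j h q = (\<Sum>p\<in>N. pd (chart_at \<A> q) j (hp p) q)" for j
    proof -
      have "pd (chart_at \<A> q) j (\<lambda>q. \<Sum>p\<in>N. hp p q) q = (\<Sum>p\<in>N. pd (chart_at \<A> q) j (hp p) q)"
        by (rule pd_sum[OF P(1) C chart_at])
      then show ?thesis by (simp only: hs)
    qed
    then have "(\<Sum>p\<in>N. IP f (hp p) q) = IP f h q"
      unfolding IP_def on_M_def ip_def
      by (simp add: sum_distrib_left) (subst sum.swap, intro sum.cong refl, rule sum.swap)
    then show "h q * L q + IP f h q = (\<Sum>p\<in>N. u p q)"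
      unfolding u_def by (simp add: sum.distrib hs flip: sum_distrib_right)
  qed
  also have "\<dots> = (\<Sum>p\<in>N. integral\<^sup>L RV (u p))"
    by (rule Bochner_Integration.integral_sum) (rule integrable_continuous_RV[OF ucont])
  finally show ?thesis using zero by simp
qed

end

subsection \<open>Coordinate expressions along a geometric flow\<close>

context slab
begin

lemma at_I_nontrivial: "t \<in> I \<Longrightarrow> at t within I \<noteq> bot"
proof -
  assume "t \<in> I"
  then obtain e h where eh: "e = 1 \<or> e = -1" "0 < h" "\<And>s. s \<in> {0..h} \<Longrightarrow> t + s * e \<in> I"
    using I_room by blast
  have "\<exists>x'\<in>I. x' \<noteq> t \<and> dist x' t < d" if "d > 0" for d
    using eh(1,2) that eh(3)[of "min h (d/2)"]
    by (intro bexI[of _ "t + min h (d/2) * e"]) (auto simp: dist_real_def abs_mult)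
  then show ?thesis by (simp add: trivial_limit_within islimpt_approachable)
qed

lemma dt_has_derivative:
  assumes F: "smooth F" and t: "t \<in> I" "y \<in> U"
  shows "((\<lambda>s. F (s, y)) has_real_derivative dt F (t, y)) (at t within I)"
proof -
  have "((\<lambda>s. F (s, y)) has_derivative (\<lambda>r. dirD Q (r, 0) F (t, y))) (at t within I)"
    by (rule has_derivative_in_compose2[OF smooth_on_has_derivative[OF F], where f="\<lambda>s. (s, y)"])
       (use t in \<open>auto intro!: derivative_eq_intros\<close>)
  moreover have "(\<lambda>r. dirD Q (r, 0) F (t, y)) = (*) (dt F (t, y))"
  proof
    show "dirD Q (r, 0) F (t, y) = dt F (t, y) * r" for r
      using linear_scale[OF has_derivative_linear[OF smooth_on_has_derivative[OF F]], of "(t, y)" r "(1, 0)"] t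
      by simp
  qed
  ultimately show ?thesis by (simp only: has_field_derivative_def)
qed

lemma dt_eqI:
  assumes "smooth F" "t \<in> I" "y \<in> U" "((\<lambda>s. F (s, y)) has_real_derivative D) (at t within I)"
  shows "dt F (t, y) = D"
  using dt_has_derivative[OF assms(1-3)] assms(4) at_I_nontrivial[OF assms(2)]
  unfolding has_real_derivative_iff_has_vector_derivative by (rule vector_derivative_unique_within[rotated])

lemma slice_has_derivative:
  assumes F: "smooth F" and t: "t \<in> I" "y \<in> U"
  shows "((\<lambda>y. F (t, y)) has_derivative (\<lambda>v. dirD Q (0, v) F (t, y))) (at y)"
proof -
  have "((\<lambda>y. F (t, y)) has_derivative (\<lambda>v. dirD Q (0, v) F (t, y))) (at y within U)"
    by (rule has_derivative_in_compose2[OF smooth_on_has_derivative[OF F], where f="\<lambda>y. (t, y)"])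
       (use t in \<open>auto intro!: derivative_eq_intros\<close>)
  then show ?thesis using at_within_open[OF t(2) open_U] by simp
qed

lemma slice_Ck_on:
  assumes "smooth F" "t \<in> I"
  shows "Ck_on k (\<lambda>y. F (t, y)) U"
proof -
  have "Ck_on k (\<lambda>y. F ((t, 0) + (0, y))) U"
    by (rule Ck_on_affine_precompose[where S=Q and L="\<lambda>y. (0, y)"])
       (use assms in \<open>auto simp: smooth_on_def intro!: bounded_linear_Pair bounded_linear_zero bounded_linear_ident\<close>)
  then show ?thesis by simp
qed

end

locale flow_manifold = closed_manifold \<A>
  for \<A> :: "('m::t2_space, 'n::finite) chart set" +
  fixes I :: "real set" and g \<alpha> :: "real \<Rightarrow> ('m, 'n) tensor2"
  assumes interval: "is_interval I" "interior I \<noteq> {}"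
    and abstract_flow: "abstract_geometric_flow \<A> I g \<alpha>"
begin

lemma metric_manifold: "t \<in> I \<Longrightarrow> metric_manifold \<A> (g t)"
proof unfold_locales
  assume t: "t \<in> I"
  show "is_riemannian_metric \<A> (g t)" using abstract_flow t unfolding abstract_geometric_flow_def by blast
  fix c i j assume c: "c \<in> \<A>"
  have "smooth_on (\<lambda>(t, y). g t c (inv_coord c y)) (I \<times> range_of c)"
    using abstract_flow c unfolding abstract_geometric_flow_def smooth_symmetric_tensor_def by blast
  moreover have "continuous_on (range_of c) (\<lambda>y. (t, y))" by (intro continuous_intros)
  ultimately have "continuous_on (range_of c) (\<lambda>y. case (t, y) of (t, y) \<Rightarrow> g t c (inv_coord c y))"
    by (rule continuous_on_compose2[OF smooth_on_imp_continuous_on]) (use t in auto)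
  then have "continuous_on (range_of c) (\<lambda>y. g t c (inv_coord c y))" by simp
  then show "continuous_on (range_of c) (\<lambda>y. g t c (inv_coord c y) $ i $ j)" by (intro continuous_intros)
qed

definition Gc :: "('m, 'n) chart \<Rightarrow> 'n \<Rightarrow> 'n \<Rightarrow> real \<times> (real ^ 'n) \<Rightarrow> real" where
  "Gc c i j x = g (fst x) c (inv_coord c (snd x)) $ i $ j"
definition Gic :: "('m, 'n) chart \<Rightarrow> 'n \<Rightarrow> 'n \<Rightarrow> real \<times> (real ^ 'n) \<Rightarrow> real" where
  "Gic c i j x = ginv (g (fst x)) c (inv_coord c (snd x)) $ i $ j"
definition rhoc :: "('m, 'n) chart \<Rightarrow> real \<times> (real ^ 'n) \<Rightarrow> real" where
  "rhoc c x = sqrt (det (g (fst x) c (inv_coord c (snd x))))"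
definition alc :: "('m, 'n) chart \<Rightarrow> 'n \<Rightarrow> 'n \<Rightarrow> real \<times> (real ^ 'n) \<Rightarrow> real" where
  "alc c i j x = \<alpha> (fst x) c (inv_coord c (snd x)) $ i $ j"

lemma smooth_components:
  fixes S :: "real \<Rightarrow> ('m, 'n) tensor2"
  assumes "smooth_symmetric_tensor \<A> I S" "c \<in> \<A>"
  shows "smooth_on (\<lambda>x. S (fst x) c (inv_coord c (snd x)) $ i $ j) (I \<times> range_of c)"
proof -
  have "smooth_on (\<lambda>(t, y). S t c (inv_coord c y)) (I \<times> range_of c)"
    using assms unfolding smooth_symmetric_tensor_def by blast
  from smooth_on_bounded_linear_compose[OF bounded_linear_vec_nth smooth_on_bounded_linear_compose[OF bounded_linear_vec_nth this]]
  show ?thesis by (simp add: case_prod_beta)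
qed

text \<open>\<open>U\<close> may be smaller than the range because two charts are compared on their
  overlap. Cramer's rule gives the smoothness of the inverse, and Jacobi's formula the derivative of
  the density in every direction.\<close>

lemma geom_flow_chart:
  assumes c: "c \<in> \<A>" and U: "open U" "U \<subseteq> range_of c"
  shows "geom_flow I U (Gc c) (Gic c) (rhoc c) (alc c)"
proof -
  interpret slab I U by unfold_locales (use interval U in auto)
  have F: "smooth_symmetric_tensor \<A> I g" "smooth_symmetric_tensor \<A> I \<alpha>"
    and F3: "\<And>p t. p \<in> dom_of c \<Longrightarrow> t \<in> I \<Longrightarrow> ((\<lambda>s. g s c p) has_vector_derivative (-2) *\<^sub>R \<alpha> t c p) (at t within I)"
    using abstract_flow c unfolding abstract_geometric_flow_def by blast+
  have sub: "I \<times> U \<subseteq> I \<times> range_of c" using U by auto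
  have sG: "smooth (Gc c i j)" and sal: "smooth (alc c i j)" for i j
    unfolding Gc_def alc_def
    using smooth_components[OF F(1) c] smooth_components[OF F(2) c] smooth_on_subset[OF _ sub] by blast+
  define M where "M x = g (fst x) c (inv_coord c (snd x))" for x :: "real \<times> (real ^ 'n)"
  have G_M: "Gc c i j x = M x $ i $ j" for i j x by (simp add: Gc_def M_def)
  have sM: "smooth (\<lambda>x. M x $ i $ j)" for i j using sG[of i j] unfolding Gc_def M_def .
  have dM: "det (M x) > 0" if "x \<in> Q" for x
    using metric_manifold.det_g_pos[OF metric_manifold, of "fst x" c "inv_coord c (snd x)"] that U c by (auto simp: M_def)
  have Gi_M: "Gic c i j x = matrix_inv (M x) $ i $ j" for i j x by (simp add: Gic_def M_def ginv_def)
  have pt: "fst x \<in> I" "snd x \<in> range_of c" "inv_coord c (snd x) \<in> dom_of c" if "x \<in> Q" for x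
    using that U c by auto
  have symGi: "Gic c i j x = Gic c j i x" if "x \<in> Q" for i j x
    unfolding Gic_def by (rule metric_manifold.ginv_sym[OF metric_manifold c]) (use pt[OF that] in auto)
  show ?thesis
  proof unfold_locales
    show "smooth (Gc c i j)" for i j by (rule sG)
    show "smooth (alc c i j)" for i j by (rule sal)
    show "smooth (Gic c i j)" for i j
      unfolding Gi_M by (rule smooth_on_matrix_inv[OF sM dM])
    show "smooth (rhoc c)"
      unfolding rhoc_def M_def[symmetric] by (intro smooth_on_sqrt smooth_on_det sM dM)
    show "Gc c i j x = Gc c j i x" if "x \<in> Q" for i j x
      using arg_cong[OF metric_manifold.g_sym[OF metric_manifold c, of "fst x" "inv_coord c (snd x)"], of "\<lambda>A. A $ j $ i"] pt[OF that]
      by (simp add: Gc_def transpose_def)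
    show "Gic c i j x = Gic c j i x" if "x \<in> Q" for i j x by (rule symGi[OF that])
    show "alc c i j x = alc c j i x" if "x \<in> Q" for i j x
    proof -
      have "is_symmetric_tensor \<A> (\<alpha> (fst x))" using F(2) pt[OF that] unfolding smooth_symmetric_tensor_def by blast
      then have "transpose (\<alpha> (fst x) c (inv_coord c (snd x))) = \<alpha> (fst x) c (inv_coord c (snd x))"
        using pt[OF that] c unfolding is_symmetric_tensor_def by blast
      from arg_cong[OF this, of "\<lambda>A. A $ j $ i"] show ?thesis by (simp add: alc_def transpose_def)
    qed
    show "(\<Sum>k\<in>UNIV. Gic c i k x * Gc c k j x) = (if i = j then 1 else 0)" if "x \<in> Q" for i j x
      using arg_cong[OF matrix_inv_mult(2), of "M x" "\<lambda>A. A $ i $ j"] dM[OF that]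
      by (simp add: Gi_M G_M matrix_matrix_mult_def mat_def)
    show "rhoc c x > 0" if "x \<in> Q" for x
      unfolding rhoc_def M_def[symmetric] using dM[OF that] by simp
    show "dirD Q v (rhoc c) x = 1/2 * rhoc c x * (\<Sum>i\<in>UNIV. \<Sum>j\<in>UNIV. Gic c i j x * dirD Q v (Gc c i j) x)" if "x \<in> Q" for v x
    proof -
      have "dirD Q v (\<lambda>x. det (M x)) x = det (M x) * (\<Sum>i\<in>UNIV. \<Sum>j\<in>UNIV. matrix_inv (M x) $ j $ i * dirD Q v (\<lambda>x. M x $ i $ j) x)"
        by (rule dirD_eqI[OF ample_Q that has_derivative_det[where M'="\<lambda>i j v. dirD Q v (\<lambda>x. M x $ i $ j) x"]])
           (use dM[OF that] in \<open>auto intro!: smooth_on_has_derivative sM that\<close>)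
      also have "(\<Sum>i\<in>UNIV. \<Sum>j\<in>UNIV. matrix_inv (M x) $ j $ i * dirD Q v (\<lambda>x. M x $ i $ j) x)
        = (\<Sum>i\<in>UNIV. \<Sum>j\<in>UNIV. Gic c i j x * dirD Q v (Gc c i j) x)"
      proof (intro sum.cong refl)
        fix i j
        have "(\<lambda>x. M x $ i $ j) = Gc c i j" by (simp add: G_M fun_eq_iff)
        then show "matrix_inv (M x) $ j $ i * dirD Q v (\<lambda>x. M x $ i $ j) x = Gic c i j x * dirD Q v (Gc c i j) x"
          using symGi[OF that, of i j] Gi_M[of j i x] by simp
      qed
      finally have d: "dirD Q v (\<lambda>x. det (M x)) x = det (M x) * (\<Sum>i\<in>UNIV. \<Sum>j\<in>UNIV. Gic c i j x * dirD Q v (Gc c i j) x)" .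
      have "dirD Q v (\<lambda>x. sqrt (det (M x))) x = inverse (sqrt (det (M x))) / 2 * dirD Q v (\<lambda>x. det (M x)) x"
        by (rule dirD_compose_real[OF ample_Q that smooth_on_det[OF sM]]) (use DERIV_real_sqrt[OF dM[OF that]] in simp)
      also have "\<dots> = 1/2 * sqrt (det (M x)) * (\<Sum>i\<in>UNIV. \<Sum>j\<in>UNIV. Gic c i j x * dirD Q v (Gc c i j) x)"
      proof -
        have "inverse r / 2 * (r * r * X) = 1/2 * r * X" if "r > 0" for r X :: real
          using that by (simp add: field_simps)
        from this[of "sqrt (det (M x))"] show ?thesis unfolding d using dM[OF that] by simp
      qed
      finally show ?thesis unfolding rhoc_def M_def[symmetric] .
    qed
    show "dt (Gc c i j) x = - 2 * alc c i j x" if "x \<in> Q" for i j x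
    proof -
      have "((\<lambda>s. g s c (inv_coord c (snd x))) has_vector_derivative (-2) *\<^sub>R \<alpha> (fst x) c (inv_coord c (snd x))) (at (fst x) within I)"
        by (rule F3) (use pt[OF that] in auto)
      from bounded_linear.has_vector_derivative[OF bounded_linear_vec_nth bounded_linear.has_vector_derivative[OF bounded_linear_vec_nth this], of i j]
      have "((\<lambda>s. Gc c i j (s, snd x)) has_real_derivative - 2 * alc c i j x) (at (fst x) within I)"
        by (simp add: Gc_def alc_def has_real_derivative_iff_has_vector_derivative)
      from dt_eqI[OF sG _ _ this] that show ?thesis by auto
    qed
  qed
qed

text \<open>\<Phi> is a coordinate expression of F over \<open>U\<close>. Outside this piece of the
  chart F may be meaningless, so Christoffel symbols, metric components and coordinate functions are
  covered as well.\<close>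

definition rep :: "('m, 'n) chart \<Rightarrow> (real ^ 'n) set \<Rightarrow> (real \<Rightarrow> 'm \<Rightarrow> real) \<Rightarrow> (real \<times> (real ^ 'n) \<Rightarrow> real) \<Rightarrow> bool" where
  "rep c U F \<Phi> \<longleftrightarrow> smooth_on \<Phi> (I \<times> U) \<and> (\<forall>t\<in>I. \<forall>y\<in>U. F t (inv_coord c y) = \<Phi> (t, y))"

context
  fixes c :: "('m, 'n) chart" and U :: "(real ^ 'n) set"
  assumes c: "c \<in> \<A>" and U: "open U" "U \<subseteq> range_of c"
begin

interpretation geom_flow I U "Gc c" "Gic c" "rhoc c" "alc c"
  by (rule geom_flow_chart[OF c U])

lemma rep_has_derivative:
  assumes "rep c U F \<Phi>" "t \<in> I" "p \<in> dom_of c" "coord c p \<in> U"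
  shows "((F t \<circ> inv_coord c) has_derivative (\<lambda>v. dirD (I \<times> U) (0, v) \<Phi> (t, coord c p))) (at (coord c p))"
  by (rule has_derivative_transform_within_open[OF slice_has_derivative U(1)])
     (use assms in \<open>auto simp: rep_def\<close>)

lemma rep_pd:
  assumes "rep c U F \<Phi>" "t \<in> I" "p \<in> dom_of c" "coord c p \<in> U"
  shows "pd c i (F t) p = dx i \<Phi> (t, coord c p)"
  using pd_eqI[OF rep_has_derivative[OF assms]] .

lemma rep_I: "smooth \<Phi> \<Longrightarrow> (\<And>t p. t \<in> I \<Longrightarrow> p \<in> dom_of c \<Longrightarrow> coord c p \<in> U \<Longrightarrow> F t p = \<Phi> (t, coord c p)) \<Longrightarrow> rep c U F \<Phi>"
  unfolding rep_def using c U by (auto simp: subset_iff)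

lemma rep_D: "rep c U F \<Phi> \<Longrightarrow> t \<in> I \<Longrightarrow> p \<in> dom_of c \<Longrightarrow> coord c p \<in> U \<Longrightarrow> F t p = \<Phi> (t, coord c p)"
  unfolding rep_def using c by (metis inv_coord_coord)

lemma rep_smooth: "rep c U F \<Phi> \<Longrightarrow> smooth \<Phi>" by (simp add: rep_def)

context
  fixes t :: real and p :: 'm
  assumes t: "t \<in> I" and p: "p \<in> dom_of c" "coord c p \<in> U"
begin

lemma Gc_at: "g t c p $ i $ j = Gc c i j (t, coord c p)"
  and Gic_at: "ginv (g t) c p $ i $ j = Gic c i j (t, coord c p)"
  and alc_at: "\<alpha> t c p $ i $ j = alc c i j (t, coord c p)"
  using c p by (simp_all add: Gc_def Gic_def alc_def)

lemma x_in_Q: "(t, coord c p) \<in> I \<times> U" using t p by auto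

end

lemma rep_Gc: "rep c U (\<lambda>t q. g t c q $ i $ j) (Gc c i j)"
  and rep_alc: "rep c U (\<lambda>t q. \<alpha> t c q $ i $ j) (alc c i j)"
  by (auto intro!: rep_I smooth_intros Gc_at alc_at)

lemma christoffel_eq:
  assumes "t \<in> I" "p \<in> dom_of c" "coord c p \<in> U"
  shows "christoffel (g t) c k i j p = Gam k i j (t, coord c p)"
  unfolding christoffel_def Gam_def
  using rep_pd[OF rep_Gc assms] by (simp add: Gic_at[OF assms])

lemma rep_christoffel: "rep c U (\<lambda>t. christoffel (g t) c k i j) (Gam k i j)"
  by (intro rep_I smooth_intros christoffel_eq)

lemma ricci_eq:
  assumes "t \<in> I" "p \<in> dom_of c" "coord c p \<in> U"
  shows "ricci (g t) c p $ j $ k = Ric j k (t, coord c p)"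
  unfolding ricci_def Ric_def riemann_def Rm_def
  using rep_pd[OF rep_christoffel assms] by (simp add: christoffel_eq[OF assms])

lemma rep_pd': "rep c U F \<Phi> \<Longrightarrow> rep c U (\<lambda>t. pd c i (F t)) (dx i \<Phi>)"
  by (rule rep_I) (auto intro: rep_pd dest: rep_smooth intro!: smooth_dirD)

lemma hessian_eq:
  assumes "rep c U F \<Phi>" "t \<in> I" "p \<in> dom_of c" "coord c p \<in> U"
  shows "hessian (g t) (F t) c p $ i $ j = H \<Phi> i j (t, coord c p)"
  unfolding hessian_def H_def
  using rep_pd[OF rep_pd'[OF assms(1)] assms(2-4)] rep_pd[OF assms] by (simp add: christoffel_eq[OF assms(2-4)])

lemma gradient_eq:
  assumes "rep c U F \<Phi>" "t \<in> I" "p \<in> dom_of c" "coord c p \<in> U"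
  shows "gradient (g t) (F t) c p $ i = V \<Phi> i (t, coord c p)"
  unfolding gradient_def V_def
  using rep_pd[OF assms] by (simp add: Gic_at[OF assms(2-4)])

lemma laplacian_eq:
  assumes "rep c U F \<Phi>" "t \<in> I" "p \<in> dom_of c" "coord c p \<in> U"
  shows "laplacian (g t) (F t) c p = Lap \<Phi> (t, coord c p)"
  unfolding laplacian_def trace_of_def Lap_def
  by (simp add: Gic_at[OF assms(2-4)] hessian_eq[OF assms])

lemma ip_eq:
  assumes "rep c U F \<Phi>" "rep c U K \<Psi>" "t \<in> I" "p \<in> dom_of c" "coord c p \<in> U"
  shows "metric_manifold.ip (g t) c (F t) (K t) p = Pr \<Phi> \<Psi> (t, coord c p)"
  unfolding metric_manifold.ip_def[OF metric_manifold[OF assms(3)]] Pr_def V_def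
  using rep_pd[OF assms(1,3-)] rep_pd[OF assms(2-)]
  by (subst sum.swap) (simp add: Gic_at[OF assms(3-)] sum_distrib_right sym_Gi[OF x_in_Q[OF assms(3-)]])

lemma rep_ip:
  assumes "rep c U F \<Phi>" "rep c U K \<Psi>"
  shows "rep c U (\<lambda>t. metric_manifold.ip (g t) c (F t) (K t)) (Pr \<Phi> \<Psi>)"
  by (rule rep_I[OF smooth_Pr[OF rep_smooth[OF assms(1)] rep_smooth[OF assms(2)]] ip_eq[OF assms]])

text \<open>Lowering the index of the gradient recovers the differential, which turns g(\<nabla>F,
  \<nabla>F) into \<open>Pr\<close>.\<close>

lemma inner_at_gradient_eq:
  assumes "rep c U F \<Phi>" "t \<in> I" "p \<in> dom_of c" "coord c p \<in> U"
  shows "inner_at (g t) c p (gradient (g t) (F t) c p) (gradient (g t) (F t) c p) = Pr \<Phi> \<Phi> (t, coord c p)"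
proof -
  let ?x = "(t, coord c p)"
  have x: "?x \<in> I \<times> U" using assms by (auto)
  have "inner_at (g t) c p (gradient (g t) (F t) c p) (gradient (g t) (F t) c p)
    = (\<Sum>j\<in>UNIV. V \<Phi> j ?x * (\<Sum>i\<in>UNIV. Gc c i j ?x * V \<Phi> i ?x))"
    unfolding inner_at_def gradient_eq[OF assms] Gc_at[OF assms(2-4)]
    by (subst sum.swap) (simp add: sum_distrib_left mult_ac)
  also have "\<dots> = Pr \<Phi> \<Phi> ?x"
    unfolding Pr_def V_def lower_raise[OF x, of _ "\<lambda>l. dx l \<Phi> ?x"] ..
  finally show ?thesis .
qed

lemma trace_alpha_eq:
  assumes "t \<in> I" "p \<in> dom_of c" "coord c p \<in> U"
  shows "trace_of (g t) (\<alpha> t) c p = trA (t, coord c p)"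
  unfolding trace_of_def trA_def by (simp add: Gic_at[OF assms] alc_at[OF assms])

lemma rep_trace: "rep c U (\<lambda>t. trace_of (g t) (\<alpha> t) c) trA"
  by (intro rep_I smooth_intros trace_alpha_eq)

lemma Div_eq:
  assumes "t \<in> I" "p \<in> dom_of c" "coord c p \<in> U"
  shows "Div (g t) (\<alpha> t) c k p = Dal k (t, coord c p)"
  unfolding Div_def Dal_def nabla_tensor_def
  using rep_pd[OF rep_alc assms] by (simp add: Gic_at[OF assms] alc_at[OF assms] christoffel_eq[OF assms])

text \<open>\<open>time_deriv\<close> differentiates a matrix-valued function; entries may be taken
  once this derivative is known to exist, and joint smoothness provides it.\<close>

lemma time_deriv_eq:
  assumes "t \<in> I" "p \<in> dom_of c" "coord c p \<in> U"
  shows "time_deriv I \<alpha> t c p $ i $ j = dt (alc c i j) (t, coord c p)"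
proof -
  have sm: "smooth_on (\<lambda>(t, y). \<alpha> t c (inv_coord c y)) (I \<times> range_of c)"
    using abstract_flow c unfolding abstract_geometric_flow_def smooth_symmetric_tensor_def by blast
  have y: "coord c p \<in> range_of c" using assms by auto
  obtain D where D: "((\<lambda>(t, y). \<alpha> t c (inv_coord c y)) has_derivative D) (at (t, coord c p) within I \<times> range_of c)"
    using smooth_on_imp_differentiable[OF sm, of "(t, coord c p)"] assms(1) y by (auto simp: differentiable_def)
  have "((\<lambda>s. (\<lambda>(t, y). \<alpha> t c (inv_coord c y)) (s, coord c p)) has_derivative (\<lambda>r. D (r, 0))) (at t within I)"
    by (rule has_derivative_in_compose[where f="\<lambda>s. (s, coord c p)"])
       (use y in \<open>auto intro!: derivative_eq_intros has_derivative_subset[OF D]\<close>)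
  then have "((\<lambda>s. \<alpha> s c p) has_derivative (\<lambda>r. D (r, 0))) (at t within I)"
    using assms(2) c by simp
  moreover have "(\<lambda>r. D (r, 0)) = (\<lambda>r. r *\<^sub>R D (1, 0))"
  proof
    fix r
    show "D (r, 0) = r *\<^sub>R D (1, 0)"
      using linear_scale[OF has_derivative_linear[OF D], of r "(1, 0)"] by simp
  qed
  ultimately have hd: "((\<lambda>s. \<alpha> s c p) has_vector_derivative D (1, 0)) (at t within I)"
    by (simp only: has_vector_derivative_def)
  then have "time_deriv I \<alpha> t c p = D (1, 0)"
    unfolding time_deriv_def using at_I_nontrivial[OF assms(1)] by (simp add: vector_derivative_within)
  moreover have "((\<lambda>s. alc c i j (s, coord c p)) has_real_derivative D (1, 0) $ i $ j) (at t within I)"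
    using bounded_linear.has_vector_derivative[OF bounded_linear_vec_nth bounded_linear.has_vector_derivative[OF bounded_linear_vec_nth hd], of i j]
      c assms(2) by (simp add: alc_def has_real_derivative_iff_has_vector_derivative)
  ultimately show ?thesis using dt_eqI[OF smooth_al assms(1,3)] by simp
qed

lemma tensor_norm_eq:
  assumes "rep c U F \<Phi>" "t \<in> I" "p \<in> dom_of c" "coord c p \<in> U"
  shows "tensor_norm_sq (g t) (expander_tensor T g \<alpha> F t) c p = NS (\<lambda>x. fst x - T) \<Phi> (t, coord c p)"
  unfolding tensor_norm_sq_def NS_def expander_tensor_def
  by (simp add: Gic_at[OF assms(2-4)] alc_at[OF assms(2-4)] Gc_at[OF assms(2-4)] hessian_eq[OF assms])

lemma Theta_eq:
  assumes "rep c U F \<Phi>" "t \<in> I" "p \<in> dom_of c" "coord c p \<in> U"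
  shows "Theta_local I g \<alpha> t (neg_gradient (g t) (F t)) c p = Th \<Phi> (t, coord c p)"
  unfolding Theta_local_def Th_def neg_gradient_def
    laplacian_eq[OF rep_trace assms(2-4)] rep_pd[OF rep_trace assms(2-4)] Div_eq[OF assms(2-4)]
  by (simp add: trace_of_def ricci_eq[OF assms(2-4)] alc_at[OF assms(2-4)] Gic_at[OF assms(2-4)]
      time_deriv_eq[OF assms(2-4)] gradient_eq[OF assms])

lemma hessian_polarised_chart:
  assumes F: "rep c U F \<Phi>" and u: "rep c U u \<Psi>" and v: "rep c U v \<Xi>"
    and t: "t \<in> I" and p: "p \<in> dom_of c" "coord c p \<in> U"
  shows "2 * (\<Sum>i\<in>UNIV. \<Sum>j\<in>UNIV. hessian (g t) (F t) c p $ i $ j * gradient (g t) (u t) c p $ i * gradient (g t) (v t) c p $ j)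
    = metric_manifold.ip (g t) c (u t) (metric_manifold.ip (g t) c (F t) (v t)) p
    + metric_manifold.ip (g t) c (v t) (metric_manifold.ip (g t) c (F t) (u t)) p
    - metric_manifold.ip (g t) c (F t) (metric_manifold.ip (g t) c (u t) (v t)) p"
  unfolding hessian_eq[OF F t p] gradient_eq[OF u t p] gradient_eq[OF v t p]
    ip_eq[OF u rep_ip[OF F v] t p] ip_eq[OF v rep_ip[OF F u] t p] ip_eq[OF F rep_ip[OF u v] t p]
  by (rule Hessian_polarised) (use rep_smooth F u v x_in_Q[OF t p] in auto)

end

end

section \<open>Chart independence of the Hessian and of traces\<close>

lemma smooth_on_snd:
  assumes "smooth_on f U"
  shows "smooth_on (\<lambda>x. f (snd x)) (I \<times> U)"
  using smooth_on_affine_precompose[OF assms bounded_linear_snd, of "I \<times> U" 0] by auto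

lemma Ck_on_id: "Ck_on k (\<lambda>x. x) S"
proof (cases k)
  case (Suc j)
  then show ?thesis by (auto intro!: Ck_on_SucI[where f'="\<lambda>x v. v"] Ck_on_const)
qed simp

lemma sum_matrix_sandwich:
  fixes A H B :: "real ^ 'n::finite ^ 'n"
  shows "(\<Sum>i\<in>UNIV. \<Sum>j\<in>UNIV. H $ i $ j * A $ i $ k * B $ j $ l) = (transpose A ** H ** B) $ k $ l"
proof -
  have "(transpose A ** H ** B) $ k $ l = (\<Sum>j\<in>UNIV. \<Sum>i\<in>UNIV. H $ i $ j * A $ i $ k * B $ j $ l)"
    by (simp add: matrix_matrix_mult_def transpose_def sum_distrib_right sum_distrib_left mult_ac)
  then show ?thesis by (subst sum.swap) simp
qed

lemma (in closed_manifold) pd_cong_local: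
  assumes "c \<in> \<A>" "p \<in> dom_of c" "open W" "p \<in> W" "\<And>q. q \<in> W \<Longrightarrow> f q = h q"
  shows "pd c i f p = pd c i h p"
proof -
  have "((h \<circ> inv_coord c) has_derivative D) (at (coord c p))"
    if "((f \<circ> inv_coord c) has_derivative D) (at (coord c p))" "\<And>q. q \<in> W \<Longrightarrow> f q = h q" for f h D
  proof (rule has_derivative_transform_within_open[OF that(1)])
    show "open (range_of c \<inter> inv_coord c -` W)"
      by (rule continuous_open_preimage[OF continuous_inv_coord open_range]) (use assms in auto)
    show "coord c p \<in> range_of c \<inter> inv_coord c -` W" using assms by auto
  qed (use that(2) in auto)
  from this[of f _ h] this[of h _ f] assms(5)
  have "((f \<circ> inv_coord c) has_derivative D) (at (coord c p)) \<longleftrightarrow> ((h \<circ> inv_coord c) has_derivative D) (at (coord c p))" for D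
    by auto
  then show ?thesis unfolding pd_def frechet_derivative_def by simp
qed

lemma (in metric_manifold) ip_cong_local:
  assumes "c \<in> \<A>" "p \<in> dom_of c" "open W" "p \<in> W" "\<And>q. q \<in> W \<Longrightarrow> f q = h q"
  shows "ip c u f p = ip c u h p"
  unfolding ip_def using pd_cong_local[OF assms] by simp

text \<open>The Jacobians of the two transformation laws meet after a cyclic permutation under the
  trace.\<close>

lemma (in metric_manifold) trace_transform:
  assumes cd: "c \<in> \<A>" "d \<in> \<A>" "p \<in> dom_of c" "p \<in> dom_of d"
    and S: "S c p = transpose (transition_jacobian c d p) ** S d p ** transition_jacobian c d p"
  shows "trace_of g S c p = trace_of g S d p"
proof -
  let ?J = "transition_jacobian c d p"
  have tr: "(\<Sum>i\<in>UNIV. \<Sum>j\<in>UNIV. A $ i $ j * B $ i $ j) = trace (A ** transpose B)" for A B :: "real ^ 'n ^ 'n"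
    by (simp add: trace_def matrix_matrix_mult_def transpose_def)
  have "trace (ginv g c p ** transpose (S c p)) = trace ((ginv g c p ** transpose ?J ** transpose (S d p)) ** ?J)"
    by (simp add: S matrix_transpose_mul matrix_mul_assoc)
  also have "\<dots> = trace (?J ** (ginv g c p ** transpose ?J ** transpose (S d p)))"
    by (rule trace_mul_sym)
  also have "\<dots> = trace (ginv g d p ** transpose (S d p))"
    by (simp add: ginv_transform[OF cd] matrix_mul_assoc)
  finally show ?thesis unfolding trace_of_def tr .
qed

context flow_manifold
begin

lemma rep_subset: "rep c U F \<Phi> \<Longrightarrow> U' \<subseteq> U \<Longrightarrow> rep c U' F \<Phi>"
  unfolding rep_def using smooth_on_subset[of \<Phi> "I \<times> U" "I \<times> U'"] by blast

lemma rep_differentiable: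
  assumes "c \<in> \<A>" "open U" "U \<subseteq> range_of c" "rep c U F \<Phi>" "t \<in> I" "p \<in> dom_of c" "coord c p \<in> U"
  shows "(F t \<circ> inv_coord c) differentiable (at (coord c p))"
  using rep_has_derivative[OF assms] by (rule differentiableI)

lemma overlap_subset: "overlap c d \<subseteq> range_of c" by (auto simp: overlap_def)

text \<open>The outer product differentiates the inner one, so the inner ones must agree near p and
  not only at p; they do on the whole overlap of the domains.\<close>

lemma ip_ip_chart:
  assumes cd: "c \<in> \<A>" "d \<in> \<A>" "p \<in> dom_of c" "p \<in> dom_of d" and t: "t \<in> I"
    and a: "rep c (overlap c d) a a1" "rep d (overlap d c) a a2"
    and b: "rep c (overlap c d) b b1" "rep d (overlap d c) b b2"
    and e: "rep c (overlap c d) e e1" "rep d (overlap d c) e e2"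
  shows "metric_manifold.ip (g t) c (a t) (metric_manifold.ip (g t) c (b t) (e t)) p =
    metric_manifold.ip (g t) d (a t) (metric_manifold.ip (g t) d (b t) (e t)) p"
proof -
  interpret M: metric_manifold \<A> "g t" by (rule metric_manifold[OF t])
  have W: "open (dom_of c \<inter> dom_of d)" using cd(1,2) by (intro open_Int open_dom)
  have dd: "rep d (overlap d c) f f2 \<Longrightarrow> q \<in> dom_of c \<Longrightarrow> q \<in> dom_of d \<Longrightarrow> (f t \<circ> inv_coord d) differentiable (at (coord d q))" for f f2 q
    by (rule rep_differentiable[OF cd(2) open_overlap[OF cd(2,1)] overlap_subset _ t]) (auto simp: overlap_def)
  have "M.ip c (a t) (M.ip c (b t) (e t)) p = M.ip c (a t) (M.ip d (b t) (e t)) p"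
    by (rule M.ip_cong_local[OF cd(1,3) W]) (use cd in \<open>auto intro!: M.ip_chart dd[OF b(2)] dd[OF e(2)]\<close>)
  also have "\<dots> = M.ip d (a t) (M.ip d (b t) (e t)) p"
    by (rule M.ip_chart[OF cd dd[OF a(2) cd(3,4)]])
       (rule dd[OF rep_ip[OF cd(2) open_overlap[OF cd(2,1)] overlap_subset b(2) e(2)] cd(3,4)])
  finally show ?thesis .
qed

text \<open>By polarisation the values of the Hessian on gradients of functions do not depend on the
  chart. The coordinate functions of \<open>d\<close> are used as test functions; their gradients
  form an invertible matrix.\<close>

lemma hessian_transform:
  assumes cd: "c \<in> \<A>" "d \<in> \<A>" "p \<in> dom_of c" "p \<in> dom_of d" and t: "t \<in> I"
    and F: "rep c (range_of c) F \<Phi>" "rep d (range_of d) F \<Psi>"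
  shows "hessian (g t) (F t) c p = transpose (transition_jacobian c d p) ** hessian (g t) (F t) d p ** transition_jacobian c d p"
proof -
  interpret M: metric_manifold \<A> "g t" by (rule metric_manifold[OF t])
  let ?J = "transition_jacobian c d p"
  let ?Hc = "hessian (g t) (F t) c p" and ?Hd = "hessian (g t) (F t) d p"
  define u where "u k s q = coord d q $ k" for k and s :: real and q
  have u_c: "rep c (overlap c d) (u k) (\<lambda>x. (coord d \<circ> inv_coord c) (snd x) $ k)" for k
    unfolding rep_def u_def
    using smooth_on_bounded_linear_compose[OF bounded_linear_vec_nth smooth_on_snd[OF smooth_transition[OF cd(1,2)]]]
    by (simp add: comp_def)
  have u_d: "rep d (overlap d c) (u k) (\<lambda>x. snd x $ k)" for k
  proof -
    have "smooth_on (\<lambda>x. (0 + snd x) $ k) (I \<times> overlap d c)"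
      unfolding smooth_on_def
    proof
      fix m
      show "Ck_on m (\<lambda>x. (0 + snd x) $ k) (I \<times> overlap d c)"
        by (rule Ck_on_affine_precompose[OF bounded_linear_snd, of m "\<lambda>y. y $ k" UNIV])
           (use Ck_on_bounded_linear_compose[OF bounded_linear_vec_nth, of m "\<lambda>y. y"] Ck_on_id in auto)
    qed
    moreover have "coord d (inv_coord d y) = y" if "y \<in> overlap d c" for y
      using that overlap_subset cd(2) by (meson coord_inv_coord subsetD)
    ultimately show ?thesis by (simp add: rep_def u_def)
  qed
  have F_c: "rep c (overlap c d) F \<Phi>" and F_d: "rep d (overlap d c) F \<Psi>"
    using rep_subset[OF F(1) overlap_subset] rep_subset[OF F(2) overlap_subset] by auto
  have pc: "coord c p \<in> overlap c d" and pd: "coord d p \<in> overlap d c" using cd by (auto simp: overlap_def)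
  have "2 * (\<Sum>i\<in>UNIV. \<Sum>j\<in>UNIV. ?Hc $ i $ j * gradient (g t) (u k t) c p $ i * gradient (g t) (u l t) c p $ j)
      = 2 * (\<Sum>i\<in>UNIV. \<Sum>j\<in>UNIV. ?Hd $ i $ j * gradient (g t) (u k t) d p $ i * gradient (g t) (u l t) d p $ j)" for k l
    unfolding hessian_polarised_chart[OF cd(1) open_overlap[OF cd(1,2)] overlap_subset F_c u_c u_c t cd(3) pc]
      hessian_polarised_chart[OF cd(2) open_overlap[OF cd(2,1)] overlap_subset F_d u_d u_d t cd(4) pd]
      ip_ip_chart[OF cd t u_c u_d F_c F_d u_c u_d] ip_ip_chart[OF cd t F_c F_d u_c u_d u_c u_d] ..
  then have key: "(\<Sum>i\<in>UNIV. \<Sum>j\<in>UNIV. ?Hc $ i $ j * gradient (g t) (u k t) c p $ i * gradient (g t) (u l t) c p $ j)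
      = (\<Sum>i\<in>UNIV. \<Sum>j\<in>UNIV. ?Hd $ i $ j * gradient (g t) (u k t) d p $ i * gradient (g t) (u l t) d p $ j)" for k l
    by simp
  have pd_d: "pd d m (u k t) p = (if m = k then 1 else 0)" for m k
  proof -
    have "((u k t \<circ> inv_coord d) has_derivative (\<lambda>v. v $ k)) (at (coord d p))"
      by (rule has_derivative_transform_within_open[OF bounded_linear.has_derivative[OF bounded_linear_vec_nth has_derivative_ident] open_range[OF cd(2)]])
         (use cd in \<open>auto simp: u_def\<close>)
    from pd_eqI[OF this] show ?thesis by (simp add: axis_def)
  qed
  have pd_c: "pd c j (u k t) p = ?J $ k $ j" for j k
    unfolding pd_chart_change[OF cd rep_differentiable[OF cd(2) open_overlap[OF cd(2,1)] overlap_subset u_d t cd(4) pd]] pd_d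
    by (simp add: if_distrib cong: if_cong)
  \<comment> \<open>Its columns are the gradients of the coordinate functions of \<open>d\<close>,
    expressed in the chart \<open>c\<close>.\<close>
  define Mc where "Mc = ginv (g t) c p ** transpose ?J"
  have gc: "gradient (g t) (u k t) c p $ i = Mc $ i $ k" for i k
    unfolding gradient_def Mc_def by (simp add: matrix_matrix_mult_def transpose_def pd_c)
  have gd: "gradient (g t) (u k t) d p $ i = ginv (g t) d p $ i $ k" for i k
    unfolding gradient_def by (simp add: pd_d if_distrib cong: if_cong)
  have Pd: "ginv (g t) d p = ?J ** Mc"
    unfolding Mc_def M.ginv_transform[OF cd] by (simp add: matrix_mul_assoc)
  have "transpose Mc ** ?Hc ** Mc = transpose (?J ** Mc) ** ?Hd ** (?J ** Mc)"
    unfolding vec_eq_iff using key unfolding gc gd Pd sum_matrix_sandwich by blast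
  then have eq: "transpose Mc ** ?Hc ** Mc = transpose Mc ** (transpose ?J ** ?Hd ** ?J) ** Mc"
    by (simp add: matrix_transpose_mul matrix_mul_assoc)
  \<comment> \<open>The inverse of \<open>Mc\<close>, with which the equation \<open>eq\<close> is
    multiplied from both sides.\<close>
  define X where "X = g t d p ** ?J"
  have "X ** Mc = mat 1"
    using M.ginv_mult(1)[OF cd(2,4)] unfolding X_def Pd by (simp add: matrix_mul_assoc)
  then have MX: "Mc ** X = mat 1" using matrix_left_right_inverse by blast
  have XM: "transpose X ** transpose Mc = mat 1"
    using arg_cong[OF MX, of transpose] by (simp add: matrix_transpose_mul)
  have "?Hc = transpose X ** (transpose Mc ** ?Hc ** Mc) ** X"
    using MX XM by (metis matrix_mul_assoc matrix_mul_lid matrix_mul_rid)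
  also have "\<dots> = transpose ?J ** ?Hd ** ?J"
    unfolding eq using MX XM by (metis matrix_mul_assoc matrix_mul_lid matrix_mul_rid)
  finally show ?thesis .
qed

section \<open>Smooth functions, operators and integrals on the whole manifold\<close>

definition up :: "('m, 'n) chart \<Rightarrow> (real \<Rightarrow> 'm \<Rightarrow> real) \<Rightarrow> real \<times> (real ^ 'n) \<Rightarrow> real" where
  "up c F x = F (fst x) (inv_coord c (snd x))"

abbreviation "sm \<equiv> smooth_scalar \<A> I"

lemma sm_iff: "sm F \<longleftrightarrow> (\<forall>c\<in>\<A>. smooth_on (up c F) (I \<times> range_of c))"
proof -
  have "(\<lambda>(t, y). F t (inv_coord c y)) = up c F" for c by (auto simp: up_def)
  then show ?thesis unfolding smooth_scalar_def by simp
qed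

lemma rep_up: "sm F \<Longrightarrow> c \<in> \<A> \<Longrightarrow> rep c (range_of c) F (up c F)"
  unfolding sm_iff rep_def by (simp add: up_def)

lemma sm_rep:
  assumes "\<And>c. c \<in> \<A> \<Longrightarrow> \<exists>\<Phi>. rep c (range_of c) F \<Phi>"
  shows "sm F"
  unfolding sm_iff
proof
  fix c assume "c \<in> \<A>"
  then obtain \<Phi> where P: "rep c (range_of c) F \<Phi>" using assms by blast
  have "smooth_on (up c F) (I \<times> range_of c) \<longleftrightarrow> smooth_on \<Phi> (I \<times> range_of c)"
    by (rule smooth_on_cong) (use P in \<open>auto simp: rep_def up_def\<close>)
  then show "smooth_on (up c F) (I \<times> range_of c)" using P by (simp add: rep_def)
qed

lemma slab_chart: "c \<in> \<A> \<Longrightarrow> slab I (range_of c)"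
  by unfold_locales (use interval open_range in auto)

lemma sm_C1:
  assumes "sm F" "t \<in> I"
  shows "C1 (F t)"
  unfolding C1_def
proof
  fix c assume c: "c \<in> \<A>"
  have r: "rep c (range_of c) F (up c F)" by (rule rep_up[OF assms(1) c])
  have "Ck_on 1 (\<lambda>y. up c F (t, y)) (range_of c)"
    by (rule slab.slice_Ck_on[OF slab_chart[OF c] _ assms(2)]) (use r in \<open>simp add: rep_def\<close>)
  then show "Ck_on 1 (F t \<circ> inv_coord c) (range_of c)"
    by (subst Ck_on_cong[of _ _ "\<lambda>y. up c F (t, y)"]) (auto simp: up_def)
qed

definition LapM :: "(real \<Rightarrow> 'm \<Rightarrow> real) \<Rightarrow> real \<Rightarrow> 'm \<Rightarrow> real" where
  "LapM F t = laplacian_M \<A> (g t) (F t)"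
definition IPM :: "(real \<Rightarrow> 'm \<Rightarrow> real) \<Rightarrow> (real \<Rightarrow> 'm \<Rightarrow> real) \<Rightarrow> real \<Rightarrow> 'm \<Rightarrow> real" where
  "IPM F K t = metric_manifold.IP \<A> (g t) (F t) (K t)"
definition trM :: "real \<Rightarrow> 'm \<Rightarrow> real" where
  "trM t = trace_M \<A> (g t) (\<alpha> t)"
definition TD :: "(real \<Rightarrow> 'm \<Rightarrow> real) \<Rightarrow> real \<Rightarrow> 'm \<Rightarrow> real" where
  "TD F t p = vector_derivative (\<lambda>s. F s p) (at t within I)"

context
  fixes c :: "('m, 'n) chart"
  assumes c: "c \<in> \<A>"
begin

interpretation geom_flow I "range_of c" "Gc c" "Gic c" "rhoc c" "alc c"
  by (rule geom_flow_chart[OF c open_range[OF c] order_refl])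

lemma smooth_up: "sm F \<Longrightarrow> smooth (up c F)"
  using rep_up[OF _ c] unfolding rep_def by blast

lemma rep_LapM:
  assumes "sm F"
  shows "rep c (range_of c) (LapM F) (Lap (up c F))"
proof (rule rep_I[OF c open_range[OF c] order_refl])
  show "smooth (Lap (up c F))" by (intro smooth_Lap smooth_up assms)
  fix t p assume t: "t \<in> I" and p: "p \<in> dom_of c" "coord c p \<in> range_of c"
  have "LapM F t p = laplacian (g t) (F t) c p"
    unfolding LapM_def laplacian_M_def
  proof (rule on_M_eq[OF _ c p(1)])
    fix c d assume cd: "c \<in> \<A>" "d \<in> \<A>" "p \<in> dom_of c" "p \<in> dom_of d"
    show "laplacian (g t) (F t) c p = laplacian (g t) (F t) d p"
      unfolding laplacian_def
      by (rule metric_manifold.trace_transform[OF metric_manifold[OF t] cd])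
         (rule hessian_transform[OF cd t rep_up[OF assms cd(1)] rep_up[OF assms cd(2)]])
  qed
  then show "LapM F t p = Lap (up c F) (t, coord c p)"
    using laplacian_eq[OF c open_range[OF c] order_refl rep_up[OF assms c] t p] by simp
qed

lemma rep_IPM:
  assumes "sm F" "sm K"
  shows "rep c (range_of c) (IPM F K) (Pr (up c F) (up c K))"
proof (rule rep_I[OF c open_range[OF c] order_refl])
  show "smooth (Pr (up c F) (up c K))" by (intro smooth_Pr smooth_up assms)
  fix t p assume t: "t \<in> I" and p: "p \<in> dom_of c" "coord c p \<in> range_of c"
  have "IPM F K t p = metric_manifold.ip (g t) c (F t) (K t) p"
    unfolding IPM_def by (rule metric_manifold.IP_eq[OF metric_manifold[OF t] sm_C1[OF assms(1) t] sm_C1[OF assms(2) t] c p(1)])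
  then show "IPM F K t p = Pr (up c F) (up c K) (t, coord c p)"
    using ip_eq[OF c open_range[OF c] order_refl rep_up[OF assms(1) c] rep_up[OF assms(2) c] t p] by simp
qed

lemma rep_trM: "rep c (range_of c) trM trA"
proof (rule rep_I[OF c open_range[OF c] order_refl])
  show "smooth trA" by (rule smooth_trA)
  fix t p assume t: "t \<in> I" and p: "p \<in> dom_of c" "coord c p \<in> range_of c"
  have "trM t p = trace_of (g t) (\<alpha> t) c p"
    unfolding trM_def trace_M_def
  proof (rule on_M_eq[OF _ c p(1)])
    fix c d assume cd: "c \<in> \<A>" "d \<in> \<A>" "p \<in> dom_of c" "p \<in> dom_of d"
    have "is_symmetric_tensor \<A> (\<alpha> t)"
      using abstract_flow t unfolding abstract_geometric_flow_def smooth_symmetric_tensor_def by blast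
    then show "trace_of (g t) (\<alpha> t) c p = trace_of (g t) (\<alpha> t) d p"
      by (intro metric_manifold.trace_transform[OF metric_manifold[OF t] cd])
         (use cd in \<open>unfold is_symmetric_tensor_def, blast\<close>)
  qed
  then show "trM t p = trA (t, coord c p)"
    using trace_alpha_eq[OF c open_range[OF c] order_refl t p] by simp
qed

lemma TD_chart:
  assumes "sm F" "t \<in> I" "p \<in> dom_of c"
  shows "((\<lambda>s. F s p) has_real_derivative dt (up c F) (t, coord c p)) (at t within I)"
    and "TD F t p = dt (up c F) (t, coord c p)"
proof -
  have y: "coord c p \<in> range_of c" using assms by auto
  have "((\<lambda>s. up c F (s, coord c p)) has_real_derivative dt (up c F) (t, coord c p)) (at t within I)"
    by (rule dt_has_derivative[OF smooth_up[OF assms(1)] assms(2) y])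
  then show h: "((\<lambda>s. F s p) has_real_derivative dt (up c F) (t, coord c p)) (at t within I)"
    using c assms(3) by (simp add: up_def)
  then show "TD F t p = dt (up c F) (t, coord c p)"
    unfolding TD_def has_real_derivative_iff_has_vector_derivative
    using at_I_nontrivial[OF assms(2)] by (simp add: vector_derivative_within)
qed

lemma rep_TD: "sm F \<Longrightarrow> rep c (range_of c) (TD F) (dt (up c F))"
  by (rule rep_I[OF c open_range[OF c] order_refl]) (auto intro: smooth_dirD smooth_up TD_chart(2))

lemma vol_rho: "t \<in> I \<Longrightarrow> y \<in> range_of c \<Longrightarrow> metric_manifold.vol (g t) c y = rhoc c (t, y)"
  by (simp add: metric_manifold.vol_def[OF metric_manifold] rhoc_def)

text \<open>The three chart hypotheses of \<open>green\<close>, with the volume density times the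
  gradient of F as the field.\<close>

lemma green_chart:
  assumes F: "sm F" and t: "t \<in> I"
  shows "Ck_on 1 (\<lambda>y. rhoc c (t, y) * V (up c F) i (t, y)) (range_of c)"
    and "y \<in> range_of c \<Longrightarrow> rhoc c (t, y) * V (up c F) i (t, y) =
      metric_manifold.vol (g t) c y * (\<Sum>j\<in>UNIV. ginv (g t) c (inv_coord c y) $ i $ j * pd c j (F t) (inv_coord c y))"
    and "y \<in> range_of c \<Longrightarrow> (\<Sum>i\<in>UNIV. frechet_derivative (\<lambda>y. rhoc c (t, y) * V (up c F) i (t, y)) (at y) (axis i 1))
      = metric_manifold.vol (g t) c y * LapM F t (inv_coord c y)"
proof -
  have s: "smooth (\<lambda>x. rhoc c x * V (up c F) i x)" for i
    by (intro smooth_intros smooth_up F)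
  show "Ck_on 1 (\<lambda>y. rhoc c (t, y) * V (up c F) i (t, y)) (range_of c)"
    using slice_Ck_on[OF s t] by simp
  assume y: "y \<in> range_of c"
  then have p: "inv_coord c y \<in> dom_of c" "coord c (inv_coord c y) \<in> range_of c" "coord c (inv_coord c y) = y"
    using c by auto
  show "rhoc c (t, y) * V (up c F) i (t, y) =
      metric_manifold.vol (g t) c y * (\<Sum>j\<in>UNIV. ginv (g t) c (inv_coord c y) $ i $ j * pd c j (F t) (inv_coord c y))"
    using rep_pd[OF c open_range[OF c] order_refl rep_up[OF F c] t p(1,2)]
    by (simp add: vol_rho[OF t y] V_def Gic_at[OF c open_range[OF c] order_refl t p(1,2)] p(3))
  have "frechet_derivative (\<lambda>y. rhoc c (t, y) * V (up c F) i (t, y)) (at y) (axis i 1) = dx i (\<lambda>x. rhoc c x * V (up c F) i x) (t, y)" for i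
    using frechet_derivative_at[OF slice_has_derivative[OF s t y], symmetric] by metis
  then have div: "(\<Sum>i\<in>UNIV. frechet_derivative (\<lambda>y. rhoc c (t, y) * V (up c F) i (t, y)) (at y) (axis i 1))
      = rhoc c (t, y) * Lap (up c F) (t, y)"
    using rho_dv[of "V (up c F)" "(t, y)"] Lap_div[OF smooth_up[OF F], of "(t, y)"] smooth_V[OF smooth_up[OF F]] t y by simp
  show "(\<Sum>i\<in>UNIV. frechet_derivative (\<lambda>y. rhoc c (t, y) * V (up c F) i (t, y)) (at y) (axis i 1))
      = metric_manifold.vol (g t) c y * LapM F t (inv_coord c y)"
  proof -
    have "LapM F t (inv_coord c y) = Lap (up c F) (t, y)"
      using rep_LapM[OF F] t y unfolding rep_def by blast
    with div show ?thesis by (simp only: vol_rho[OF t y])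
  qed
qed

text \<open>The volume density evolves with logarithmic derivative - A, which produces the second
  term.\<close>

lemma dt_density:
  assumes F: "sm F" and t: "t \<in> I" and y: "y \<in> range_of c"
  shows "dt (\<lambda>x. up c F x * rhoc c x) (t, y) =
    metric_manifold.vol (g t) c y * (TD F t (inv_coord c y) - trM t (inv_coord c y) * F t (inv_coord c y))"
proof -
  have x: "(t, y) \<in> Q" using t y by simp
  have "dt (\<lambda>x. up c F x * rhoc c x) (t, y) = rhoc c (t, y) * (dt (up c F) (t, y) - trA (t, y) * up c F (t, y))"
    by (simp add: d_mult[OF x] smooth_up[OF F] smooth_rho dt_rho[OF x] algebra_simps)
  moreover have "TD F t (inv_coord c y) = dt (up c F) (t, y)" "trM t (inv_coord c y) = trA (t, y)"
      "F t (inv_coord c y) = up c F (t, y)"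
    using rep_TD[OF F] rep_trM rep_up[OF F c] t y unfolding rep_def by blast+
  ultimately show ?thesis by (simp only: vol_rho[OF t y])
qed

lemma smooth_density: "sm F \<Longrightarrow> smooth (\<lambda>x. up c F x * rhoc c x)"
  by (intro smooth_intros smooth_up)

end

lemma sm_LapM: "sm F \<Longrightarrow> sm (LapM F)"
  by (rule sm_rep) (blast intro: rep_LapM)

lemma sm_IPM: "sm F \<Longrightarrow> sm K \<Longrightarrow> sm (IPM F K)"
  by (rule sm_rep) (blast intro: rep_IPM)

lemma sm_trM: "sm trM"
  by (rule sm_rep) (blast intro: rep_trM)

lemma sm_TD: "sm F \<Longrightarrow> sm (TD F)"
  by (rule sm_rep) (blast intro: rep_TD)

lemma sm_add: "sm F \<Longrightarrow> sm K \<Longrightarrow> sm (\<lambda>t p. F t p + K t p)"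
  and sm_diff: "sm F \<Longrightarrow> sm K \<Longrightarrow> sm (\<lambda>t p. F t p - K t p)"
  and sm_mult: "sm F \<Longrightarrow> sm K \<Longrightarrow> sm (\<lambda>t p. F t p * K t p)"
  and sm_exp: "sm F \<Longrightarrow> sm (\<lambda>t p. exp (F t p))"
  and sm_uminus: "sm F \<Longrightarrow> sm (\<lambda>t p. - F t p)"
  unfolding sm_iff up_def by (simp_all add: smooth_intros)

lemma sm_time:
  assumes "smooth_on f I"
  shows "sm (\<lambda>t p. f t)"
  unfolding sm_iff up_def
proof
  fix c :: "('m, 'n) chart"
  show "smooth_on (\<lambda>x. f (fst x)) (I \<times> range_of c)"
    using smooth_on_affine_precompose[OF assms bounded_linear_fst, of "I \<times> range_of c" 0] by auto
qed

lemma sm_continuous: "sm F \<Longrightarrow> t \<in> I \<Longrightarrow> continuous_on UNIV (F t)"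
  by (rule C1_continuous[OF sm_C1])

lemma sm_integrable: "sm F \<Longrightarrow> t \<in> I \<Longrightarrow> integrable (riemannian_volume \<A> (g t)) (F t)"
  using metric_manifold.integrable_continuous_RV[OF metric_manifold sm_continuous]
  by (simp add: metric_manifold.RV_def[OF metric_manifold])

lemma green_M:
  assumes F: "sm F" and K: "sm K" and t: "t \<in> I"
  shows "(\<integral>p. (K t p * LapM F t p + IPM F K t p) \<partial>riemannian_volume \<A> (g t)) = 0"
proof -
  interpret M: metric_manifold \<A> "g t" by (rule metric_manifold[OF t])
  have "(\<integral>p. (K t p * LapM F t p + M.IP (F t) (K t) p) \<partial>M.RV) = 0"
    by (rule M.green[OF sm_C1[OF F t] sm_C1[OF K t] sm_continuous[OF sm_LapM[OF F] t] green_chart(1)[OF _ F t]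
        green_chart(2)[OF _ F t] green_chart(3)[OF _ F t]])
  then show ?thesis by (simp add: M.RV_def IPM_def)
qed

text \<open>The partition of unity is independent of time, so the integral splits into integrals
  over fixed coordinate sets in which only F and the volume density move.\<close>

lemma has_derivative_integral_M:
  assumes F: "sm F" and t: "t \<in> I"
  shows "((\<lambda>s. \<integral>p. F s p \<partial>riemannian_volume \<A> (g s)) has_real_derivative
    (\<integral>p. (TD F t p - trM t p * F t p) \<partial>riemannian_volume \<A> (g t))) (at t within I)"
proof -
  obtain N cf Kf \<eta> where "partition_of_unity N cf Kf \<eta>" using partition_exists by blast
  note P = partition_of_unityD[OF this]
  have C: "C1 (\<eta> p)" for p using P(7) by (simp add: C1_def)
  have split: "(\<integral>q. f q \<partial>riemannian_volume \<A> (g s)) =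
      (\<Sum>p\<in>N. \<integral>y. (if y \<in> range_of (cf p) then \<eta> p (inv_coord (cf p) y) * (metric_manifold.vol (g s) (cf p) y * f (inv_coord (cf p) y)) else 0) \<partial>lborel)"
    if s: "s \<in> I" and f: "continuous_on UNIV f" for s f
  proof -
    interpret M: metric_manifold \<A> "g s" by (rule metric_manifold[OF s])
    have c: "continuous_on UNIV (\<lambda>q. \<eta> p q * f q)" for p by (intro continuous_intros C1_continuous C f)
    have "(\<integral>q. f q \<partial>M.RV) = (\<integral>q. (\<Sum>p\<in>N. \<eta> p q * f q) \<partial>M.RV)"
      by (simp add: P(6) flip: sum_distrib_right)
    also have "\<dots> = (\<Sum>p\<in>N. \<integral>q. \<eta> p q * f q \<partial>M.RV)"
      by (rule Bochner_Integration.integral_sum) (rule M.integrable_continuous_RV[OF c])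
    also have "\<dots> = (\<Sum>p\<in>N. \<integral>y. M.vol (cf p) y * (\<eta> p (icoord (cf p) y) * f (icoord (cf p) y)) \<partial>lborel)"
      by (intro sum.cong refl M.integral_RV_chart P(2) borel_measurable_continuous_onI[OF c])
         (use P(4,5) in force)
    also have "\<dots> = (\<Sum>p\<in>N. \<integral>y. (if y \<in> range_of (cf p) then \<eta> p (inv_coord (cf p) y) * (M.vol (cf p) y * f (inv_coord (cf p) y)) else 0) \<partial>lborel)"
      by (intro sum.cong refl Bochner_Integration.integral_cong) (auto simp: M.vol_def icoord_def)
    finally show ?thesis unfolding M.RV_def .
  qed
  define D where "D q = TD F t q - trM t q * F t q" for q
  have cD: "continuous_on UNIV D"
    unfolding D_def by (intro continuous_intros sm_continuous t sm_TD sm_trM F)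
  have "((\<lambda>s. \<Sum>p\<in>N. \<integral>y. (if y \<in> range_of (cf p) then \<eta> p (inv_coord (cf p) y) * (up (cf p) F (s, y) * rhoc (cf p) (s, y)) else 0) \<partial>lborel)
    has_real_derivative (\<Sum>p\<in>N. \<integral>y. (if y \<in> range_of (cf p) then \<eta> p (inv_coord (cf p) y) *
        dirD (I \<times> range_of (cf p)) (1, 0) (\<lambda>x. up (cf p) F x * rhoc (cf p) x) (t, y) else 0) \<partial>lborel)) (at t within I)"
  proof (rule DERIV_sum)
    fix p
    let ?c = "cf p"
    show "((\<lambda>s. \<integral>y. (if y \<in> range_of ?c then \<eta> p (inv_coord ?c y) * (up ?c F (s, y) * rhoc ?c (s, y)) else 0) \<partial>lborel)
      has_real_derivative (\<integral>y. (if y \<in> range_of ?c then \<eta> p (inv_coord ?c y) *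
        dirD (I \<times> range_of ?c) (1, 0) (\<lambda>x. up ?c F x * rhoc ?c x) (t, y) else 0) \<partial>lborel)) (at t within I)"
    proof (rule slab.has_derivative_integral_slab[OF slab_chart[OF P(2)], where K="coord ?c ` Kf p" and F="\<lambda>x. up ?c F x * rhoc ?c x"])
      show "compact (coord ?c ` Kf p)"
        by (rule compact_continuous_image[OF continuous_on_subset[OF continuous_coord[OF P(2)] P(4)] P(3)])
      show "coord ?c ` Kf p \<subseteq> range_of ?c" using P(4) by blast
      show "smooth_on (\<lambda>x. up ?c F x * rhoc ?c x) (I \<times> range_of ?c)" by (rule smooth_density[OF P(2) F])
      show "continuous_on (range_of ?c) (\<lambda>y. \<eta> p (inv_coord ?c y))"
        by (rule continuous_on_compose2[OF C1_continuous[OF C] continuous_inv_coord[OF P(2)]]) auto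
      show "\<eta> p (inv_coord ?c y) = 0" if "y \<in> range_of ?c - coord ?c ` Kf p" for y
      proof -
        have "inv_coord ?c y \<notin> Kf p" using that P(2) by (metis DiffD1 DiffD2 coord_inv_coord image_eqI)
        then show ?thesis by (rule P(5))
      qed
    qed (rule t)
  qed
  also have "(\<Sum>p\<in>N. \<integral>y. (if y \<in> range_of (cf p) then \<eta> p (inv_coord (cf p) y) *
        dirD (I \<times> range_of (cf p)) (1, 0) (\<lambda>x. up (cf p) F x * rhoc (cf p) x) (t, y) else 0) \<partial>lborel)
     = (\<Sum>p\<in>N. \<integral>y. (if y \<in> range_of (cf p) then \<eta> p (inv_coord (cf p) y) * (metric_manifold.vol (g t) (cf p) y * D (inv_coord (cf p) y)) else 0) \<partial>lborel)"
    by (intro sum.cong refl Bochner_Integration.integral_cong) (simp add: dt_density[OF P(2) F t] D_def)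
  also have "\<dots> = (\<integral>q. D q \<partial>riemannian_volume \<A> (g t))" by (rule split[OF t cD, symmetric])
  finally have deriv: "((\<lambda>s. \<Sum>p\<in>N. \<integral>y. (if y \<in> range_of (cf p) then \<eta> p (inv_coord (cf p) y) * (up (cf p) F (s, y) * rhoc (cf p) (s, y)) else 0) \<partial>lborel)
    has_real_derivative (\<integral>q. D q \<partial>riemannian_volume \<A> (g t))) (at t within I)" .
  have eq: "(\<Sum>p\<in>N. \<integral>y. (if y \<in> range_of (cf p) then \<eta> p (inv_coord (cf p) y) * (up (cf p) F (s, y) * rhoc (cf p) (s, y)) else 0) \<partial>lborel)
     = (\<integral>q. F s q \<partial>riemannian_volume \<A> (g s))" if s: "s \<in> I" for s
    unfolding split[OF s sm_continuous[OF F s]]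
    by (intro sum.cong refl Bochner_Integration.integral_cong) (simp add: vol_rho[OF P(2) s] up_def)
  from has_field_derivative_transform_within[OF deriv zero_less_one t eq] show ?thesis
    unfolding D_def by simp
qed

end

subsection \<open>Perelman's entropy for expanders\<close>

lemma smooth_on_ident: "smooth_on (\<lambda>x. x) S"
  by (simp add: smooth_on_def Ck_on_id)

context metric_manifold
begin

lemma ip_sym: "c \<in> \<A> \<Longrightarrow> p \<in> dom_of c \<Longrightarrow> ip c f u p = ip c u f p"
  unfolding ip_def by (subst sum.swap) (simp add: ginv_sym mult_ac)

text \<open>With w obtained from v by the inverse metric, the form equals g(w, w).\<close>

lemma ginv_psd:
  assumes "c \<in> \<A>" "p \<in> dom_of c"
  shows "(\<Sum>i\<in>UNIV. \<Sum>j\<in>UNIV. ginv g c p $ i $ j * v i * v j) \<ge> 0"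
proof -
  define V where "V = (\<chi> i. v i)"
  define w where "w = ginv g c p *v V"
  have "(\<Sum>i\<in>UNIV. \<Sum>j\<in>UNIV. ginv g c p $ i $ j * v i * v j) = V \<bullet> w"
    by (simp add: V_def w_def inner_vec_def matrix_vector_mult_def sum_distrib_left mult_ac)
  also have "V = g c p *v w"
    by (simp add: w_def matrix_vector_mul_assoc ginv_mult[OF assms])
  also have "(g c p *v w) \<bullet> w = w \<bullet> (g c p *v w)" by (rule inner_commute)
  also have "\<dots> \<ge> 0"
    using riem assms unfolding is_riemannian_metric_def by (cases "w = 0") (auto intro: less_imp_le)
  finally show ?thesis .
qed

lemma tensor_norm_sq_nonneg:
  assumes "c \<in> \<A>" "p \<in> dom_of c"
  shows "tensor_norm_sq g S c p \<ge> 0" and "tensor_norm_sq g S c p = 0 \<Longrightarrow> S c p = 0"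
proof -
  note n = tensor_norm_sq_psd[of "\<lambda>i j. ginv g c p $ i $ j" "\<lambda>i j. S c p $ i $ j", OF ginv_sym[OF assms] ginv_psd[OF assms]]
  show "tensor_norm_sq g S c p \<ge> 0" unfolding tensor_norm_sq_def by (rule n(1))
  assume "tensor_norm_sq g S c p = 0"
  then have z: "(\<Sum>i\<in>UNIV. \<Sum>j\<in>UNIV. ginv g c p $ a $ i * ginv g c p $ b $ j * S c p $ i $ j) = 0" for a b
    unfolding tensor_norm_sq_def by (rule n(2))
  have "(transpose (ginv g c p) ** S c p ** ginv g c p) $ a $ b = 0" for a b
    using z[of a b] unfolding sum_matrix_sandwich[symmetric] by (simp add: ginv_sym[OF assms, of a] ginv_sym[OF assms, of b] mult_ac)
  then have "transpose (ginv g c p) ** S c p ** ginv g c p = 0" by (simp add: vec_eq_iff)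
  moreover have "transpose (ginv g c p) = ginv g c p"
    by (simp add: vec_eq_iff transpose_def ginv_sym[OF assms])
  ultimately have "ginv g c p ** S c p ** ginv g c p = 0" by simp
  then have "g c p ** (ginv g c p ** S c p ** ginv g c p) ** g c p = 0" by simp
  moreover have "g c p ** (ginv g c p ** S c p ** ginv g c p) ** g c p
      = (g c p ** ginv g c p) ** S c p ** (ginv g c p ** g c p)"
    by (simp only: matrix_mul_assoc)
  ultimately show "S c p = 0" by (simp add: ginv_mult[OF assms])
qed

lemma gradient_transform:
  assumes cd: "c \<in> \<A>" "d \<in> \<A>" "p \<in> dom_of c" "p \<in> dom_of d" and f: "C1 f"
  shows "gradient g f d p = transition_jacobian c d p *v gradient g f c p"
proof -
  let ?J = "transition_jacobian c d p"
  have gr: "gradient g f e p = ginv g e p *v (\<chi> i. pd e i f p)" for e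
    by (simp add: gradient_def matrix_vector_mult_def vec_eq_iff)
  have "(\<chi> i. pd c i f p) = transpose ?J *v (\<chi> i. pd d i f p)"
    by (simp add: vec_eq_iff matrix_vector_mult_def transpose_def pd_chart_change[OF cd C1_differentiable[OF f cd(2,4)]])
  then show ?thesis
    unfolding gr ginv_transform[OF cd] by (simp only: matrix_vector_mul_assoc matrix_mul_assoc)
qed

text \<open>The volume density is positive on the chart, and a nonempty open set of coordinates is
  not negligible.\<close>

lemma RV_open_pos:
  assumes c: "c \<in> \<A>" and W: "open W" "W \<subseteq> dom_of c" "W \<noteq> {}"
  shows "emeasure RV W \<noteq> 0"
proof
  assume "emeasure RV W = 0"
  then have z: "(\<integral>\<^sup>+ y. ennreal (indicator (coord c ` W) y * vol c y) \<partial>lborel) = 0"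
  proof -
    have "(\<integral>\<^sup>+ y. ennreal (indicator (coord c ` W) y * vol c y) \<partial>lborel) =
       (\<integral>\<^sup>+ y \<in> coord c ` W. ennreal (sqrt (det (g c (inv_coord c y)))) \<partial>lborel)"
      using W(2) by (intro nn_integral_cong) (auto simp: vol_def indicator_def)
    then show ?thesis
      using emeasure_RV[OF c _ W(2)] emeasure_chart_measure[OF c _ W(2)] W(1) \<open>emeasure RV W = 0\<close> by simp
  qed
  have oW: "open (coord c ` W)" by (rule open_coord_image[OF c W(1,2)])
  have m: "(\<lambda>y. ennreal (indicator (coord c ` W) y * vol c y)) \<in> borel_measurable lborel"
    using measurable_vol[OF c] borel_open[OF oW] by simp
  have "AE y in lborel. ennreal (indicator (coord c ` W) y * vol c y) = 0"
    using z nn_integral_0_iff_AE[OF m] by simp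
  then have "AE y in lborel. y \<notin> coord c ` W"
  proof (rule AE_mp, intro AE_I2 impI notI)
    fix y assume e: "ennreal (indicator (coord c ` W) y * vol c y) = 0" and y: "y \<in> coord c ` W"
    then have "inv_coord c y \<in> dom_of c" "y \<in> range_of c" using W(2) c by auto
    then have "vol c y > 0" using det_g_pos[OF c] by (simp add: vol_def)
    with e y show False by simp
  qed
  then have "emeasure lborel (coord c ` W) = 0"
    using AE_iff_measurable[of "coord c ` W" lborel "\<lambda>y. y \<notin> coord c ` W"] oW by simp
  then have "negligible (coord c ` W)"
    using oW by (simp add: negligible_iff_null_sets null_sets_completionI null_sets_def)
  then show False using open_not_negligible[OF oW] W(3) by simp
qed

end

context flow_manifold
begin

lemma pd_mult:
  assumes "C1 f" "C1 h" "c \<in> \<A>" "p \<in> dom_of c"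
  shows "pd c i (\<lambda>q. f q * h q) p = f p * pd c i h p + h p * pd c i f p"
proof -
  have y: "coord c p \<in> range_of c" using assms by auto
  from has_derivative_mult[OF C1_derivative[OF assms(1,3) y] C1_derivative[OF assms(2,3) y]]
  have "(((\<lambda>q. f q * h q) \<circ> inv_coord c) has_derivative
     (\<lambda>v. (f \<circ> inv_coord c) (coord c p) * frechet_derivative (h \<circ> inv_coord c) (at (coord c p)) v +
        frechet_derivative (f \<circ> inv_coord c) (at (coord c p)) v * (h \<circ> inv_coord c) (coord c p))) (at (coord c p))"
    by (simp add: comp_def)
  from pd_eqI[OF this] show ?thesis using assms(3,4) by (simp add: pd_def)
qed

lemma IPM_at:
  assumes "sm F" "sm K" "t \<in> I" "c \<in> \<A>" "p \<in> dom_of c"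
  shows "IPM F K t p = metric_manifold.ip (g t) c (F t) (K t) p"
  unfolding IPM_def by (rule metric_manifold.IP_eq[OF metric_manifold[OF assms(3)] sm_C1[OF assms(1,3)] sm_C1[OF assms(2,3)] assms(4,5)])

lemma IPM_sym: "sm F \<Longrightarrow> sm K \<Longrightarrow> t \<in> I \<Longrightarrow> IPM F K t p = IPM K F t p"
  unfolding IPM_at[OF _ _ _ chart_at] by (rule metric_manifold.ip_sym[OF metric_manifold chart_at])

lemma IPM_mult:
  assumes "sm F" "sm K" "sm L" "t \<in> I"
  shows "IPM F (\<lambda>t p. K t p * L t p) t p = K t p * IPM F L t p + L t p * IPM F K t p"
proof -
  interpret M: metric_manifold \<A> "g t" by (rule metric_manifold[OF assms(4)])
  show ?thesis
    using IPM_at[OF assms(1) sm_mult[OF assms(2,3)] assms(4) chart_at] IPM_at[OF assms(1,2,4) chart_at] IPM_at[OF assms(1,3,4) chart_at]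
    by (simp add: M.ip_def pd_mult[OF sm_C1[OF assms(2,4)] sm_C1[OF assms(3,4)] chart_at] algebra_simps sum.distrib sum_distrib_left)
qed

lemma TD_works: "sm F \<Longrightarrow> t \<in> I \<Longrightarrow> ((\<lambda>s. F s p) has_real_derivative TD F t p) (at t within I)"
  using TD_chart[OF chart_at(1) _ _ chart_at(2)] by metis

lemma TD_eqI: "((\<lambda>s. F s p) has_real_derivative D) (at t within I) \<Longrightarrow> t \<in> I \<Longrightarrow> TD F t p = D"
  unfolding TD_def has_real_derivative_iff_has_vector_derivative
  using slab.at_I_nontrivial[OF slab_chart[OF chart_at(1)]] by (simp add: vector_derivative_within)

end

section \<open>The entropy along a flow with a solution of the evolution equation\<close>

locale entropy_flow = flow_manifold \<A> I g \<alpha>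
  for \<A> :: "('m::t2_space, 'n::finite) chart set" and I :: "real set" and g \<alpha> :: "real \<Rightarrow> ('m, 'n) tensor2" +
  fixes T :: real and \<phi> :: "real \<Rightarrow> 'm \<Rightarrow> real"
  assumes I_T: "I \<subseteq> {T<..}" and sm_phi: "sm \<phi>"
    and evolution: "\<And>t p. t \<in> I \<Longrightarrow>
      ((\<lambda>s. \<phi> s p) has_real_derivative
        (- laplacian_M \<A> (g t) (\<phi> t) p + gradient_norm_sq \<A> (g t) (\<phi> t) p
         - trace_M \<A> (g t) (\<alpha> t) p - real CARD('n) / (2 * (t - T)))) (at t within I)"
begin

definition u :: "real \<Rightarrow> 'm \<Rightarrow> real" where "u t p = weight \<A> T \<phi> t p"

definition w :: "real \<Rightarrow> 'm \<Rightarrow> real" where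
  "w t p = (t - T) * (2 * LapM \<phi> t p - IPM \<phi> \<phi> t p + trM t p) - \<phi> t p + real CARD('n)"

abbreviation "J t \<equiv> integral\<^sup>L (riemannian_volume \<A> (g t))"

lemma sigma_pos: "t \<in> I \<Longrightarrow> t - T > 0" using I_T by auto

lemma smooth_sigma: "smooth_on (\<lambda>t. t - T) I"
  by (intro smooth_intros smooth_on_ident)

lemma sm_u: "sm u"
proof -
  have "smooth_on (\<lambda>t. (4 * pi * (t - T)) powr (- real CARD('n) / 2)) I"
    by (intro smooth_on_powr smooth_on_mult smooth_on_const smooth_sigma) (use sigma_pos in auto)
  then show ?thesis
    unfolding u_def weight_def by (intro sm_mult sm_time sm_exp sm_uminus sm_phi)
qed

lemma u_pos: "t \<in> I \<Longrightarrow> u t p > 0"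
  using sigma_pos[of t] by (simp add: u_def weight_def)

lemma sm_w: "sm w"
  unfolding w_def
  by (intro sm_add sm_diff sm_mult sm_time smooth_sigma sm_LapM sm_IPM sm_trM sm_phi smooth_on_const)

lemma gradient_norm_sq_eq:
  assumes t: "t \<in> I"
  shows "gradient_norm_sq \<A> (g t) (\<phi> t) p = IPM \<phi> \<phi> t p"
proof -
  let ?c = "chart_at \<A> p"
  note c = chart_at(1)[of p] open_range[OF chart_at(1)[of p]] order_refl[of "range_of ?c"]
  have p: "p \<in> dom_of ?c" "coord ?c p \<in> range_of ?c" using chart_at by auto
  have r: "rep ?c (range_of ?c) \<phi> (up ?c \<phi>)" by (rule rep_up[OF sm_phi chart_at(1)])
  show ?thesis
    unfolding gradient_norm_sq_def on_M_def IPM_at[OF sm_phi sm_phi t chart_at]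
      inner_at_gradient_eq[OF c r t p] ip_eq[OF c r r t p] ..
qed

lemma evolution': "t \<in> I \<Longrightarrow> ((\<lambda>s. \<phi> s p) has_real_derivative
    (- LapM \<phi> t p + IPM \<phi> \<phi> t p - trM t p - real CARD('n) / (2 * (t - T)))) (at t within I)"
  using evolution[of t p] by (simp add: gradient_norm_sq_eq LapM_def trM_def)

text \<open>The power of \<sigma> contributes - n/(2\<sigma>), which cancels the constant term of
  the evolution equation.\<close>

lemma TD_u:
  assumes t: "t \<in> I"
  shows "TD u t p = u t p * (LapM \<phi> t p - IPM \<phi> \<phi> t p + trM t p)"
proof (rule TD_eqI[OF _ t])
  define C where "C s = (4 * pi * (s - T)) powr (- real CARD('n) / 2)" for s
  define D where "D = - LapM \<phi> t p + IPM \<phi> \<phi> t p - trM t p - real CARD('n) / (2 * (t - T))"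
  have s: "t - T > 0" by (rule sigma_pos[OF t])
  have "((\<lambda>s. (4 * pi * (s - T)) powr (- real CARD('n) / 2)) has_real_derivative
      (- real CARD('n) / 2) * (4 * pi * (t - T)) powr (- real CARD('n) / 2 - 1) * (4 * pi)) (at t within I)"
    by (rule DERIV_chain2[OF has_real_derivative_powr]) (use s in \<open>auto intro!: derivative_eq_intros\<close>)
  note dP = this
  have e: "(4 * pi * (t - T)) powr (- real CARD('n) / 2 - 1) = C t / (4 * pi * (t - T))"
    using s by (simp add: C_def powr_diff)
  have dC: "(C has_real_derivative - real CARD('n) / (2 * (t - T)) * C t) (at t within I)"
    by (rule DERIV_cong[OF dP[unfolded e, folded C_def]]) (use s in \<open>simp add: divide_simps\<close>)
  have "((\<lambda>s. \<phi> s p) has_real_derivative D) (at t within I)" unfolding D_def by (rule evolution'[OF t])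
  then have dE: "((\<lambda>s. exp (- \<phi> s p)) has_real_derivative exp (- \<phi> t p) * - D) (at t within I)"
    by (intro derivative_intros)
  have "((\<lambda>s. C s * exp (- \<phi> s p)) has_real_derivative
      u t p * (LapM \<phi> t p - IPM \<phi> \<phi> t p + trM t p)) (at t within I)"
    by (rule DERIV_cong[OF DERIV_mult[OF dC dE]]) (simp add: u_def weight_def C_def D_def algebra_simps)
  then show "((\<lambda>s. u s p) has_real_derivative u t p * (LapM \<phi> t p - IPM \<phi> \<phi> t p + trM t p)) (at t within I)"
    by (simp add: u_def weight_def C_def)
qed

lemma pd_u:
  assumes t: "t \<in> I" and c: "c \<in> \<A>" "p \<in> dom_of c"
  shows "pd c i (u t) p = - u t p * pd c i (\<phi> t) p"
proof -
  define C where "C = (4 * pi * (t - T)) powr (- real CARD('n) / 2)"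
  have y: "coord c p \<in> range_of c" using c by auto
  have "((\<lambda>y. C * exp (- (\<phi> t \<circ> inv_coord c) y)) has_derivative
      (\<lambda>v. C * (exp (- (\<phi> t \<circ> inv_coord c) (coord c p)) * - frechet_derivative (\<phi> t \<circ> inv_coord c) (at (coord c p)) v))) (at (coord c p))"
    by (rule has_derivative_eq_rhs, (rule has_derivative_mult_right has_derivative_exp has_derivative_minus C1_derivative[OF sm_C1[OF sm_phi t] c(1) y])+)
       (simp add: mult_ac)
  then have "((u t \<circ> inv_coord c) has_derivative
      (\<lambda>v. C * (exp (- (\<phi> t \<circ> inv_coord c) (coord c p)) * - frechet_derivative (\<phi> t \<circ> inv_coord c) (at (coord c p)) v))) (at (coord c p))"
    by (simp add: u_def weight_def C_def comp_def)
  from pd_eqI[OF this] show ?thesis using c by (simp add: pd_def u_def weight_def C_def)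
qed

lemma IPM_u:
  assumes F: "sm F" and t: "t \<in> I"
  shows "IPM F u t p = - u t p * IPM F \<phi> t p"
proof -
  interpret M: metric_manifold \<A> "g t" by (rule metric_manifold[OF t])
  show ?thesis
    unfolding IPM_at[OF F sm_u t chart_at] IPM_at[OF F sm_phi t chart_at] M.ip_def pd_u[OF t chart_at]
    by (simp add: sum_distrib_left sum_negf mult_ac)
qed

text \<open>\<open>entropy_identity\<close> read in the chart that \<open>on_M\<close> selects at p;
  every term of it is the coordinate expression of a global scalar.\<close>

lemma integrand_identity:
  assumes t: "t \<in> I"
  shows "2 * (t - T) * (norm_sq_M \<A> (g t) (expander_tensor T g \<alpha> \<phi> t) p
      + Theta \<A> I g \<alpha> t (neg_gradient (g t) (\<phi> t)) p)
    = TD w t p + LapM w t p - 2 * IPM \<phi> w t p"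
proof -
  define c where "c = chart_at \<A> p"
  have c: "c \<in> \<A>" "p \<in> dom_of c" using chart_at by (auto simp: c_def)
  note cr = c(1) open_range[OF c(1)] order_refl[of "range_of c"]
  interpret geom_flow I "range_of c" "Gc c" "Gic c" "rhoc c" "alc c" by (rule geom_flow_chart[OF cr])
  define \<Phi> where "\<Phi> = up c \<phi>"
  define s where "s = (\<lambda>x :: real \<times> (real ^ 'n). fst x - T)"
  have y: "coord c p \<in> range_of c" using c by auto
  let ?x = "(t, coord c p)"
  have x: "?x \<in> Q" using t y by auto
  have r: "rep c (range_of c) \<phi> \<Phi>" unfolding \<Phi>_def by (rule rep_up[OF sm_phi c(1)])
  have sP: "smooth \<Phi>" using r by (simp add: rep_def)
  have ss: "smooth s"
    unfolding s_def using smooth_on_affine_precompose[OF smooth_sigma bounded_linear_fst, of Q 0] by auto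
  have ds: "dirD Q v s x = fst v" if "x \<in> Q" for v x
    by (rule dirD_eqI[OF ample_Q that]) (auto simp: s_def intro!: derivative_eq_intros)
  have at: "LapM \<phi> t' (inv_coord c y') = Lap \<Phi> (t', y')" "IPM \<phi> \<phi> t' (inv_coord c y') = Pr \<Phi> \<Phi> (t', y')"
    "trM t' (inv_coord c y') = trA (t', y')" "\<phi> t' (inv_coord c y') = \<Phi> (t', y')"
    if "t' \<in> I" "y' \<in> range_of c" for t' y'
    using rep_LapM[OF c(1) sm_phi] rep_IPM[OF c(1) sm_phi sm_phi] rep_trM[OF c(1)] r that
    unfolding rep_def \<Phi>_def by blast+
  have upw: "up c w x' = dens s \<Phi> x'" if xQ: "x' \<in> Q" for x'
  proof -
    obtain t' y' where "x' = (t', y')" "t' \<in> I" "y' \<in> range_of c" using xQ by blast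
    then show ?thesis by (simp add: up_def w_def dens_def s_def at)
  qed
  have evo: "dt \<Phi> x' = - Lap \<Phi> x' + Pr \<Phi> \<Phi> x' - trA x' - real CARD('n) / (2 * s x')" if xQ: "x' \<in> Q" for x'
  proof -
    obtain t' y' where x': "x' = (t', y')" "t' \<in> I" "y' \<in> range_of c" using xQ by blast
    have "((\<lambda>s. \<Phi> (s, y')) has_real_derivative
       (- LapM \<phi> t' (inv_coord c y') + IPM \<phi> \<phi> t' (inv_coord c y') - trM t' (inv_coord c y') - real CARD('n) / (2 * (t' - T)))) (at t' within I)"
      using evolution'[OF x'(2), of "inv_coord c y'"] by (simp add: \<Phi>_def up_def)
    from dt_eqI[OF sP x'(2,3) this] show ?thesis by (simp add: x'(1) at[OF x'(2,3)] s_def)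
  qed
  have "dt (dens s \<Phi>) ?x + Lap (dens s \<Phi>) ?x - 2 * Pr \<Phi> (dens s \<Phi>) ?x = 2 * s ?x * (NS s \<Phi> ?x + Th \<Phi> ?x)"
    by (rule entropy_identity[OF sP ss _ _ _ evo x]) (use ds sigma_pos in \<open>auto simp: s_def\<close>)
  moreover have "TD w t p = dt (dens s \<Phi>) ?x"
    unfolding TD_chart(2)[OF c(1) sm_w t c(2)] by (rule dirD_cong[OF upw x])
  moreover have "LapM w t p = Lap (dens s \<Phi>) ?x"
    unfolding rep_D[OF cr rep_LapM[OF c(1) sm_w] t c(2) y] by (rule Lap_cong[OF upw x])
  moreover have "IPM \<phi> w t p = Pr \<Phi> (dens s \<Phi>) ?x"
    unfolding rep_D[OF cr rep_IPM[OF c(1) sm_phi sm_w] t c(2) y] \<Phi>_def[symmetric] by (rule Pr_cong[OF refl upw x])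
  moreover have "norm_sq_M \<A> (g t) (expander_tensor T g \<alpha> \<phi> t) p = NS s \<Phi> ?x"
    unfolding norm_sq_M_def on_M_def c_def[symmetric] s_def by (rule tensor_norm_eq[OF cr r t c(2) y])
  moreover have "Theta \<A> I g \<alpha> t (neg_gradient (g t) (\<phi> t)) p = Th \<Phi> ?x"
    unfolding Theta_def on_M_def c_def[symmetric] by (rule Theta_eq[OF cr r t c(2) y])
  ultimately show ?thesis by (simp add: s_def)
qed

lemma entropy_eq:
  assumes t: "t \<in> I"
  shows "expander_entropy \<A> T g \<alpha> \<phi> t = J t (\<lambda>p. w t p * u t p)"
proof -
  have "expander_entropy \<A> T g \<alpha> \<phi> t =
      J t (\<lambda>p. w t p * u t p - 2 * (t - T) * (u t p * LapM \<phi> t p + IPM \<phi> u t p))"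
    unfolding expander_entropy_def gradient_norm_sq_eq[OF t] trM_def[symmetric] u_def[symmetric]
    by (rule Bochner_Integration.integral_cong[OF refl])
       (simp add: IPM_u[OF sm_phi t] w_def algebra_simps)
  also have "\<dots> = J t (\<lambda>p. w t p * u t p) - J t (\<lambda>p. 2 * (t - T) * (u t p * LapM \<phi> t p + IPM \<phi> u t p))"
    by (rule Bochner_Integration.integral_diff)
       (intro sm_integrable[OF _ t] sm_mult sm_w sm_u integrable_mult_right sm_add sm_LapM sm_IPM sm_phi)+
  also have "\<dots> = J t (\<lambda>p. w t p * u t p)"
    using green_M[OF sm_phi sm_u t] by simp
  finally show ?thesis .
qed

lemma entropy_derivative:
  assumes t: "t \<in> I"
  shows "(expander_entropy \<A> T g \<alpha> \<phi> has_real_derivative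
    J t (\<lambda>p. 2 * (t - T) * (norm_sq_M \<A> (g t) (expander_tensor T g \<alpha> \<phi> t) p
      + Theta \<A> I g \<alpha> t (neg_gradient (g t) (\<phi> t)) p) * weight \<A> T \<phi> t p)) (at t within I)"
proof -
  have swu: "sm (\<lambda>t p. w t p * u t p)" by (intro sm_mult sm_w sm_u)
  have TD_wu: "TD (\<lambda>t p. w t p * u t p) t p = w t p * TD u t p + TD w t p * u t p" for p
    by (rule TD_eqI[OF _ t]) (rule DERIV_cong[OF DERIV_mult[OF TD_works[OF sm_w t] TD_works[OF sm_u t]]], simp)
  \<comment> \<open>The A of \<open>TD_u\<close> cancels that of the volume. Each of the two Green
    integrands contributes u times \<langle>\<nabla>\<phi>, \<nabla>w\<rangle> once, which accounts
    for the coefficient 2.\<close>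
  have "TD (\<lambda>t p. w t p * u t p) t p - trM t p * (w t p * u t p) =
     (TD w t p + LapM w t p - 2 * IPM \<phi> w t p) * u t p
     + ((w t p * u t p) * LapM \<phi> t p + IPM \<phi> (\<lambda>t p. w t p * u t p) t p)
     - (u t p * LapM w t p + IPM w u t p)" for p
    unfolding TD_wu TD_u[OF t] IPM_mult[OF sm_phi sm_w sm_u t] IPM_u[OF sm_phi t] IPM_u[OF sm_w t] IPM_sym[OF sm_w sm_phi t]
    by (simp add: algebra_simps)
  then have "J t (\<lambda>p. TD (\<lambda>t p. w t p * u t p) t p - trM t p * (w t p * u t p)) =
     J t (\<lambda>p. (TD w t p + LapM w t p - 2 * IPM \<phi> w t p) * u t p
     + ((w t p * u t p) * LapM \<phi> t p + IPM \<phi> (\<lambda>t p. w t p * u t p) t p)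
     - (u t p * LapM w t p + IPM w u t p))" by simp
  also have "\<dots> = J t (\<lambda>p. (TD w t p + LapM w t p - 2 * IPM \<phi> w t p) * u t p)
     + J t (\<lambda>p. (w t p * u t p) * LapM \<phi> t p + IPM \<phi> (\<lambda>t p. w t p * u t p) t p)
     - J t (\<lambda>p. u t p * LapM w t p + IPM w u t p)"
  proof -
    have 1: "integrable (riemannian_volume \<A> (g t)) (\<lambda>p. (TD w t p + LapM w t p - 2 * IPM \<phi> w t p) * u t p)"
      by (intro sm_integrable[OF _ t] sm_mult sm_add sm_diff sm_TD sm_LapM sm_IPM sm_w sm_phi sm_u sm_time smooth_on_const)
    have 2: "integrable (riemannian_volume \<A> (g t)) (\<lambda>p. (w t p * u t p) * LapM \<phi> t p + IPM \<phi> (\<lambda>t p. w t p * u t p) t p)"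
      by (intro sm_integrable[OF _ t] sm_mult sm_add sm_LapM sm_IPM sm_w sm_phi sm_u)
    have 3: "integrable (riemannian_volume \<A> (g t)) (\<lambda>p. u t p * LapM w t p + IPM w u t p)"
      by (intro sm_integrable[OF _ t] sm_mult sm_add sm_LapM sm_IPM sm_w sm_phi sm_u)
    show ?thesis using 1 2 3 by simp
  qed
  also have "\<dots> = J t (\<lambda>p. (TD w t p + LapM w t p - 2 * IPM \<phi> w t p) * u t p)"
    using green_M[OF sm_phi swu t] green_M[OF sm_w sm_u t] by simp
  finally have e: "J t (\<lambda>p. TD (\<lambda>t p. w t p * u t p) t p - trM t p * (w t p * u t p)) = \<dots>" .
  have "((\<lambda>s. J s (\<lambda>p. w s p * u s p)) has_real_derivative
      J t (\<lambda>p. (TD w t p + LapM w t p - 2 * IPM \<phi> w t p) * u t p)) (at t within I)"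
    using has_derivative_integral_M[OF swu t] unfolding e .
  from has_field_derivative_transform_within[OF this zero_less_one t entropy_eq[symmetric]]
  show ?thesis unfolding integrand_identity[OF t] u_def by simp
qed

text \<open>\<open>Theta_nonneg\<close> quantifies over smooth vector fields, so - \<nabla>\<phi>
  has to be recognised as one before the sign of \<Theta> can be used.\<close>

lemma smooth_neg_gradient: "smooth_vector_field \<A> I (\<lambda>t. neg_gradient (g t) (\<phi> t))"
  unfolding smooth_vector_field_def
proof (intro conjI ballI)
  fix t assume t: "t \<in> I"
  show "is_vector_field \<A> (neg_gradient (g t) (\<phi> t))"
    unfolding is_vector_field_def
  proof (intro ballI)
    fix c d p assume c: "c \<in> \<A>" and d: "d \<in> \<A>" and "p \<in> dom_of c \<inter> dom_of d"
    then have p: "p \<in> dom_of c" "p \<in> dom_of d" by blast+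
    show "neg_gradient (g t) (\<phi> t) d p = transition_jacobian c d p *v neg_gradient (g t) (\<phi> t) c p"
      unfolding neg_gradient_def metric_manifold.gradient_transform[OF metric_manifold[OF t] c d p sm_C1[OF sm_phi t]]
      by (simp add: matrix_vector_mult_def vec_eq_iff sum_negf)
  qed
next
  fix c :: "('m, 'n) chart" assume c: "c \<in> \<A>"
  interpret geom_flow I "range_of c" "Gc c" "Gic c" "rhoc c" "alc c"
    by (rule geom_flow_chart[OF c open_range[OF c] order_refl])
  have r: "rep c (range_of c) \<phi> (up c \<phi>)" by (rule rep_up[OF sm_phi c])
  have "smooth_on (\<lambda>x. - V (up c \<phi>) i x) Q" for i
    using r unfolding rep_def by (intro smooth_intros) blast
  then have "smooth_on (\<lambda>x. (\<chi> i. - V (up c \<phi>) i x)) Q"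
    by (intro smooth_on_vec) simp
  moreover have "(\<lambda>(t, y). neg_gradient (g t) (\<phi> t) c (inv_coord c y)) x = (\<chi> i. - V (up c \<phi>) i x)" if xQ: "x \<in> Q" for x
  proof -
    obtain t y where x: "x = (t, y)" "t \<in> I" "y \<in> range_of c" using xQ by blast
    then have "inv_coord c y \<in> dom_of c" "coord c (inv_coord c y) \<in> range_of c" and e: "coord c (inv_coord c y) = y" using c by auto
    from this(1,2) show ?thesis
      using gradient_eq[OF c open_range[OF c] order_refl r x(2), of "inv_coord c y", unfolded e] x(3)
      by (simp add: x(1) neg_gradient_def vec_eq_iff)
  qed
  ultimately show "smooth_on (\<lambda>(t, y). neg_gradient (g t) (\<phi> t) c (inv_coord c y)) Q"
    by (subst smooth_on_cong)
qed

lemma matrix_matrix_add_rdistrib: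
  fixes A B :: "'a::semiring_1 ^ 'k::finite ^ 'l::finite"
  shows "(A + B) ** (C :: 'a ^ 'o::finite ^ 'k) = A ** C + B ** C"
  by (simp add: matrix_matrix_mult_def vec_eq_iff distrib_right sum.distrib)

text \<open>All three summands obey the covariant transformation law, the Hessian by
  \<open>hessian_transform\<close>; vanishing at p therefore passes from one chart to
  another.\<close>

lemma expander_tensor_transform:
  assumes t: "t \<in> I" and cd: "c \<in> \<A>" "d \<in> \<A>" "p \<in> dom_of c" "p \<in> dom_of d"
    and z: "expander_tensor T g \<alpha> \<phi> t d p = 0"
  shows "expander_tensor T g \<alpha> \<phi> t c p = 0"
proof -
  let ?J = "transition_jacobian c d p"
  have "is_symmetric_tensor \<A> (\<alpha> t)"
    using abstract_flow t unfolding abstract_geometric_flow_def smooth_symmetric_tensor_def by blast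
  then have a: "\<alpha> t c p = transpose ?J ** \<alpha> t d p ** ?J"
    using cd unfolding is_symmetric_tensor_def by blast
  have "expander_tensor T g \<alpha> \<phi> t c p = transpose ?J ** expander_tensor T g \<alpha> \<phi> t d p ** ?J"
    unfolding expander_tensor_def a metric_manifold.g_transform[OF metric_manifold[OF t] cd]
      hessian_transform[OF cd t rep_up[OF sm_phi cd(1)] rep_up[OF sm_phi cd(2)]]
    by (simp add: matrix_add_ldistrib matrix_matrix_add_rdistrib matrix_scalar_ac scalar_matrix_assoc flip: scalar_mult_eq_scaleR)
  then show ?thesis unfolding z by simp
qed

context
  assumes nonneg: "Theta_nonneg \<A> I g \<alpha>"
begin

lemma terms_nonneg:
  assumes t: "t \<in> I"
  shows "norm_sq_M \<A> (g t) (expander_tensor T g \<alpha> \<phi> t) p \<ge> 0"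
    and "Theta \<A> I g \<alpha> t (neg_gradient (g t) (\<phi> t)) p \<ge> 0"
  using metric_manifold.tensor_norm_sq_nonneg(1)[OF metric_manifold[OF t] chart_at] nonneg smooth_neg_gradient t
  unfolding norm_sq_M_def on_M_def Theta_nonneg_def by blast+

lemma integrand_nonneg:
  assumes t: "t \<in> I"
  shows "2 * (t - T) * (norm_sq_M \<A> (g t) (expander_tensor T g \<alpha> \<phi> t) p
      + Theta \<A> I g \<alpha> t (neg_gradient (g t) (\<phi> t)) p) * weight \<A> T \<phi> t p \<ge> 0"
  using terms_nonneg[OF t] sigma_pos[OF t] u_pos[OF t, of p] unfolding u_def
  by (intro mult_nonneg_nonneg add_nonneg_nonneg) auto

text \<open>The mean value theorem on [r, s], to which the derivative within \<open>I\<close>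
  restricts.\<close>

lemma entropy_mono: "mono_on I (expander_entropy \<A> T g \<alpha> \<phi>)"
proof (rule mono_onI)
  fix r s assume rs: "r \<in> I" "s \<in> I" "r \<le> s"
  have sub: "{r..s} \<subseteq> I" using mem_is_interval_1_I[OF interval(1) rs(1,2)] by auto
  show "expander_entropy \<A> T g \<alpha> \<phi> r \<le> expander_entropy \<A> T g \<alpha> \<phi> s"
  proof (cases "r = s")
    case False
    then have "r < s" using rs by simp
    let ?E = "\<lambda>t. J t (\<lambda>p. 2 * (t - T) * (norm_sq_M \<A> (g t) (expander_tensor T g \<alpha> \<phi> t) p
      + Theta \<A> I g \<alpha> t (neg_gradient (g t) (\<phi> t)) p) * weight \<A> T \<phi> t p)"
    have "\<exists>t\<in>{r<..<s}. expander_entropy \<A> T g \<alpha> \<phi> s - expander_entropy \<A> T g \<alpha> \<phi> r = ?E t * (s - r)"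
    proof (rule mvt_simple[OF \<open>r < s\<close>])
      fix t assume "r \<le> t" "t \<le> s"
      then have t: "t \<in> I" using sub by force
      show "(expander_entropy \<A> T g \<alpha> \<phi> has_derivative (*) (?E t)) (at t within {r..s})"
        using has_derivative_subset[OF entropy_derivative[OF t, unfolded has_field_derivative_def] sub] .
    qed
    then obtain t where "t \<in> {r<..<s}" "expander_entropy \<A> T g \<alpha> \<phi> s - expander_entropy \<A> T g \<alpha> \<phi> r = ?E t * (s - r)"
      by (elim bexE)
    moreover have "?E t \<ge> 0" if "t \<in> {r<..<s}" for t
    proof (rule Bochner_Integration.integral_nonneg)
      show "0 \<le> 2 * (t - T) * (norm_sq_M \<A> (g t) (expander_tensor T g \<alpha> \<phi> t) p
        + Theta \<A> I g \<alpha> t (neg_gradient (g t) (\<phi> t)) p) * weight \<A> T \<phi> t p" for p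
        by (rule integrand_nonneg) (use that sub in force)
    qed
    ultimately have "0 \<le> ?E t" "expander_entropy \<A> T g \<alpha> \<phi> s - expander_entropy \<A> T g \<alpha> \<phi> r = ?E t * (s - r)"
      by blast+
    moreover have "0 \<le> ?E t * (s - r)" by (rule mult_nonneg_nonneg) (use \<open>0 \<le> ?E t\<close> \<open>r < s\<close> in linarith)+
    ultimately show ?thesis by linarith
  qed simp
qed

text \<open>The nonnegative integrand has integral 0, hence vanishes almost everywhere, and by
  continuity everywhere. As \<sigma> and the weight are positive and both summands nonnegative, each
  summand is zero.\<close>

lemma equality_case:
  assumes t: "t \<in> I" and zero: "(expander_entropy \<A> T g \<alpha> \<phi> has_real_derivative 0) (at t within I)"
  shows "\<And>c p. c \<in> \<A> \<Longrightarrow> p \<in> dom_of c \<Longrightarrow> expander_tensor T g \<alpha> \<phi> t c p = 0"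
    and "\<And>p. Theta \<A> I g \<alpha> t (neg_gradient (g t) (\<phi> t)) p = 0"
proof -
  interpret M: metric_manifold \<A> "g t" by (rule metric_manifold[OF t])
  define f where "f p = (TD w t p + LapM w t p - 2 * IPM \<phi> w t p) * u t p" for p
  have f_eq: "f p = 2 * (t - T) * (norm_sq_M \<A> (g t) (expander_tensor T g \<alpha> \<phi> t) p
      + Theta \<A> I g \<alpha> t (neg_gradient (g t) (\<phi> t)) p) * weight \<A> T \<phi> t p" for p
    unfolding f_def u_def integrand_identity[OF t] ..
  have sf: "sm (\<lambda>t p. (TD w t p + LapM w t p - 2 * IPM \<phi> w t p) * u t p)"
    by (intro sm_mult sm_add sm_diff sm_TD sm_LapM sm_IPM sm_w sm_phi sm_u sm_time smooth_on_const)
  have f0: "f p \<ge> 0" for p unfolding f_eq by (rule integrand_nonneg[OF t])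
  have fc: "continuous_on UNIV f" using sm_continuous[OF sf t] unfolding f_def .
  have fi: "integrable M.RV f" by (rule M.integrable_continuous_RV[OF fc])
  have "J t f = 0"
    using vector_derivative_unique_within[OF slab.at_I_nontrivial[OF slab_chart[OF chart_at(1)] t]]
      entropy_derivative[OF t] zero unfolding has_real_derivative_iff_has_vector_derivative f_eq[symmetric] by blast
  then have ae: "AE p in M.RV. f p = 0"
    using integral_nonneg_eq_0_iff_AE[OF fi] f0 by (simp add: M.RV_def)
  have fz: "f p = 0" for p
  proof (rule ccontr)
    assume "f p \<noteq> 0"
    then have fp: "f p > 0" using f0[of p] by simp
    let ?c = "chart_at \<A> p"
    \<comment> \<open>If \<open>f p\<close> were positive, this would be a nonempty open part of a
      chart contained in a null set.\<close>
    define W where "W = dom_of ?c \<inter> f -` {0<..}"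
    have oW: "open W"
      unfolding W_def using open_dom[OF chart_at(1)] continuous_on_open_vimage[OF open_UNIV, of f] fc by auto
    have "emeasure M.RV W = 0"
    proof -
      have "{p \<in> space M.RV. \<not> f p = 0} \<in> sets M.RV"
        using M.measurable_RV[OF borel_measurable_continuous_onI[OF fc]] by measurable
      then have "emeasure M.RV {p \<in> space M.RV. \<not> f p = 0} = 0"
        using ae AE_iff_measurable[of "{p \<in> space M.RV. \<not> f p = 0}" M.RV "\<lambda>p. f p = 0"] by simp
      moreover have "W \<subseteq> {p \<in> space M.RV. \<not> f p = 0}" by (auto simp: W_def)
      ultimately show ?thesis
        using emeasure_mono[OF _ \<open>{p \<in> space M.RV. \<not> f p = 0} \<in> sets M.RV\<close>, of W] by simp
    qed
    moreover have "emeasure M.RV W \<noteq> 0"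
      by (rule M.RV_open_pos[OF chart_at(1) oW]) (use fp chart_at in \<open>auto simp: W_def\<close>)
    ultimately show False by simp
  qed
  have both: "norm_sq_M \<A> (g t) (expander_tensor T g \<alpha> \<phi> t) p = 0 \<and> Theta \<A> I g \<alpha> t (neg_gradient (g t) (\<phi> t)) p = 0" for p
  proof -
    have "norm_sq_M \<A> (g t) (expander_tensor T g \<alpha> \<phi> t) p + Theta \<A> I g \<alpha> t (neg_gradient (g t) (\<phi> t)) p = 0"
      using fz[of p] sigma_pos[OF t] u_pos[OF t, of p] unfolding f_eq u_def by auto
    then show ?thesis using terms_nonneg[OF t, of p] by (simp add: add_nonneg_eq_0_iff)
  qed
  then show "\<And>p. Theta \<A> I g \<alpha> t (neg_gradient (g t) (\<phi> t)) p = 0" by blast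
  fix c p assume c: "c \<in> \<A>" "p \<in> dom_of c"
  have "expander_tensor T g \<alpha> \<phi> t (chart_at \<A> p) p = 0"
    by (rule M.tensor_norm_sq_nonneg(2)[OF chart_at]) (use both[of p] in \<open>simp add: norm_sq_M_def on_M_def\<close>)
  then show "expander_tensor T g \<alpha> \<phi> t c p = 0"
    by (rule expander_tensor_transform[OF t c(1) chart_at(1) c(2) chart_at(2)])
qed

end

end

theorem theorem6p2:
  fixes \<A> :: "('m::t2_space, 'n::finite) chart set"
    and I :: "real set" and T :: real
    and g \<alpha> :: "real \<Rightarrow> ('m, 'n) tensor2"
    and \<phi> :: "real \<Rightarrow> 'm \<Rightarrow> real"
  assumes compact_M: "compact (UNIV :: 'm set)"
    and atlas: "smooth_atlas \<A>"
    and interval: "is_interval I" "interior I \<noteq> {}" "I \<subseteq> {T<..}"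
    and flow: "abstract_geometric_flow \<A> I g \<alpha>"
    and smooth_phi: "smooth_scalar \<A> I \<phi>"
    and evolution: "\<And>t p. t \<in> I \<Longrightarrow>
      ((\<lambda>s. \<phi> s p) has_real_derivative
        (- laplacian_M \<A> (g t) (\<phi> t) p + gradient_norm_sq \<A> (g t) (\<phi> t) p
         - trace_M \<A> (g t) (\<alpha> t) p - real CARD('n) / (2 * (t - T)))) (at t within I)"
    and normalized: "\<And>t. t \<in> I \<Longrightarrow>
      (\<integral>p. weight \<A> T \<phi> t p \<partial>riemannian_volume \<A> (g t)) = 1"
  shows "(\<forall>t\<in>I. (expander_entropy \<A> T g \<alpha> \<phi> has_real_derivative
            (\<integral>p. 2 * (t - T) *
                  (norm_sq_M \<A> (g t) (expander_tensor T g \<alpha> \<phi> t) p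
                   + Theta \<A> I g \<alpha> t (neg_gradient (g t) (\<phi> t)) p) *
                  weight \<A> T \<phi> t p \<partial>riemannian_volume \<A> (g t))) (at t within I)) \<and>
         (Theta_nonneg \<A> I g \<alpha> \<longrightarrow>
            mono_on I (expander_entropy \<A> T g \<alpha> \<phi>) \<and>
            (\<forall>t\<in>I. (expander_entropy \<A> T g \<alpha> \<phi> has_real_derivative 0) (at t within I) \<longrightarrow>
               (\<forall>c\<in>\<A>. \<forall>p\<in>dom_of c. expander_tensor T g \<alpha> \<phi> t c p = 0) \<and>
               (\<forall>p. Theta \<A> I g \<alpha> t (neg_gradient (g t) (\<phi> t)) p = 0)))"
proof -
  interpret entropy_flow \<A> I g \<alpha> T \<phi>
    by unfold_locales (fact compact_M atlas interval flow smooth_phi evolution)+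
  show ?thesis
    using entropy_derivative entropy_mono equality_case by blast
qed

end
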